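(* Let $k\ge2$ and $d\ge1$ be integers, let $a_0(x),\dots,a_d(x)\in\mathbb{Z}[x]$ with $a_0(x)a_d(x)\neq0$, and suppose $F(x)=\sum_{n\ge0}f(n)x^n\in\mathbb{Z}[[x]]$ satisfies $\sum_{i=0}^d a_i(x)F(x^{k^i})=0$. Let $H=\max\{1,\deg a_0(x),\dots,\deg a_d(x)\}$ and let $h$ be the maximum of $\max\{|f(0)|,\dots,|f(H)|\}$ and of the absolute values of the coefficients of $a_0(x),\dots,a_d(x)$. Let $a,b$ be integers with $a\neq0$, $b\ge2$, such that $a/b$ is in the radius of convergence of $F(x)$ and $\log|a|/\log b\in[0,1/(8H^2dk^{2d+1}))$. Then $$\mu(F(a/b))\le(4dHh^3)^{1536H^6k^{10d}d^2}\,k^{320H^4k^{6d}d^2}.$$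
   Context: The irrationality exponent $\mu(\xi)$ of a real $\xi$ is the supremum of the real $\mu$ such that $0<|\xi-p/q|<q^{-\mu}$ has infinitely many solutions $(p,q)\in\mathbb{Z}\times\mathbb{N}$. No condition on the nonvanishing of $a_0((a/b)^{k^n})$ is assumed. *)

theory Defs
  imports "HOL-Analysis.FPS_Convergence" "HOL-Computational_Algebra.Polynomial_FPS"
begin

text \<open>The supremum is taken in the extended reals, so that Liouville numbers have exponent
  \<open>\<infinity>\<close>. Solutions are counted as pairs, not as fractions in lowest terms.\<close>

definition irrationality_exponent :: "real \<Rightarrow> ereal" where
  "irrationality_exponent \<xi> =
     (SUP \<mu> \<in> {\<mu> :: real. infinite {(p :: int, q :: nat). q > 0 \<and>
          0 < \<bar>\<xi> - of_int p / of_nat q\<bar> \<and>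
          \<bar>\<xi> - of_int p / of_nat q\<bar> < of_nat q powr (- \<mu>)}}. ereal \<mu>)"

definition real_fps :: "int fps \<Rightarrow> real fps" where
  "real_fps F = Abs_fps (\<lambda>n. real_of_int (fps_nth F n))"

definition mahler_equation :: "nat \<Rightarrow> nat \<Rightarrow> (nat \<Rightarrow> int poly) \<Rightarrow> int fps \<Rightarrow> bool" where
  "mahler_equation k d A F \<longleftrightarrow>
     (\<Sum>i\<le>d. fps_of_poly (A i) * (F oo fps_X ^ (k ^ i))) = 0"

end

theory Submission
  imports Defs
begin

text \<open>Write \<open>f\<^sub>i = F(x^k^i)\<close> for \<open>i < d\<close>. A zero estimate bounds the order of vanishing of nonzero
  polynomial combinations of \<open>1, f\<^sub>0, \<dots>, f\<^sub>d\<^sub>-\<^sub>1\<close> linearly in the degree. By duality, the simultaneous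
  approximants \<open>(Q; P\<^sub>i)\<close> with \<open>deg \<le> D\<close> and \<open>Q f\<^sub>i - P\<^sub>i = O(x^M)\<close> then separate, at every point, all
  linear functionals that do not vanish on \<open>(1; f\<^sub>i)\<close>; here \<open>D\<close> is so much smaller than \<open>M\<close> that
  the hypothesis on \<open>log |a| / log b\<close> applies. A fixed finite set of integral approximants, evaluated at \<open>(a/b)^k^n\<close>
  and carried back to \<open>F(a/b)\<close> by iterating the equation \<open>n\<close> times, gives for each \<open>n\<close> integral linear
  forms in \<open>1\<close> and \<open>F(a/b)\<close> that do not all vanish at a given rational point. Their coefficients are bounded by
  and their values decay like powers of \<open>b^k^n\<close> with exponents not depending on \<open>h\<close>, which bounds the
  irrationality exponent in terms of \<open>k\<close>, \<open>d\<close> and \<open>H\<close> only. If the leading coefficient \<open>\<Prod>\<^sub>j a\<^sub>0(x^k^j)\<close> of the iterated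
  equation vanishes at \<open>a/b\<close>, to order \<open>s \<le> H\<close>, then the \<open>s\<close>-th derivative at \<open>a/b\<close> is used in place of the
  value.\<close>

text \<open>The approximants must be fixed before \<open>n\<close>, whereas the order
  \<open>s\<close> of vanishing of the denominator at \<open>x\<close> depends on \<open>n\<close>.
  Duality modulo a power with exponent \<open>t = s + 1\<close> needs
  \<open>\<delta> + D + 2 = M + t\<close>. With \<open>\<delta> = 3 * H + s\<close> the order
  \<open>s\<close> drops out and leaves \<open>3 * H + D + 1 = M\<close>, while
  \<open>s \<le> H\<close> keeps \<open>\<delta> \<le> 4 * H\<close>. This is why the zero estimate
  is used in degree \<open>4 * H\<close>, which fixes \<open>M\<close>. At \<open>x^k^n\<close>,
  clearing denominators costs \<open>b^((D + H) * k^n)\<close>, and the remainder gains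
  \<open>(|a| / b)^(M * k^n)\<close>. Since \<open>M - (D + H + 1) = 2 * H\<close>, a positive power
  of \<open>b^k^n\<close> is saved once \<open>|a|^M \<le> b^(2 * H)\<close>, which is what the
  hypothesis on \<open>log |a| / log b\<close> provides. The height \<open>h\<close> enters through
  a product of \<open>n\<close> factors and the size of the approximants through a constant, and any
  \<open>Z * c^n\<close> is negligible against a power of \<open>b^k^n\<close>.\<close>

unbundle no vec_syntax
unbundle fps_syntax

section \<open>Power series with bounded degree or order\<close>

text \<open>Polynomials are kept as power series with a degree bound, so that \<open>F\<close>, its
  dilations, polynomials and quotients by linear factors all live in one type.\<close>

definition deg_le :: "nat \<Rightarrow> 'a::zero fps \<Rightarrow> bool" where
  "deg_le D G \<longleftrightarrow> (\<forall>m>D. G $ m = 0)"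

definition ord_ge :: "nat \<Rightarrow> 'a::zero fps \<Rightarrow> bool" where
  "ord_ge M G \<longleftrightarrow> (\<forall>m<M. G $ m = 0)"

abbreviation dil :: "nat \<Rightarrow> 'a::comm_ring_1 fps \<Rightarrow> 'a fps" where
  "dil m G \<equiv> G oo fps_X ^ m"

lemma deg_leD: "deg_le D G \<Longrightarrow> D < m \<Longrightarrow> G $ m = 0"
  by (simp add: deg_le_def)

lemma deg_le_mono: "deg_le D G \<Longrightarrow> D \<le> E \<Longrightarrow> deg_le E G"
  by (simp add: deg_le_def)

lemma deg_le_0 [simp]: "deg_le D 0"
  by (simp add: deg_le_def)

lemma deg_le_1 [simp]: "deg_le D (1 :: 'a::{zero_neq_one, comm_semiring_1} fps)"
  by (simp add: deg_le_def)

lemma deg_le_add: "deg_le D F \<Longrightarrow> deg_le D G \<Longrightarrow> deg_le D (F + G :: 'a::monoid_add fps)"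
  by (simp add: deg_le_def)

lemma deg_le_diff: "deg_le D F \<Longrightarrow> deg_le D G \<Longrightarrow> deg_le D (F - G :: 'a::group_add fps)"
  by (simp add: deg_le_def)

lemma deg_le_sum:
  "(\<And>i. i \<in> I \<Longrightarrow> deg_le D (G i)) \<Longrightarrow> deg_le D (\<Sum>i\<in>I. G i :: 'a::comm_monoid_add fps)"
  by (simp add: deg_le_def fps_sum_nth)

lemma deg_le_mult:
  fixes F G :: "'a::semiring_0 fps"
  assumes "deg_le a F" "deg_le b G"
  shows "deg_le (a + b) (F * G)"
  unfolding deg_le_def fps_mult_nth
proof (intro allI impI sum.neutral ballI)
  fix m i assume "a + b < m" "i \<in> {0..m}"
  then have "a < i \<or> b < m - i" by auto
  then show "F $ i * G $ (m - i) = 0" using assms by (auto simp: deg_le_def)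
qed

lemma deg_le_const [simp]: "deg_le D (fps_const c)"
  by (simp add: deg_le_def)

lemma deg_le_power:
  fixes F :: "'a::comm_semiring_1 fps"
  assumes "deg_le a F"
  shows "deg_le (n * a) (F ^ n)"
proof (induction n)
  case (Suc n)
  then show ?case using deg_le_mult[OF assms Suc] by simp
qed (simp add: deg_le_def)

lemma dil_nth:
  assumes "m > 0"
  shows "dil m G $ n = (if m dvd n then G $ (n div m) else 0)"
proof -
  have "dil m G $ n = (\<Sum>i=0..n. if n = m * i then G $ i else 0)"
    by (simp add: fps_compose_nth fps_X_power_nth flip: power_mult cong: if_cong)
       (rule sum.cong, auto)
  also have "\<dots> = (\<Sum>i\<in>{i. n = m * i}. G $ i)"
    using assms by (intro sum.mono_neutral_cong_right) auto
  also have "{i. n = m * i} = (if m dvd n then {n div m} else {})"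
    using assms by auto
  finally show ?thesis by simp
qed

lemma deg_le_dil:
  assumes "deg_le a G" "m > 0"
  shows "deg_le (m * a) (dil m G)"
  unfolding deg_le_def
proof (intro allI impI)
  fix n assume "m * a < n"
  then show "dil m G $ n = 0" using assms 
    by (auto simp: dil_nth deg_le_def elim!: dvdE)
qed

lemma ord_ge_mono: "ord_ge M G \<Longrightarrow> N \<le> M \<Longrightarrow> ord_ge N G"
  by (simp add: ord_ge_def)

lemma ord_ge_0 [simp]: "ord_ge M 0"
  by (simp add: ord_ge_def)

lemma ord_ge_uminus: "ord_ge M F \<Longrightarrow> ord_ge M (- F :: 'a::group_add fps)"
  by (simp add: ord_ge_def)

lemma ord_ge_sum:
  "(\<And>i. i \<in> I \<Longrightarrow> ord_ge D (G i)) \<Longrightarrow> ord_ge D (\<Sum>i\<in>I. G i :: 'a::comm_monoid_add fps)"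
  by (simp add: ord_ge_def fps_sum_nth)

lemma ord_ge_mult:
  fixes F G :: "'a::semiring_0 fps"
  assumes "ord_ge M G"
  shows "ord_ge M (F * G)"
  using assms by (auto simp: ord_ge_def fps_mult_nth intro!: sum.neutral)

lemma ord_ge_dil:
  assumes "ord_ge a G" "m > 0"
  shows "ord_ge (m * a) (dil m G)"
  using assms by (auto simp: ord_ge_def dil_nth elim!: dvdE)

lemma dil_add: "dil m (F + G) = dil m F + dil m G"
  by (rule fps_compose_add_distrib)

lemma dil_diff: "dil m (F - G) = dil m F - dil m (G :: 'a::comm_ring_1 fps)"
  by (rule fps_compose_sub_distrib)

lemma dil_mult: "m > 0 \<Longrightarrow> dil m (F * G) = dil m F * dil m (G :: 'a::idom fps)"
  by (rule fps_compose_mult_distrib) simp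

lemma dil_sum: "dil m (\<Sum>i\<in>I. G i) = (\<Sum>i\<in>I. dil m (G i))"
  by (rule fps_compose_sum_distrib)

lemma dil_dil: "m > 0 \<Longrightarrow> n > 0 \<Longrightarrow> dil m (dil n G) = dil (n * m) G"
  by (rule fps_ext)
     (auto simp: dil_nth div_mult2_eq mult.commute[of n m] dvd_mult_imp_div 
       intro: dvd_mult_left elim!: dvdE)

section \<open>Linear systems and polynomial relations\<close>

lemma underdetermined_system:
  fixes a :: "'i \<Rightarrow> 'j \<Rightarrow> 'a::field"
  assumes "finite I" "finite J" "card I < card J"
  shows "\<exists>x. (\<exists>j\<in>J. x j \<noteq> 0) \<and> (\<forall>i\<in>I. (\<Sum>j\<in>J. a i j * x j) = 0)"
  using assms
proof (induction I arbitrary: a J rule: finite_induct)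
  case empty
  then obtain j where "j \<in> J" by fastforce
  then show ?case by (intro exI[of _ "\<lambda>_. 1"]) auto
next
  case (insert i I)
  show ?case
  proof (cases "\<forall>j\<in>J. a i j = 0")
    case True
    obtain x where "\<exists>j\<in>J. x j \<noteq> 0" "\<forall>i\<in>I. (\<Sum>j\<in>J. a i j * x j) = 0"
      using insert.IH[of J a] insert.prems insert.hyps by auto
    then show ?thesis using True by (intro exI[of _ x]) auto
  next
    case False
    then obtain p where p: "p \<in> J" "a i p \<noteq> 0" by blast
    let ?J = "J - {p}"
    let ?b = "\<lambda>i' j. a i' j - a i' p * a i j / a i p"
    have "card I < card ?J" using insert p by simp
    then obtain x where x: "\<exists>j\<in>?J. x j \<noteq> 0" "\<forall>i'\<in>I. (\<Sum>j\<in>?J. ?b i' j * x j) = 0"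
      using insert.IH[of ?J ?b] insert.prems by auto
    define c where "c = - (\<Sum>j\<in>?J. a i j * x j) / a i p"
    define y where "y = x(p := c)"
    have split: "(\<Sum>j\<in>J. a i' j * y j) = a i' p * c + (\<Sum>j\<in>?J. a i' j * x j)" for i'
      using insert.prems p by (subst sum.remove[of J p]) (auto simp: y_def intro!: sum.cong)
    have "(\<Sum>j\<in>J. a i j * y j) = 0"
      using p by (simp add: split c_def)
    moreover have "(\<Sum>j\<in>J. a i' j * y j) = 0" if "i' \<in> I" for i'
    proof -
      have "(\<Sum>j\<in>?J. ?b i' j * x j) =
            (\<Sum>j\<in>?J. a i' j * x j) - a i' p / a i p * (\<Sum>j\<in>?J. a i j * x j)"
        by (simp add: sum_subtractf sum_distrib_left algebra_simps)
      then have "(\<Sum>j\<in>?J. a i' j * x j) = a i' p / a i p * (\<Sum>j\<in>?J. a i j * x j)"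
        using bspec[OF x(2) that] by simp
      then show ?thesis unfolding split c_def by simp
    qed
    moreover have "\<exists>j\<in>J. y j \<noteq> 0" using x(1) by (auto simp: y_def)
    ultimately show ?thesis by (intro exI[of _ y]) auto
  qed
qed

text \<open>Comparison of coefficients gives \<open>U * (R * T + 1)\<close> unknowns and
  \<open>R * (R * T + T + 1)\<close> equations. For \<open>U = R + 1\<close> the unknowns win by
  exactly one, which is where the degree \<open>R * T\<close> comes from.\<close>

lemma poly_kernel:
  fixes A :: "nat \<Rightarrow> nat \<Rightarrow> 'a::field fps"
  assumes deg: "\<And>u r. u < U \<Longrightarrow> r < R \<Longrightarrow> deg_le T (A u r)" and "R < U"
  shows "\<exists>e. (\<forall>u. deg_le (R * T) (e u)) \<and> (\<exists>u<U. e u \<noteq> 0) \<and>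
             (\<forall>r<R. (\<Sum>u<U. e u * A u r) = 0)"
proof -
  define J where "J = {..<U} \<times> {..R*T}"
  define I where "I = {..<R} \<times> {..R*T+T}"
  define a where "a = (\<lambda>(r,m) (u,j). if j \<le> m then A u r $ (m - j) else 0)"
  have "R * (R * T + T + 1) < (R + 1) * (R * T + 1)" by (simp add: algebra_simps)
  also have "\<dots> \<le> U * (R * T + 1)" using \<open>R < U\<close> by (intro mult_right_mono) auto
  finally have "card I < card J" by (simp add: I_def J_def)
  then obtain x where x: "\<exists>j\<in>J. x j \<noteq> 0" "\<forall>i\<in>I. (\<Sum>j\<in>J. a i j * x j) = 0"
    using underdetermined_system[of I J a] by (auto simp: I_def J_def)
  define e where "e = (\<lambda>u. Abs_fps (\<lambda>j. if j \<le> R*T then x (u,j) else 0))"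
  have dege: "deg_le (R * T) (e u)" for u by (simp add: e_def deg_le_def)
  moreover have "\<exists>u<U. e u \<noteq> 0" using x(1) by (auto simp: J_def e_def fps_eq_iff)
  moreover have "(\<Sum>u<U. e u * A u r) = 0" if "r < R" for r
  proof (rule fps_ext)
    fix m
    show "(\<Sum>u<U. e u * A u r) $ m = 0 $ m"
    proof (cases "m \<le> R*T+T")
      case True
      have "(\<Sum>u<U. e u * A u r) $ m = (\<Sum>u<U. \<Sum>j\<le>m. e u $ j * A u r $ (m - j))"
        by (simp add: fps_sum_nth fps_mult_nth atLeast0AtMost)
      also have "\<dots> = (\<Sum>u<U. \<Sum>j\<le>R*T. a (r,m) (u,j) * x (u,j))"
      proof (rule sum.cong[OF refl])
        fix u
        have "(\<Sum>j\<le>m. e u $ j * A u r $ (m - j)) = (\<Sum>j\<in>{..m}\<inter>{..R*T}. e u $ j * A u r $ (m - j))"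
          by (rule sum.mono_neutral_right) (auto simp: e_def)
        also have "\<dots> = (\<Sum>j\<in>{..m}\<inter>{..R*T}. a (r,m) (u,j) * x (u,j))"
          by (rule sum.cong) (auto simp: a_def e_def)
        also have "\<dots> = (\<Sum>j\<le>R*T. a (r,m) (u,j) * x (u,j))"
          by (rule sum.mono_neutral_left) (auto simp: a_def)
        finally show "(\<Sum>j\<le>m. e u $ j * A u r $ (m - j)) = (\<Sum>j\<le>R*T. a (r,m) (u,j) * x (u,j))" .
      qed
      also have "\<dots> = 0" using x(2) that True
        by (auto simp: J_def I_def sum.cartesian_product)
      finally show ?thesis by simp
    next
      case False
      have "deg_le (R*T+T) (\<Sum>u<U. e u * A u r)"
        using that deg dege by (intro deg_le_sum deg_le_mult) auto
      then show ?thesis using False by (simp add: deg_le_def)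
    qed
  qed
  ultimately show ?thesis by blast
qed

section \<open>A zero estimate for Mahler functions\<close>

text \<open>Multiplying \<open>y = \<Sum>\<^sub>i c\<^sub>i(x) F(x^k^i) - c'(x)\<close> out, its dilations \<open>y(x^k^j)\<close> for
  \<open>j \<le> d + 1\<close> and the equations \<open>\<Sum>\<^sub>i A\<^sub>i(x^k^l) F(x^k^(i+l)) = 0\<close> for \<open>l \<le> d\<close> are
  \<open>2d + 3\<close> expressions in \<open>1, F, F(x^k), \<dots>, F(x^k^(2d))\<close>. A polynomial relation among them is a
  Mahler equation for \<open>y\<close>, which bounds the order of vanishing of \<open>y\<close>.\<close>

lemma mahler_zero_estimate:
  fixes F :: "'a::field fps" and A c :: "nat \<Rightarrow> 'a fps"
  assumes k: "k \<ge> 2" and degA: "\<And>i. i \<le> d \<Longrightarrow> deg_le \<delta> (A i)" and A0: "A 0 \<noteq> 0"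
    and eq: "(\<Sum>i\<le>d. A i * dil (k ^ i) F) = 0"
    and degc: "\<And>i. i < d \<Longrightarrow> deg_le \<delta> (c i)" and degc': "deg_le \<delta> c'"
    and ord: "ord_ge ((2 * d + 2) * (k ^ (d + 1) * \<delta>) + 1) ((\<Sum>i<d. c i * dil (k ^ i) F) - c')"
  shows "(\<Sum>i<d. c i * dil (k ^ i) F) = c'"
proof (rule ccontr)
  define y where "y = (\<Sum>i<d. c i * dil (k ^ i) F) - c'"
  assume "(\<Sum>i<d. c i * dil (k ^ i) F) \<noteq> c'"
  then have y0: "y \<noteq> 0" by (simp add: y_def)
  have kpos: "k ^ i > 0" for i using k by simp
  define T where "T = k ^ (d + 1) * \<delta>"
  \<comment> \<open>Columns \<open>r \<le> 2 * d\<close> stand for \<open>F(x^k^r)\<close>, column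
    \<open>2 * d + 1\<close> for the constant 1. Both families of rows reach exactly up to
    \<open>r = 2 * d\<close>. The sign of \<open>c'\<close> is left out, since the last column
    enters only through a sum that vanishes.\<close>
  define rowc where "rowc = (\<lambda>j r. if r = 2*d+1 then dil (k^j) c' else
     if j \<le> r \<and> r < j + d then dil (k^j) (c (r - j)) else 0)"
  define rowA where "rowA = (\<lambda>l r. if r < 2*d+1 \<and> l \<le> r \<and> r \<le> l + d then dil (k^l) (A (r - l)) else 0)"
  define M where "M = (\<lambda>u r. if u < d + 2 then rowc u r else rowA (u - (d + 2)) r)"
  have T: "k ^ j * \<delta> \<le> T" if "j \<le> d + 1" for j
    unfolding T_def using k that by (intro mult_right_mono power_increasing) auto
  have "deg_le T (M u r)" if "u < 2*d+3" "r < 2*d+2" for u r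
    using that degA degc degc' unfolding M_def rowc_def rowA_def
    by (auto intro!: deg_le_mono[OF deg_le_dil[OF _ kpos]] T)
  then obtain e where dege: "\<And>u. deg_le ((2*d+2) * T) (e u)" and ene: "\<exists>u<2*d+3. e u \<noteq> 0"
    and rel: "\<And>r. r < 2*d+2 \<Longrightarrow> (\<Sum>u<2*d+3. e u * M u r) = 0"
    using poly_kernel[of "2*d+3" "2*d+2" T M] by auto
  have split: "(\<Sum>u<2*d+3. g u) = (\<Sum>j\<le>d+1. g j) + (\<Sum>l\<le>d. g (l + (d+2)))" for g :: "nat \<Rightarrow> 'a fps"
  proof -
    have "{..<2*d+3} = {..d+1} \<union> (\<lambda>l. l + (d+2)) ` {..d}"
    proof (intro set_eqI iffI)
      fix u assume "u \<in> {..<2*d+3}"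
      then show "u \<in> {..d+1} \<union> (\<lambda>l. l + (d+2)) ` {..d}"
        by (cases "u \<le> d+1") (auto intro!: image_eqI[of _ _ "u - (d+2)"])
    qed auto
    then have "(\<Sum>u<2*d+3. g u) = (\<Sum>j\<le>d+1. g j) + (\<Sum>u\<in>(\<lambda>l. l + (d+2)) ` {..d}. g u)"
      by (simp only:) (rule sum.union_disjoint; force)
    then show ?thesis by (simp only: sum.reindex inj_on_def) (simp add: sum.reindex inj_on_def)
  qed
  define w where "w = (\<lambda>l. e (l + (d+2)))"
  have rel': "(\<Sum>j\<le>d+1. e j * rowc j r) + (\<Sum>l\<le>d. w l * rowA l r) = 0" if "r < 2*d+2" for r
  proof -
    have "(\<Sum>j\<le>d+1. e j * M j r) = (\<Sum>j\<le>d+1. e j * rowc j r)"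
      by (rule sum.cong) (auto simp: M_def)
    moreover have "(\<Sum>l\<le>d. e (l+(d+2)) * M (l+(d+2)) r) = (\<Sum>l\<le>d. w l * rowA l r)"
      by (rule sum.cong) (auto simp: M_def w_def)
    ultimately show ?thesis using rel[OF that] unfolding split by simp
  qed
  have dil0: "dil m G \<noteq> 0" if "G \<noteq> 0" "m > 0" for m and G :: "'a fps"
  proof -
    have "dil m G $ (m * subdegree G) \<noteq> 0" using that by (simp add: dil_nth)
    then show ?thesis by auto
  qed
  \<comment> \<open>Otherwise the relation would involve the dilated equations only. These are in
    echelon form: column \<open>l\<close> meets only the rows up to \<open>l\<close>, and row
    \<open>l\<close> has the nonzero entry \<open>dil (k ^ l) (A 0)\<close> there, so all
    \<open>w l\<close> would vanish one after the other.\<close>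
  have "\<exists>j\<le>d+1. e j \<noteq> 0"
  proof (rule ccontr)
    assume "\<not> ?thesis"
    then have e0: "e j = 0" if "j \<le> d+1" for j using that by blast
    have w0: "l \<le> d \<longrightarrow> w l = 0" for l
    proof (induction l rule: less_induct)
      case (less l)
      show ?case
      proof
        assume l: "l \<le> d"
        have "0 = (\<Sum>l'\<le>d. w l' * rowA l' l)" using rel'[of l] l e0 by simp
        also have "\<dots> = (\<Sum>l'\<in>{l}. w l' * rowA l' l)"
        proof (rule sum.mono_neutral_right)
          show "\<forall>i\<in>{..d} - {l}. w i * rowA i l = 0"
          proof
            fix i assume "i \<in> {..d} - {l}"
            then show "w i * rowA i l = 0" using less.IH[of i] by (cases "i < l") (auto simp: rowA_def)
          qed
        qed (use l in auto)
        also have "\<dots> = w l * dil (k ^ l) (A 0)" using l by (simp add: rowA_def)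
        finally show "w l = 0" using dil0[OF A0 kpos] by simp
      qed
    qed
    obtain u where u: "u < 2*d+3" "e u \<noteq> 0" using ene by blast
    then have "u > d+1" using e0[of u] by (cases "u \<le> d+1") auto
    then have "w (u - (d+2)) = e u" unfolding w_def by (subst le_add_diff_inverse2) auto
    moreover have "u - (d+2) \<le> d" using u by linarith
    ultimately show False using w0[of "u - (d+2)"] u by simp
  qed
  then obtain j1 where j1: "j1 \<le> d+1" "e j1 \<noteq> 0" by blast
  \<comment> \<open>The terms after \<open>j0\<close> have order at least
    \<open>k ^ (j0 + 1) * v\<close>, but \<open>dil (k ^ j0) y\<close> has only order
    \<open>k ^ j0 * v\<close>. The factor \<open>e j0\<close> has to make up the difference, and its
    order is at most its degree.\<close>
  define j0 where "j0 = (LEAST j. e j \<noteq> 0)"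
  have j0: "j0 \<le> d+1" "e j0 \<noteq> 0"
    using LeastI[of "\<lambda>j. e j \<noteq> 0", OF j1(2)] Least_le[of "\<lambda>j. e j \<noteq> 0", OF j1(2)] j1(1)
    unfolding j0_def by auto
  have j0min: "e j = 0" if "j < j0" for j
    using not_less_Least[of j "\<lambda>j. e j \<noteq> 0"] that unfolding j0_def by blast
  have sy: "dil (k^j) y = (\<Sum>r<2*d+1. rowc j r * dil (k^r) F) - rowc j (2*d+1)" if "j \<le> d+1" for j
  proof -
    have "dil (k^j) y = (\<Sum>i<d. dil (k^j) (c i) * dil (k^(i+j)) F) - dil (k^j) c'"
      by (simp add: y_def dil_diff dil_sum dil_mult[OF kpos] dil_dil[OF kpos kpos] power_add)
    also have "(\<Sum>i<d. dil (k^j) (c i) * dil (k^(i+j)) F)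
       = (\<Sum>r\<in>(\<lambda>i. i + j) ` {..<d}. rowc j r * dil (k^r) F)"
      using that by (subst sum.reindex) (auto simp: rowc_def intro!: sum.cong)
    also have "\<dots> = (\<Sum>r<2*d+1. rowc j r * dil (k^r) F)"
    proof (rule sum.mono_neutral_left)
      show "\<forall>r\<in>{..<2*d+1} - (\<lambda>i. i+j) ` {..<d}. rowc j r * dil (k^r) F = 0"
      proof
        fix r assume r: "r \<in> {..<2*d+1} - (\<lambda>i. i+j) ` {..<d}"
        then have "\<not> (j \<le> r \<and> r < j + d)"
          by (auto simp: image_iff dest!: bspec[of _ _ "r - j"])
        then show "rowc j r * dil (k^r) F = 0" using r by (auto simp: rowc_def)
      qed
    qed (use that in auto)
    finally show ?thesis by (simp add: rowc_def)
  qed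
  have sA: "(\<Sum>r<2*d+1. rowA l r * dil (k^r) F) = 0" if "l \<le> d" for l
  proof -
    have "0 = dil (k^l) (\<Sum>i\<le>d. A i * dil (k ^ i) F)" by (simp add: eq)
    also have "\<dots> = (\<Sum>i\<le>d. dil (k^l) (A i) * dil (k^(i+l)) F)"
      by (simp add: dil_sum dil_mult[OF kpos] dil_dil[OF kpos kpos] power_add)
    also have "\<dots> = (\<Sum>r\<in>(\<lambda>i. i + l) ` {..d}. rowA l r * dil (k^r) F)"
      using that by (subst sum.reindex) (auto simp: rowA_def intro!: sum.cong)
    also have "\<dots> = (\<Sum>r<2*d+1. rowA l r * dil (k^r) F)"
    proof (rule sum.mono_neutral_left)
      show "\<forall>r\<in>{..<2*d+1} - (\<lambda>i. i+l) ` {..d}. rowA l r * dil (k^r) F = 0"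
      proof
        fix r assume r: "r \<in> {..<2*d+1} - (\<lambda>i. i+l) ` {..d}"
        then have "\<not> (l \<le> r \<and> r \<le> l + d)"
          by (auto simp: image_iff dest!: bspec[of _ _ "r - l"])
        then show "rowA l r * dil (k^r) F = 0" by (auto simp: rowA_def)
      qed
    qed (use that in auto)
    finally show ?thesis by simp
  qed
  have last: "(\<Sum>j\<le>d+1. e j * rowc j (2*d+1)) = 0"
    using rel'[of "2*d+1"] by (simp add: rowA_def)
  have "(\<Sum>j\<le>d+1. e j * dil (k^j) y) =
      (\<Sum>j\<le>d+1. (\<Sum>r<2*d+1. e j * rowc j r * dil (k^r) F) - e j * rowc j (2*d+1))"
  proof (rule sum.cong[OF refl])
    fix j assume "j \<in> {..d+1}"
    then have "dil (k^j) y = (\<Sum>r<2*d+1. rowc j r * dil (k^r) F) - rowc j (2*d+1)"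
      using sy[of j] by blast
    then show "e j * dil (k^j) y = (\<Sum>r<2*d+1. e j * rowc j r * dil (k^r) F) - e j * rowc j (2*d+1)"
      by (simp only: sum_distrib_left right_diff_distrib mult.assoc)
  qed
  also have "\<dots> = (\<Sum>j\<le>d+1. \<Sum>r<2*d+1. e j * rowc j r * dil (k^r) F)"
    by (simp only: sum_subtractf last diff_zero)
  also have "\<dots> = (\<Sum>r<2*d+1. (\<Sum>j\<le>d+1. e j * rowc j r) * dil (k^r) F)"
    by (subst sum.swap) (simp only: sum_distrib_right)
  also have "\<dots> = (\<Sum>r<2*d+1. - (\<Sum>l\<le>d. w l * rowA l r) * dil (k^r) F)"
  proof (rule sum.cong[OF refl])
    fix r assume "r \<in> {..<2*d+1}"
    then have "(\<Sum>j\<le>d+1. e j * rowc j r) = - (\<Sum>l\<le>d. w l * rowA l r)"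
      using rel'[of r] by (simp only: eq_neg_iff_add_eq_0) simp
    then show "(\<Sum>j\<le>d+1. e j * rowc j r) * dil (k^r) F = - (\<Sum>l\<le>d. w l * rowA l r) * dil (k^r) F"
      by (simp only:)
  qed
  also have "\<dots> = - (\<Sum>r<2*d+1. \<Sum>l\<le>d. w l * (rowA l r * dil (k^r) F))"
    by (simp only: mult_minus_left sum_negf sum_distrib_right mult.assoc)
  also have "\<dots> = - (\<Sum>l\<le>d. w l * (\<Sum>r<2*d+1. rowA l r * dil (k^r) F))"
    by (subst sum.swap) (simp only: sum_distrib_left)
  also have "\<dots> = 0"
  proof -
    have "(\<Sum>l\<le>d. w l * (\<Sum>r<2*d+1. rowA l r * dil (k^r) F)) = 0"
      using sA by (intro sum.neutral ballI) (simp only: atMost_iff mult_zero_right)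
    then show ?thesis by (simp only: minus_zero)
  qed
  finally have tot: "(\<Sum>j\<le>d+1. e j * dil (k^j) y) = 0" .
  define v where "v = subdegree y"
  have v: "ord_ge v y" by (auto simp: ord_ge_def v_def)
  have "(\<Sum>j\<le>d+1. e j * dil (k^j) y) = e j0 * dil (k^j0) y + (\<Sum>j\<in>{..d+1} - {j0}. e j * dil (k^j) y)"
    using j0 by (subst sum.remove[of _ j0]) auto
  then have "e j0 * dil (k^j0) y = - (\<Sum>j\<in>{..d+1} - {j0}. e j * dil (k^j) y)"
    using tot by (simp add: eq_neg_iff_add_eq_0)
  moreover have "ord_ge (k ^ (j0+1) * v) \<dots>"
  proof (intro ord_ge_uminus ord_ge_sum)
    fix j assume j: "j \<in> {..d+1} - {j0}"
    show "ord_ge (k ^ (j0+1) * v) (e j * dil (k^j) y)"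
    proof (cases "j < j0")
      case True then show ?thesis using j0min by simp
    next
      case False
      then have "k ^ (j0+1) * v \<le> k ^ j * v" using j k by (intro mult_right_mono power_increasing) auto
      then show ?thesis by (intro ord_ge_mult ord_ge_mono[OF ord_ge_dil[OF v kpos]])
    qed
  qed
  ultimately have big: "ord_ge (k ^ (j0+1) * v) (e j0 * dil (k^j0) y)" by simp
  have sub: "subdegree (dil (k^j0) y) = k ^ j0 * v"
    using kpos y0 ord_ge_dil[OF v kpos, of j0]
    by (intro subdegreeI) (auto simp: dil_nth v_def ord_ge_def)
  have nz: "e j0 * dil (k^j0) y \<noteq> 0" using j0 dil0[OF y0 kpos] by simp
  then have "k ^ (j0+1) * v \<le> subdegree (e j0 * dil (k^j0) y)"
    using big by (intro subdegree_geI) (auto simp: ord_ge_def)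
  also have "\<dots> = subdegree (e j0) + k ^ j0 * v"
    using nz sub by (subst subdegree_mult) auto
  also have "subdegree (e j0) \<le> (2*d+2) * T"
    using dege[of j0] j0 by (metis deg_leD not_le_imp_less nth_subdegree_nonzero)
  finally have "k ^ (j0+1) * v \<le> (2*d+2) * T + k ^ j0 * v" by simp
  moreover have "2 * (k ^ j0 * v) \<le> k ^ (j0+1) * v" using k by (simp add: mult_ac)
  moreover have "1 * v \<le> k ^ j0 * v" using kpos[of j0] by (intro mult_right_mono) linarith+
  ultimately have "v \<le> (2*d+2) * T" by linarith
  moreover have "v \<ge> (2*d+2) * T + 1"
    using ord y0 unfolding v_def y_def[symmetric] T_def[symmetric]
    by (intro subdegree_geI) (auto simp: ord_ge_def)
  ultimately show False by simp
qed

section \<open>Duality for simultaneous approximants\<close>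

text \<open>Induction on the constraints. If a new one is nonzero at a generator \<open>w\<close>,
  the combinations \<open>e w * v - e v * w\<close> replace the generators: cross-multiplication
  keeps them integral, and \<open>B\<close> need only detect real functionals, not generate the
  integral kernel as a group. The last clause is the double annihilator property that duality
  uses.\<close>

lemma integer_kernel_spanning_set:
  fixes \<phi> :: "'i \<Rightarrow> 'j \<Rightarrow> int"
  assumes "finite I" "finite J"
  shows "\<exists>B. finite B \<and> (\<forall>v\<in>B. \<forall>i\<in>I. (\<Sum>j\<in>J. \<phi> i j * v j) = 0) \<and>
    (\<forall>l :: 'j \<Rightarrow> real. (\<forall>v\<in>B. (\<Sum>j\<in>J. l j * of_int (v j)) = 0) \<longrightarrow>
       (\<exists>g. \<forall>j\<in>J. l j = (\<Sum>i\<in>I. g i * of_int (\<phi> i j))))"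
  using assms(1)
proof (induction I rule: finite_induct)
  case empty
  define B where "B = (\<lambda>p j. if j = p then 1 else 0 :: int) ` J"
  have "l p = 0" if "\<forall>v\<in>B. (\<Sum>j\<in>J. l j * of_int (v j)) = 0" "p \<in> J" for l :: "'j \<Rightarrow> real" and p
  proof -
    have "(\<Sum>j\<in>J. l j * of_int (if j = p then 1 else 0)) = 0"
      using that by (auto simp: B_def)
    moreover have "(\<Sum>j\<in>J. l j * of_int (if j = p then 1 else 0)) = (\<Sum>j\<in>J. if j = p then l j else 0)"
      by (rule sum.cong) auto
    ultimately show ?thesis using that \<open>finite J\<close> by simp
  qed
  then show ?case using \<open>finite J\<close> by (intro exI[of _ B]) (auto simp: B_def)
next
  case (insert i I)
  then obtain B where B: "finite B" "\<forall>v\<in>B. \<forall>i\<in>I. (\<Sum>j\<in>J. \<phi> i j * v j) = 0"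
    and span: "\<And>l :: 'j \<Rightarrow> real. (\<forall>v\<in>B. (\<Sum>j\<in>J. l j * of_int (v j)) = 0) \<Longrightarrow>
       (\<exists>g. \<forall>j\<in>J. l j = (\<Sum>i\<in>I. g i * of_int (\<phi> i j)))" by blast
  define e where "e = (\<lambda>v. \<Sum>j\<in>J. \<phi> i j * v j)"
  show ?case
  proof (cases "\<forall>v\<in>B. e v = 0")
    case True
    have "\<exists>g. \<forall>j\<in>J. l j = (\<Sum>i\<in>insert i I. g i * of_int (\<phi> i j))"
      if l: "\<forall>v\<in>B. (\<Sum>j\<in>J. l j * of_int (v j)) = 0" for l :: "'j \<Rightarrow> real"
    proof -
      obtain g where "\<forall>j\<in>J. l j = (\<Sum>i\<in>I. g i * of_int (\<phi> i j))" using span[OF l] by blast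
      moreover have "(\<Sum>i'\<in>I. (g(i := 0)) i' * of_int (\<phi> i' j)) = (\<Sum>i\<in>I. g i * of_int (\<phi> i j))" for j
        using insert.hyps by (intro sum.cong) auto
      ultimately show ?thesis using insert.hyps by (intro exI[of _ "g(i := 0)"]) auto
    qed
    then show ?thesis using True B by (intro exI[of _ B]) (auto simp: e_def)
  next
    case False
    then obtain w where w: "w \<in> B" "e w \<noteq> 0" by blast
    define B' where "B' = (\<lambda>v j. e w * v j - e v * w j) ` B"
    have lin: "(\<Sum>j\<in>J. c j * (e w * v j - e v * w j)) = e w * (\<Sum>j\<in>J. c j * v j) - e v * (\<Sum>j\<in>J. c j * w j)"
      for c :: "'j \<Rightarrow> int" and v by (simp add: sum_subtractf sum_distrib_left algebra_simps)
    have "(\<Sum>j\<in>J. \<phi> i' j * v j) = 0" if v: "v \<in> B'" "i' \<in> insert i I" for v i'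
    proof -
      obtain u where u: "u \<in> B" "v = (\<lambda>j. e w * u j - e u * w j)" using v unfolding B'_def by blast
      show ?thesis
      proof (cases "i' = i")
        case True
        then show ?thesis unfolding u lin by (simp add: e_def mult.commute)
      next
        case False
        then show ?thesis unfolding u lin using B v u w by simp
      qed
    qed
    moreover have "\<exists>g. \<forall>j\<in>J. l j = (\<Sum>i\<in>insert i I. g i * of_int (\<phi> i j))"
      if l: "\<forall>v\<in>B'. (\<Sum>j\<in>J. l j * of_int (v j)) = 0" for l :: "'j \<Rightarrow> real"
    proof -
      \<comment> \<open>The coefficient of the new constraint is forced by the value of
        \<open>l\<close> at \<open>w\<close>. Subtracting it makes the functional vanish on all of
        \<open>B\<close>, not only on \<open>B'\<close>, so that the induction hypothesis
        applies.\<close>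
      define m where "m = (\<Sum>j\<in>J. l j * of_int (w j)) / of_int (e w)"
      have "\<forall>v\<in>B. (\<Sum>j\<in>J. (l j - m * of_int (\<phi> i j)) * of_int (v j)) = 0"
      proof
        fix v assume v: "v \<in> B"
        have "(\<Sum>j\<in>J. l j * of_int (e w * v j - e v * w j)) = 0"
          using l v by (auto simp: B'_def)
        then have "of_int (e w) * (\<Sum>j\<in>J. l j * of_int (v j)) - of_int (e v) * (\<Sum>j\<in>J. l j * of_int (w j)) = 0"
          by (simp add: sum_subtractf sum_distrib_left algebra_simps)
        then have "(\<Sum>j\<in>J. l j * of_int (v j)) = m * of_int (e v)"
          using w by (simp add: m_def field_simps)
        then show "(\<Sum>j\<in>J. (l j - m * of_int (\<phi> i j)) * of_int (v j)) = 0"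
          by (simp add: e_def sum_subtractf sum_distrib_left algebra_simps)
      qed
      from span[OF this] obtain g where
        g: "\<forall>j\<in>J. l j - m * of_int (\<phi> i j) = (\<Sum>i\<in>I. g i * of_int (\<phi> i j))" by blast
      have "(\<Sum>i'\<in>I. (g(i := m)) i' * of_int (\<phi> i' j)) = (\<Sum>i\<in>I. g i * of_int (\<phi> i j))" for j
        using insert.hyps by (intro sum.cong) auto
      then show ?thesis using insert.hyps g
        by (intro exI[of _ "g(i := m)"]) (auto simp: algebra_simps)
    qed
    ultimately show ?thesis using B by (intro exI[of _ B']) (auto simp: B'_def)
  qed
qed

definition coeff_trunc :: "nat \<Rightarrow> 'a::zero fps \<Rightarrow> 'a fps" where
  "coeff_trunc M G = Abs_fps (\<lambda>e. if e < M then G $ e else 0)"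

lemma mult_nth_cong:
  fixes F G :: "'a::semiring_0 fps"
  assumes "\<And>j. j \<le> m \<Longrightarrow> F $ j = F' $ j"
  shows "(F * G) $ m = (F' * G) $ m"
  using assms by (simp add: fps_mult_nth)

text \<open>The functional \<open>l\<close> on tuples \<open>(Q; P\<^sub>i)\<close> of polynomials of degree at most \<open>D\<close> is given by
  its values \<open>lq j\<close> and \<open>lp i j\<close> on the monomials \<open>x^j\<close>; it annihilates the multiples of \<open>\<omega>\<close> and,
  being a combination of the coefficients of \<open>x^m\<close> (\<open>m < M\<close>) in \<open>Q f\<^sub>i - P\<^sub>i\<close>, the simultaneous
  approximations to order \<open>M\<close>. The conclusion is that it annihilates \<open>(1; f\<^sub>i)\<close>, as \<open>r\<^sub>i\<close> is the
  residue of \<open>f\<^sub>i\<close> modulo \<open>\<omega>\<close>. The zero estimate enters as the second assumption, and the third one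
  says that a quotient of a polynomial by \<open>\<omega>\<close> of this shape is a polynomial.\<close>

lemma simultaneous_approximation_duality:
  fixes f r u :: "nat \<Rightarrow> 'a::field fps" and g :: "nat \<Rightarrow> nat \<Rightarrow> 'a"
  assumes \<delta>D: "\<delta> + D + 2 = M + t" and tD: "t \<le> Suc D" and t: "t > 0" and \<delta>: "\<delta> > 0" and \<delta>M: "\<delta> < M" and DM: "D < M"
    and zero_estimate: "\<And>c c'. (\<And>i. i < d \<Longrightarrow> deg_le \<delta> (c i)) \<Longrightarrow> deg_le \<delta> c' \<Longrightarrow>
       ord_ge M ((\<Sum>i<d. c i * f i) - c') \<Longrightarrow> (\<Sum>i<d. c i * f i) = c'"
    and quotient: "\<And>c. (\<And>i. i < d \<Longrightarrow> deg_le \<delta> (c i)) \<Longrightarrow>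
       deg_le (\<delta> + t - 1) (\<omega> * (\<Sum>i<d. c i * u i)) \<Longrightarrow> deg_le (\<delta> - 1) (\<Sum>i<d. c i * u i)"
    and \<omega>: "deg_le t \<omega>"
    and f: "\<And>i. i < d \<Longrightarrow> f i = r i + \<omega> * u i" and r: "\<And>i. i < d \<Longrightarrow> deg_le (t - 1) (r i)"
    and lp: "\<And>i j. i < d \<Longrightarrow> j \<le> D \<Longrightarrow> lp i j = - g i j"
    and lq: "\<And>j. j \<le> D \<Longrightarrow> lq j = (\<Sum>i<d. \<Sum>m\<in>{j..<M}. g i m * f i $ (m - j))"
    and lp\<omega>: "\<And>i j. i < d \<Longrightarrow> j + t \<le> D \<Longrightarrow> (\<Sum>l\<le>t. \<omega> $ l * lp i (j + l)) = 0"
    and lq\<omega>: "\<And>j. j + t \<le> D \<Longrightarrow> (\<Sum>l\<le>t. \<omega> $ l * lq (j + l)) = 0"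
  shows "lq 0 + (\<Sum>i<d. \<Sum>j<t. r i $ j * lp i j) = 0"
proof -
  \<comment> \<open>Reversing the index turns the sums of \<open>g i m * h $ (m - j)\<close> over
    \<open>m\<close> into the coefficient of \<open>x^(M - 1 - j)\<close> in
    \<open>\<gamma> i * h\<close>. For \<open>j \<le> D\<close>, \<open>lq j\<close> thus becomes a
    coefficient of \<open>G\<close>, and \<open>lp i j\<close> one of \<open>\<gamma> i\<close> up
    to sign.\<close>
  define \<gamma> where "\<gamma> = (\<lambda>i. Abs_fps (\<lambda>e. if e < M then g i (M - 1 - e) else 0))"
  define G where "G = (\<Sum>i<d. \<gamma> i * f i)"
  define c where "c = (\<lambda>i. coeff_trunc M (\<omega> * \<gamma> i))"
  define c' where "c' = coeff_trunc M (\<omega> * G)"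
  have \<gamma>mult: "(\<gamma> i * h) $ (M - 1 - j) = (\<Sum>m\<in>{j..<M}. g i m * h $ (m - j))" if "j < M" for i h j
  proof -
    have "(\<gamma> i * h) $ (M - 1 - j) = (\<Sum>e=0..M-1-j. g i (M - 1 - e) * h $ (M - 1 - j - e))"
      unfolding fps_mult_nth using that by (intro sum.cong) (auto simp: \<gamma>_def)
    also have "\<dots> = (\<Sum>m\<in>{j..<M}. g i m * h $ (m - j))"
      using that by (intro sum.reindex_bij_witness[of _ "\<lambda>m. M - 1 - m" "\<lambda>e. M - 1 - e"])
         (auto simp: add.commute)
    finally show ?thesis .
  qed
  have \<omega>mult: "(\<omega> * h) $ e = (\<Sum>l\<le>t. \<omega> $ l * h $ (e - l))" if "t \<le> e" for h e
    unfolding fps_mult_nth using that \<omega>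
    by (intro sum.mono_neutral_right) (auto simp: deg_le_def)
  have Gnth: "G $ (M - 1 - j) = lq j" if "j \<le> D" for j
    unfolding G_def fps_sum_nth lq[OF that] using that DM by (intro sum.cong refl \<gamma>mult) auto
  \<comment> \<open>That the functional kills the multiples of \<open>\<omega>\<close> means that
    the coefficient of \<open>x^(M - 1 - j)\<close> in \<open>\<omega> * \<gamma> i\<close> vanishes
    for \<open>j + t \<le> D\<close>. By \<open>\<delta> + D + 2 = M + t\<close> these are precisely
    the exponents strictly between \<open>\<delta>\<close> and \<open>M\<close>.\<close>
  have degc: "deg_le \<delta> (c i)" if i: "i < d" for i
    unfolding deg_le_def
  proof (intro allI impI)
    fix e assume e: "\<delta> < e"
    show "c i $ e = 0"
    proof (cases "e < M")
      case True
      define j where "j = M - 1 - e"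
      have j: "j + t \<le> D" "t \<le> e" using True e \<delta>D tD DM by (auto simp: j_def)
      have "(\<omega> * \<gamma> i) $ e = (\<Sum>l\<le>t. - (\<omega> $ l * lp i (j + l)))"
        unfolding \<omega>mult[OF j(2)]
      proof (rule sum.cong[OF refl])
        fix l assume l: "l \<in> {..t}"
        then have "M - 1 - (e - l) = j + l" using True j by (auto simp: j_def)
        then show "\<omega> $ l * \<gamma> i $ (e - l) = - (\<omega> $ l * lp i (j + l))"
          using True l j lp[OF i, of "j + l"] by (simp add: \<gamma>_def)
      qed
      then show ?thesis using lp\<omega>[OF i j(1)] True by (simp add: c_def coeff_trunc_def sum_negf)
    qed (simp add: c_def coeff_trunc_def)
  qed
  have degc': "deg_le \<delta> c'"
    unfolding deg_le_def
  proof (intro allI impI)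
    fix e assume e: "\<delta> < e"
    show "c' $ e = 0"
    proof (cases "e < M")
      case True
      define j where "j = M - 1 - e"
      have j: "j + t \<le> D" "t \<le> e" using True e \<delta>D tD DM by (auto simp: j_def)
      have "(\<omega> * G) $ e = (\<Sum>l\<le>t. \<omega> $ l * lq (j + l))"
        unfolding \<omega>mult[OF j(2)]
      proof (rule sum.cong[OF refl])
        fix l assume l: "l \<in> {..t}"
        then have "e - l = M - 1 - (j + l)" using True j by (auto simp: j_def)
        then show "\<omega> $ l * G $ (e - l) = \<omega> $ l * lq (j + l)"
          using l j Gnth[of "j + l"] by simp
      qed
      then show ?thesis using lq\<omega>[OF j(1)] True by (simp add: c'_def coeff_trunc_def)
    qed (simp add: c'_def coeff_trunc_def)
  qed
  have cmult: "(c i * h) $ m = (\<omega> * \<gamma> i * h) $ m" if "m < M" for i h m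
    using that by (intro mult_nth_cong) (simp add: c_def coeff_trunc_def)
  have "ord_ge M ((\<Sum>i<d. c i * f i) - c')"
    unfolding ord_ge_def
  proof (intro allI impI)
    fix m assume m: "m < M"
    have "(\<Sum>i<d. c i * f i) $ m = (\<Sum>i<d. \<omega> * \<gamma> i * f i) $ m"
      unfolding fps_sum_nth by (intro sum.cong refl cmult m)
    also have "\<dots> = (\<omega> * G) $ m" by (simp add: G_def sum_distrib_left mult.assoc)
    finally show "((\<Sum>i<d. c i * f i) - c') $ m = 0" using m by (simp add: c'_def coeff_trunc_def)
  qed
  \<comment> \<open>The approximate relation becomes exact here. This makes
    \<open>\<omega> * (\<Sum>i<d. c i * u i)\<close> a polynomial, although the \<open>u i\<close>
    are only power series.\<close>
  then have eq: "(\<Sum>i<d. c i * f i) = c'" using degc degc' by (intro zero_estimate)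
  have "\<omega> * (\<Sum>i<d. c i * u i) = (\<Sum>i<d. c i * f i - c i * r i)"
    unfolding sum_distrib_left using f by (intro sum.cong) (auto simp: algebra_simps)
  also have "\<dots> = c' - (\<Sum>i<d. c i * r i)" by (simp add: sum_subtractf eq)
  finally have "\<omega> * (\<Sum>i<d. c i * u i) = c' - (\<Sum>i<d. c i * r i)" .
  moreover have "deg_le (\<delta> + t - 1) (c' - (\<Sum>i<d. c i * r i))"
  proof (intro deg_le_diff deg_le_sum)
    show "deg_le (\<delta> + t - 1) c'" using degc' t by (elim deg_le_mono) simp
    show "deg_le (\<delta> + t - 1) (c i * r i)" if "i \<in> {..<d}" for i
      using deg_le_mult[OF degc r, of i i] that t by simp
  qed
  ultimately have "deg_le (\<delta> - 1) (\<Sum>i<d. c i * u i)" using degc by (intro quotient) auto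
  \<comment> \<open>The exponent \<open>M - 1\<close> corresponds to \<open>j = 0\<close>, so this
    coefficient is the value of the functional on the residues, as computed below. It vanishes
    because \<open>M - 1\<close> exceeds the degree \<open>\<delta> - 1\<close>.\<close>
  then have 0: "(\<Sum>i<d. c i * u i) $ (M - 1) = 0" using \<delta> \<delta>M by (auto simp: deg_le_def)
  have "(\<Sum>j<t. r i $ j * lp i j) = - (\<gamma> i * r i) $ (M - 1)" if i: "i < d" for i
  proof -
    have "(\<Sum>m\<in>{0..<M}. g i m * r i $ m) = (\<Sum>m<t. g i m * r i $ m)"
      using r[OF i] tD DM t by (intro sum.mono_neutral_right) (auto simp: deg_le_def)
    also have "\<dots> = - (\<Sum>j<t. r i $ j * lp i j)"
      unfolding sum_negf[symmetric] using lp[OF i] tD by (intro sum.cong) auto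
    finally show ?thesis using \<gamma>mult[of 0 i "r i"] DM by simp
  qed
  then have "lq 0 + (\<Sum>i<d. \<Sum>j<t. r i $ j * lp i j)
      = (\<Sum>i<d. (\<gamma> i * f i) $ (M - 1) - (\<gamma> i * r i) $ (M - 1))"
    using Gnth[of 0] by (simp add: G_def fps_sum_nth sum_subtractf sum_negf)
  also have "\<dots> = (\<Sum>i<d. (c i * u i) $ (M - 1))"
  proof (rule sum.cong[OF refl])
    fix i assume "i \<in> {..<d}"
    then have "\<gamma> i * f i - \<gamma> i * r i = \<omega> * \<gamma> i * u i" using f[of i] by (simp add: algebra_simps)
    then show "(\<gamma> i * f i) $ (M - 1) - (\<gamma> i * r i) $ (M - 1) = (c i * u i) $ (M - 1)"
      using cmult[of "M - 1" i "u i"] DM by (simp flip: fps_sub_nth)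
  qed
  also have "\<dots> = 0" using 0 by (simp add: fps_sum_nth)
  finally show ?thesis .
qed

section \<open>Division by powers of a linear factor\<close>

text \<open>Convergence is traded for a geometric bound. The ratio is taken at least 1 so that the
  bound survives dilation, where \<open>r ^ (n div m) \<le> r ^ n\<close> is needed.\<close>

lemma fps_conv_radius_coeff_bound:
  fixes G :: "real fps"
  assumes "0 \<le> x" "x < 1" "ereal x < fps_conv_radius G"
  obtains K r where "1 \<le> r" "r * x < 1" "0 \<le> K" "\<And>m. \<bar>G $ m\<bar> \<le> K * r ^ m"
proof -
  obtain \<rho> :: real where \<rho>: "ereal x < ereal \<rho>" "ereal \<rho> < fps_conv_radius G"
    using ereal_dense2[OF assms(3)] by auto
  then have \<rho>0: "\<rho> > 0" "x < \<rho>" using assms(1) by auto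
  have "summable (\<lambda>m. G $ m * \<rho> ^ m)"
    using \<rho> \<rho>0 by (intro summable_fps) simp
  then have "Bseq (\<lambda>m. G $ m * \<rho> ^ m)"
    by (intro convergent_imp_Bseq) (auto simp: convergent_def dest: summable_LIMSEQ_zero)
  then obtain K where K: "K > 0" "\<And>m. norm (G $ m * \<rho> ^ m) \<le> K" by (auto elim: BseqE)
  define r where "r = max 1 (1 / \<rho>)"
  show ?thesis
  proof (rule that[of r K])
    show "1 \<le> r" by (simp add: r_def)
    show "r * x < 1" using assms \<rho>0 by (auto simp: r_def max_def field_simps)
    show "0 \<le> K" using K by simp
    fix m
    have "\<bar>G $ m\<bar> \<le> K * (1 / \<rho>) ^ m"
      using K(2)[of m] \<rho>0 by (simp add: abs_mult field_simps)
    also have "\<dots> \<le> K * r ^ m"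
      using K \<rho>0 by (intro mult_left_mono power_mono) (auto simp: r_def)
    finally show "\<bar>G $ m\<bar> \<le> K * r ^ m" .
  qed
qed

lemma fps_conv_radius_gt:
  fixes G :: "real fps"
  assumes "0 \<le> x" "0 < r" "r * x < 1" and bound: "\<And>m. \<bar>G $ m\<bar> \<le> K * r ^ m"
  shows "ereal x < fps_conv_radius G"
proof -
  have "x < 1 / r" using assms by (simp add: field_simps)
  then obtain \<rho> where \<rho>: "x < \<rho>" "\<rho> < 1 / r" using dense by blast
  have "summable (\<lambda>m. G $ m * \<rho> ^ m)"
  proof (rule summable_comparison_test')
    show "summable (\<lambda>m. K * (r * \<rho>) ^ m)"
      using \<rho> assms by (intro summable_mult summable_geometric) (auto simp: field_simps abs_mult)
    fix m assume "m \<ge> (0::nat)"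
    show "norm (G $ m * \<rho> ^ m) \<le> K * (r * \<rho>) ^ m"
      using mult_right_mono[OF bound[of m], of "\<rho> ^ m"] \<rho> assms by (simp add: abs_mult power_mult_distrib mult_ac)
  qed
  then have "ereal \<bar>\<rho>\<bar> \<le> fps_conv_radius G"
    unfolding fps_conv_radius_def using conv_radius_geI[of "fps_nth G" \<rho>] by simp
  moreover have "ereal x < ereal \<bar>\<rho>\<bar>" using \<rho> by simp
  ultimately show ?thesis by (rule less_le_trans[rotated])
qed

lemma fps_conv_radius_dil:
  fixes G :: "real fps"
  assumes "0 \<le> x" "x < 1" "ereal x < fps_conv_radius G" "m > 0"
  shows "ereal x < fps_conv_radius (dil m G)"
proof -
  obtain K r where r: "1 \<le> r" "r * x < 1" "0 \<le> K" "\<And>m. \<bar>G $ m\<bar> \<le> K * r ^ m"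
    using fps_conv_radius_coeff_bound[OF assms(1-3)] by blast
  have bound: "\<bar>dil m G $ n\<bar> \<le> K * r ^ n" for n
  proof (cases "m dvd n")
    case True
    have "\<bar>dil m G $ n\<bar> \<le> K * r ^ (n div m)" using True r(4) assms by (simp add: dil_nth)
    also have "\<dots> \<le> K * r ^ n" using r by (intro mult_left_mono power_increasing) auto
    finally show ?thesis .
  qed (use r assms in \<open>simp add: dil_nth\<close>)
  show ?thesis using r(1) by (intro fps_conv_radius_gt[OF assms(1) _ r(2) bound]) simp
qed

lemma fps_conv_radius_sum_gt:
  assumes "\<And>i. i \<in> I \<Longrightarrow> x < fps_conv_radius (G i)" "x < \<infinity>"
  shows "x < fps_conv_radius (\<Sum>i\<in>I. G i :: 'a :: {banach, real_normed_div_algebra} fps)"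
  using assms
proof (induction I rule: infinite_finite_induct)
  case (insert i I)
  then have "x < min (fps_conv_radius (G i)) (fps_conv_radius (sum G I))" by simp
  also note fps_conv_radius_add
  finally show ?case using insert.hyps by simp
qed auto

lemma fps_conv_radius_mult_gt:
  fixes F G :: "'a :: {banach, real_normed_div_algebra} fps"
  assumes "x < fps_conv_radius F" "x < fps_conv_radius G"
  shows "x < fps_conv_radius (F * G)"
  using assms by (intro less_le_trans[OF _ fps_conv_radius_mult]) simp

lemma fps_conv_radius_deg_le:
  fixes G :: "real fps"
  assumes "deg_le D G"
  shows "fps_conv_radius G = \<infinity>"
proof -
  have "G = (\<Sum>j\<le>D. fps_const (G $ j) * fps_X ^ j)"
    using assms by (intro fps_ext) (auto simp: fps_sum_nth fps_X_power_nth deg_le_def if_distrib cong: if_cong)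
  also have "fps_conv_radius \<dots> = \<infinity>"
  proof (rule ccontr)
    assume "\<not> ?thesis"
    then obtain x where "fps_conv_radius (\<Sum>j\<le>D. fps_const (G $ j) * fps_X ^ j) < ereal x"
      using less_PInf_Ex_of_nat[of "fps_conv_radius (\<Sum>j\<le>D. fps_const (G $ j) * fps_X ^ j)"] by auto
    moreover have "ereal x < fps_conv_radius (\<Sum>j\<le>D. fps_const (G $ j) * fps_X ^ j)"
      by (intro fps_conv_radius_sum_gt fps_conv_radius_mult_gt) auto
    ultimately show False by simp
  qed
  finally show ?thesis .
qed

definition lin :: "'a::comm_ring_1 \<Rightarrow> 'a fps" where
  "lin \<beta> = fps_X - fps_const \<beta>"

lemma deg_le_lin: "deg_le 1 (lin \<beta>)"
  by (auto simp: deg_le_def lin_def fps_X_def)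

lemma deg_le_lin_power: "deg_le t (lin \<beta> ^ t)"
  using deg_le_power[OF deg_le_lin, of t \<beta>] by simp

lemma lin_mult_nth: "(lin \<beta> * G) $ m = (if m = 0 then 0 else G $ (m - 1)) - \<beta> * G $ m"
  by (simp add: lin_def algebra_simps)

lemma fps_conv_radius_lin_power [simp]: "fps_conv_radius (lin (\<beta>::real) ^ t) = \<infinity>"
  by (rule fps_conv_radius_deg_le[OF deg_le_lin_power])

text \<open>Synthetic division from the high coefficients downwards: the tails
  \<open>\<Sum>i. G $ (m + 1 + i) * \<beta> ^ i\<close> converge because \<open>\<beta>\<close> lies
  inside the disc, and they inherit the geometric bound of \<open>G\<close>. The remainder is the
  value of \<open>G\<close> at \<open>\<beta>\<close>.\<close>

lemma divide_by_lin:
  fixes G :: "real fps"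
  assumes "\<bar>\<beta>\<bar> \<le> x" "x < 1" "ereal x < fps_conv_radius G"
  obtains c W where "G = fps_const c + lin \<beta> * W" "ereal x < fps_conv_radius W"
proof -
  have x0: "0 \<le> x" using assms by linarith
  obtain K r where r: "1 \<le> r" "r * x < 1" "0 \<le> K" "\<And>m. \<bar>G $ m\<bar> \<le> K * r ^ m"
    using fps_conv_radius_coeff_bound[OF x0 assms(2,3)] by blast
  have rb: "r * \<bar>\<beta>\<bar> < 1" using mult_left_mono[OF assms(1), of r] r by linarith
  define W where "W = Abs_fps (\<lambda>m. \<Sum>i. G $ (m + 1 + i) * \<beta> ^ i)"
  have Wn: "W $ m = (\<Sum>i. G $ (m + 1 + i) * \<beta> ^ i)" for m by (simp only: W_def fps_nth_Abs_fps)
  have bd: "norm (G $ (m + i) * \<beta> ^ i) \<le> K * r ^ m * (r * \<bar>\<beta>\<bar>) ^ i" for m i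
    using mult_right_mono[OF r(4)[of "m + i"], of "\<bar>\<beta>\<bar> ^ i"]
    by (simp add: abs_mult power_abs power_mult_distrib power_add mult_ac)
  have gs: "summable (\<lambda>i. K * r ^ m * (r * \<bar>\<beta>\<bar>) ^ i)" for m
    using rb r by (intro summable_mult summable_geometric) (simp add: abs_mult)
  have sm: "summable (\<lambda>i. G $ (m + i) * \<beta> ^ i)" for m
    by (rule summable_comparison_test'[OF gs[of m], of 0]) (use bd in auto)
  have Wb: "\<bar>W $ m\<bar> \<le> (K * r / (1 - r * \<bar>\<beta>\<bar>)) * r ^ m" for m
  proof -
    have "norm (\<Sum>i. G $ (m + 1 + i) * \<beta> ^ i) \<le> (\<Sum>i. K * r ^ (m+1) * (r * \<bar>\<beta>\<bar>) ^ i)"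
      by (rule norm_suminf_le[OF bd gs])
    then have "\<bar>W $ m\<bar> \<le> (\<Sum>i. K * r ^ (m+1) * (r * \<bar>\<beta>\<bar>) ^ i)"
      by (simp only: Wn real_norm_def)
    also have "\<dots> = K * r ^ (m+1) * (1 / (1 - r * \<bar>\<beta>\<bar>))"
      using rb r by (subst suminf_mult) (auto simp: suminf_geometric summable_geometric abs_mult)
    finally show ?thesis by (simp add: mult_ac)
  qed
  have "ereal x < fps_conv_radius W" using r by (intro fps_conv_radius_gt[OF x0 _ r(2) Wb]) simp
  moreover have "G = fps_const (\<Sum>i. G $ i * \<beta> ^ i) + lin \<beta> * W"
  proof (rule fps_ext)
    fix m
    have key: "(\<Sum>i. G $ (m + i) * \<beta> ^ i) = G $ m + \<beta> * W $ m" for m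
    proof -
      have "(\<Sum>i. G $ (m + i) * \<beta> ^ i) = G $ m + (\<Sum>i. G $ (m + Suc i) * \<beta> ^ Suc i)"
        using suminf_split_head[OF sm[of m]] by simp
      also have "(\<Sum>i. G $ (m + Suc i) * \<beta> ^ Suc i) = \<beta> * (\<Sum>i. G $ (m + 1 + i) * \<beta> ^ i)"
        by (subst suminf_mult[OF sm, symmetric]) (simp add: mult_ac)
      finally show ?thesis by (simp only: Wn)
    qed
    show "G $ m = (fps_const (\<Sum>i. G $ i * \<beta> ^ i) + lin \<beta> * W) $ m"
    proof (cases m)
      case 0
      then show ?thesis using key[of 0] by (simp add: lin_def)
    next
      case (Suc n)
      then show ?thesis using key[of m] Wn[of n] by (simp add: lin_mult_nth)
    qed
  qed
  ultimately show ?thesis using that by blast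
qed

lemma divide_by_lin_power:
  fixes G :: "real fps"
  assumes "\<bar>\<beta>\<bar> \<le> x" "x < 1" "ereal x < fps_conv_radius G"
  obtains r u where "G = r + lin \<beta> ^ Suc s * u" "deg_le s r" "ereal x < fps_conv_radius u"
proof -
  have "\<exists>r u. G = r + lin \<beta> ^ Suc s * u \<and> deg_le s r \<and> ereal x < fps_conv_radius u"
  proof (induction s)
    case 0
    obtain c W where "G = fps_const c + lin \<beta> * W" "ereal x < fps_conv_radius W"
      by (rule divide_by_lin[OF assms])
    then have "G = fps_const c + lin \<beta> ^ Suc 0 * W" by simp
    then show ?case using \<open>ereal x < fps_conv_radius W\<close> deg_le_const by blast
  next
    case (Suc s)
    then obtain r u where ru: "G = r + lin \<beta> ^ Suc s * u" "deg_le s r" "ereal x < fps_conv_radius u" by blast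
    obtain c W where W: "u = fps_const c + lin \<beta> * W" "ereal x < fps_conv_radius W"
      by (rule divide_by_lin[OF assms(1,2) ru(3)])
    have "G = (r + fps_const c * lin \<beta> ^ Suc s) + lin \<beta> ^ Suc (Suc s) * W"
      unfolding ru(1) W(1) by (simp add: algebra_simps)
    moreover have "deg_le (Suc s) (r + fps_const c * lin \<beta> ^ Suc s)"
    proof (rule deg_le_add)
      show "deg_le (Suc s) r" using ru(2) by (rule deg_le_mono) simp
      show "deg_le (Suc s) (fps_const c * lin \<beta> ^ Suc s)"
        using deg_le_mult[OF deg_le_const[of 0 c] deg_le_lin_power[of "Suc s" \<beta>]] by (simp only: add_0)
    qed
    ultimately show ?case using W(2) by blast
  qed
  then show ?thesis using that by blast
qed

text \<open>Convergence excludes the expansion of \<open>1 / (x - \<beta>)\<close>, whose product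
  with \<open>lin \<beta>\<close> is 1. Beyond degree \<open>e\<close> the product relation makes
  \<open>W $ m * \<beta> ^ m\<close> constant in \<open>m\<close>, while the terms of a convergent
  series tend to 0.\<close>

lemma deg_le_lin_mult_cancel:
  fixes W :: "real fps"
  assumes "deg_le (Suc e) (lin \<beta> * W)" "ereal \<bar>\<beta>\<bar> < fps_conv_radius W"
  shows "deg_le e W"
proof -
  have step: "W $ m = \<beta> * W $ Suc m" if "m > e" for m
    using assms(1) that unfolding deg_le_def lin_mult_nth by (auto dest!: spec[of _ "Suc m"])
  have "W $ m = 0" if m: "m > e" for m
  proof (cases "\<beta> = 0")
    case False
    have "W $ m * \<beta> ^ m = W $ (m + i) * \<beta> ^ (m + i)" for i
    proof (induction i)
      case (Suc i)
      then show ?case using step[of "m + i"] m by (simp add: mult.assoc mult.left_commute)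
    qed simp
    moreover have "(\<lambda>i. W $ (i + m) * \<beta> ^ (i + m)) \<longlonglongrightarrow> 0"
      using assms(2) by (intro LIMSEQ_ignore_initial_segment summable_LIMSEQ_zero summable_fps) simp
    ultimately have "(\<lambda>i::nat. W $ m * \<beta> ^ m) \<longlonglongrightarrow> 0" by (simp add: add.commute)
    then show ?thesis using False by (simp add: LIMSEQ_const_iff)
  qed (use step[OF m] in simp)
  then show ?thesis by (simp add: deg_le_def)
qed


lemma deg_le_lin_power_mult_cancel:
  fixes W :: "real fps"
  assumes "deg_le (e + t) (lin \<beta> ^ t * W)" "ereal \<bar>\<beta>\<bar> < fps_conv_radius W"
  shows "deg_le e W"
  using assms(1)
proof (induction t)
  case 0 then show ?case by simp
next
  case (Suc t)
  have c: "ereal \<bar>\<beta>\<bar> < fps_conv_radius (lin \<beta> ^ t * W)" 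
    using assms(2) by (intro fps_conv_radius_mult_gt) simp_all
  have d: "deg_le (Suc (e + t)) (lin \<beta> * (lin \<beta> ^ t * W))"
    using Suc.prems by (simp only: power_Suc mult.assoc add_Suc_right)
  have "deg_le (e + t) (lin \<beta> ^ t * W)"
    by (rule deg_le_lin_mult_cancel[OF d c])
  then show ?case by (rule Suc.IH)
qed

section \<open>Jets\<close>

definition jet :: "nat \<Rightarrow> real \<Rightarrow> real fps \<Rightarrow> real" where
  "jet s x G = eval_fps ((fps_deriv ^^ s) G) x"

lemma higher_fps_deriv_nth:
  "(fps_deriv ^^ s) G $ m = (\<Prod>i<s. real (m + 1 + i)) * G $ (m + s)"
proof (induction s arbitrary: m)
  case (Suc s)
  have "(\<Prod>i<Suc s. real (m + 1 + i)) = real (m + 1) * (\<Prod>i<s. real (m + 1 + 1 + i))"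
    by (subst prod.lessThan_Suc_shift) simp
  then show ?case by (simp add: Suc)
qed simp

lemma fps_conv_radius_higher_deriv:
  "fps_conv_radius ((fps_deriv ^^ s) G) \<ge> fps_conv_radius (G :: real fps)"
proof (induction s)
  case (Suc s)
  then show ?case using fps_conv_radius_deriv[of "(fps_deriv ^^ s) G"] by simp
qed simp

lemma fps_conv_radius_higher_deriv_gt:
  "x < fps_conv_radius G \<Longrightarrow> x < fps_conv_radius ((fps_deriv ^^ s) (G :: real fps))"
  using fps_conv_radius_higher_deriv less_le_trans by blast

lemma higher_fps_deriv_add: "(fps_deriv ^^ s) (F + G) = (fps_deriv ^^ s) F + (fps_deriv ^^ s) (G :: real fps)"
  by (rule fps_ext) (simp only: higher_fps_deriv_nth fps_add_nth distrib_left)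

lemma jet_add:
  assumes "ereal \<bar>x\<bar> < fps_conv_radius F" "ereal \<bar>x\<bar> < fps_conv_radius G"
  shows "jet s x (F + G) = jet s x F + jet s x G"
  unfolding jet_def higher_fps_deriv_add
  using assms by (intro eval_fps_add) (auto intro: fps_conv_radius_higher_deriv_gt)

lemma jet_cmult:
  assumes "ereal \<bar>x\<bar> < fps_conv_radius G"
  shows "jet s x (fps_const c * G) = c * jet s x G"
proof -
  have "(fps_deriv ^^ s) (fps_const c * G) = fps_const c * (fps_deriv ^^ s) G"
    by (rule fps_ext) (simp add: higher_fps_deriv_nth)
  moreover have "ereal (norm x) < fps_conv_radius ((fps_deriv ^^ s) G)"
    using assms by (auto intro: fps_conv_radius_higher_deriv_gt)
  ultimately show ?thesis unfolding jet_def by (simp add: eval_fps_mult)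
qed

lemma jet_0 [simp]: "jet s x 0 = 0"
proof -
  have "(fps_deriv ^^ s) (0 :: real fps) = 0"
    by (rule fps_ext) (simp add: higher_fps_deriv_nth)
  then show ?thesis by (simp add: jet_def)
qed

lemma jet_diff:
  assumes "ereal \<bar>x\<bar> < fps_conv_radius F" "ereal \<bar>x\<bar> < fps_conv_radius G"
  shows "jet s x (F - G) = jet s x F - jet s x G"
proof -
  have "jet s x (F - G) + jet s x G = jet s x F"
    using assms fps_conv_radius_diff[of F G]
    by (subst jet_add[symmetric]) (auto intro: less_le_trans[of _ "min (fps_conv_radius F) (fps_conv_radius G)"])
  then show ?thesis by simp
qed

lemma jet_sum:
  assumes "\<And>i. i \<in> I \<Longrightarrow> ereal \<bar>x\<bar> < fps_conv_radius (G i)"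
  shows "jet s x (\<Sum>i\<in>I. G i) = (\<Sum>i\<in>I. jet s x (G i))"
  using assms
proof (induction I rule: infinite_finite_induct)
  case (insert i I)
  then show ?case by (simp add: jet_add fps_conv_radius_sum_gt)
qed auto

lemma jet_Suc_lin_mult:
  assumes "ereal \<bar>x\<bar> < fps_conv_radius G"
  shows "jet (Suc s) x (lin x * G) = real (Suc s) * jet s x G"
proof -
  have *: "(fps_deriv ^^ Suc s) (lin x * G) = lin x * (fps_deriv ^^ Suc s) G + fps_const (real (Suc s)) * (fps_deriv ^^ s) G"
    for s
  proof (induction s)
    case 0
    show ?case by (simp add: lin_def algebra_simps)
  next
    case (Suc s)
    have "(fps_deriv ^^ Suc (Suc s)) (lin x * G) = fps_deriv ((fps_deriv ^^ Suc s) (lin x * G))" by simp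
    also have "\<dots> = lin x * (fps_deriv ^^ Suc (Suc s)) G + (fps_deriv ^^ Suc s) G
         + fps_const (real (Suc s)) * (fps_deriv ^^ Suc s) G"
      unfolding Suc by (simp add: lin_def algebra_simps)
    also have "\<dots> = lin x * (fps_deriv ^^ Suc (Suc s)) G + (1 + fps_const (real (Suc s))) * (fps_deriv ^^ Suc s) G"
      by (simp only: distrib_right mult_1 add.assoc)
    also have "1 + fps_const (real (Suc s)) = fps_const (real (Suc (Suc s)))"
      by (rule fps_ext) simp
    finally show ?case .
  qed
  have c: "ereal \<bar>x\<bar> < fps_conv_radius ((fps_deriv ^^ s) G)" for s
    using assms by (rule fps_conv_radius_higher_deriv_gt)
  have cl: "fps_conv_radius (lin x) = \<infinity>" using fps_conv_radius_lin_power[of x 1] by simp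
  have l: "eval_fps (lin x) x = 0" by (simp add: lin_def eval_fps_diff)
  have "ereal \<bar>x\<bar> < fps_conv_radius (lin x * (fps_deriv ^^ Suc s) G)"
    "ereal \<bar>x\<bar> < fps_conv_radius (fps_const (real (Suc s)) * (fps_deriv ^^ s) G)"
    using c cl by (intro fps_conv_radius_mult_gt; simp del: funpow.simps)+
  then show ?thesis unfolding jet_def *
    using c cl l by (subst eval_fps_add) (simp_all del: funpow.simps add: eval_fps_mult)
qed

lemma jet_lin_power_mult:
  assumes "ereal \<bar>x\<bar> < fps_conv_radius G"
  shows "jet s x (lin x ^ s * G) = fact s * eval_fps G x"
proof (induction s)
  case (Suc s)
  have "ereal \<bar>x\<bar> < fps_conv_radius (lin x ^ s * G)"
    using assms by (intro fps_conv_radius_mult_gt) auto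
  from jet_Suc_lin_mult[OF this, of s] Suc show ?case by (simp add: mult.assoc)
qed (simp add: jet_def)

lemma jet_lin_power_Suc_mult:
  assumes "ereal \<bar>x\<bar> < fps_conv_radius G"
  shows "jet s x (lin x ^ Suc s * G) = 0"
proof -
  have cl: "fps_conv_radius (lin x) = \<infinity>" using fps_conv_radius_lin_power[of x 1] by simp
  have l: "eval_fps (lin x) x = 0" by (simp add: lin_def eval_fps_diff)
  have c: "ereal \<bar>x\<bar> < fps_conv_radius (lin x * G)"
    using assms cl by (intro fps_conv_radius_mult_gt) auto
  have "jet s x (lin x ^ Suc s * G) = jet s x (lin x ^ s * (lin x * G))" by (simp add: mult_ac)
  also have "\<dots> = fact s * eval_fps (lin x * G) x" by (rule jet_lin_power_mult[OF c])
  also have "\<dots> = 0" using assms cl l by (simp add: eval_fps_mult)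
  finally show ?thesis .
qed

text \<open>Differentiation multiplies the coefficients by at most \<open>m ^ s\<close>, which is
  absorbed by enlarging \<open>\<theta>\<close> to \<open>\<theta>'\<close>. The constant must not
  depend on the series or on \<open>N\<close>, because both will vary with \<open>n\<close>.\<close>

lemma jet_bound:
  assumes "0 < \<theta>" "\<theta> < \<theta>'" "0 < \<bar>x\<bar>" "\<theta>' * \<bar>x\<bar> < 1"
  shows "\<exists>C\<ge>0. \<forall>G K N. 0 \<le> K \<longrightarrow> (\<forall>m. \<bar>G $ m\<bar> \<le> K * \<theta> ^ m) \<longrightarrow> ord_ge N G \<longrightarrow>
           \<bar>jet s x G\<bar> \<le> C * K * (\<theta>' * \<bar>x\<bar>) ^ N"
proof -
  have "(\<lambda>m. real m ^ s * (\<theta> / \<theta>') ^ m) \<longlonglongrightarrow> 0"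
  proof (cases "s = 0")
    case True
    then show ?thesis using assms by (auto intro!: LIMSEQ_power_zero)
  next
    case False
    define q where "q = root s (\<theta> / \<theta>')"
    have q: "q ^ s = \<theta> / \<theta>'" "0 \<le> q" using False assms by (simp_all add: q_def)
    have "q < 1"
      using assms by (intro power_less_imp_less_base[of q s 1]) (simp_all add: q)
    then have "(\<lambda>m. (real m * q ^ m) ^ s) \<longlonglongrightarrow> 0 ^ s"
      using q by (intro tendsto_power powser_times_n_limit_0) simp
    moreover have "(real m * q ^ m) ^ s = real m ^ s * (\<theta> / \<theta>') ^ m" for m
      by (simp add: power_mult_distrib q flip: power_mult) (simp add: power_mult q mult.commute[of m])
    ultimately show ?thesis using False by (simp add: power_0_left)
  qed
  then have "Bseq (\<lambda>m. real m ^ s * (\<theta> / \<theta>') ^ m)" by (intro convergent_imp_Bseq) (auto simp: convergent_def)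
  then obtain B where B: "B > 0" "\<And>m. norm (real m ^ s * (\<theta> / \<theta>') ^ m) \<le> B" by (auto elim: BseqE)
  define y where "y = \<theta>' * \<bar>x\<bar>"
  have y: "0 < y" "y < 1" using assms by (auto simp: y_def)
  define C where "C = B / \<bar>x\<bar> ^ s / (1 - y)"
  show ?thesis
  proof (intro exI[of _ C] conjI allI impI)
    show "C \<ge> 0" using B y by (simp add: C_def)
    fix G K N assume K: "0 \<le> K" and G: "\<forall>m. \<bar>G $ m\<bar> \<le> K * \<theta> ^ m" and N: "ord_ge N G"
    define g where "g = (\<lambda>m. (fps_deriv ^^ s) G $ m * x ^ m)"
    define z where "z = K * B / \<bar>x\<bar> ^ s"
    have z: "z \<ge> 0" using K B by (simp add: z_def)
    \<comment> \<open>The exponent is \<open>m + s\<close>, the index of the coefficient before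
      differentiation. Nonzero terms have \<open>m + s \<ge> N\<close>, so the full factor
      \<open>y ^ N\<close> is kept although the derivative may have order \<open>N - s\<close>
      only.\<close>
    have gb: "\<bar>g m\<bar> \<le> z * y ^ (m + s)" for m
    proof -
      have "(\<Prod>i<s. real (m + 1 + i)) \<le> (\<Prod>i<s. real (m + s))"
        by (intro prod_mono) auto
      then have 1: "(\<Prod>i<s. real (m + 1 + i)) \<le> real (m + s) ^ s" by simp
      have "\<bar>(fps_deriv ^^ s) G $ m\<bar> = (\<Prod>i<s. real (m + 1 + i)) * \<bar>G $ (m + s)\<bar>"
        unfolding higher_fps_deriv_nth abs_mult by (subst abs_of_nonneg) (auto intro: prod_nonneg)
      also have "\<dots> \<le> real (m + s) ^ s * (K * \<theta> ^ (m + s))"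
        using 1 G by (intro mult_mono) auto
      also have "\<dots> = K * (real (m + s) ^ s * (\<theta> / \<theta>') ^ (m + s)) * \<theta>' ^ (m + s)"
        using assms by (simp add: power_divide)
      also have "\<dots> \<le> K * B * \<theta>' ^ (m + s)"
        using B(2)[of "m + s"] K assms by (intro mult_right_mono mult_left_mono) auto
      finally have "\<bar>g m\<bar> \<le> K * B * \<theta>' ^ (m + s) * \<bar>x\<bar> ^ m"
        unfolding g_def abs_mult power_abs by (intro mult_right_mono) auto
      also have "\<dots> = z * y ^ (m + s)"
        using assms by (simp add: z_def y_def power_mult_distrib power_add)
      finally show ?thesis .
    qed
    have g0: "g m = 0" if "m + s < N" for m
      using N that by (simp add: g_def higher_fps_deriv_nth ord_ge_def)
    have gb': "norm (g m) \<le> (z * y ^ N) * y ^ (m + s - N)" for m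
    proof (cases "m + s < N")
      case True
      then show ?thesis using g0[OF True] z y by simp
    next
      case False
      then show ?thesis using gb[of m] by (simp add: mult.assoc flip: power_add)
    qed
    have gb'': "norm (g m) \<le> (if N - s \<le> m then (z * y ^ N) * y ^ (m - (N - s)) else 0)" for m
    proof (cases "N - s \<le> m")
      case False
      then show ?thesis using g0[of m] by simp
    next
      case True
      have "m - (N - s) \<le> m + s - N" by arith
      then have "y ^ (m + s - N) \<le> y ^ (m - (N - s))" using y by (simp add: power_decreasing)
      then have "(z * y ^ N) * y ^ (m + s - N) \<le> (z * y ^ N) * y ^ (m - (N - s))"
        using z y by (intro mult_left_mono) auto
      then show ?thesis using gb'[of m] True by simp
    qed
    have sums: "(\<lambda>m. if N - s \<le> m then (z * y ^ N) * y ^ (m - (N - s)) else 0) sums ((z * y ^ N) * (1 / (1 - y)))"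
    proof -
      have "(\<lambda>m. (z * y ^ N) * y ^ m) sums ((z * y ^ N) * (1 / (1 - y)))"
        using y by (intro sums_mult geometric_sums) simp
      then show ?thesis
        by (subst sums_zero_iff_shift[of "N - s", symmetric]) auto
    qed
    have "\<bar>jet s x G\<bar> = norm (\<Sum>m. g m)" by (simp add: jet_def eval_fps_def g_def)
    also have "\<dots> \<le> (\<Sum>m. if N - s \<le> m then (z * y ^ N) * y ^ (m - (N - s)) else 0)"
      using sums by (intro norm_suminf_le gb'') (rule sums_summable)
    also have "\<dots> = (z * y ^ N) * (1 / (1 - y))" using sums by (rule sums_unique[symmetric])
    also have "\<dots> = C * K * (\<theta>' * \<bar>x\<bar>) ^ N" by (simp add: C_def z_def y_def)
    finally show "\<bar>jet s x G\<bar> \<le> C * K * (\<theta>' * \<bar>x\<bar>) ^ N" .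
  qed
qed

lemma jet_integrality:
  fixes a b :: int
  assumes "deg_le e G" "\<And>m. G $ m \<in> \<int>" "b \<noteq> 0"
  shows "of_int b ^ e * jet s (of_int a / of_int b) G \<in> \<int>"
proof -
  let ?g = "\<lambda>m. (fps_deriv ^^ s) G $ m"
  have g: "?g m = 0" if "m > e" for m using that assms(1) by (simp add: higher_fps_deriv_nth deg_le_def)
  have "jet s (of_int a / of_int b) G = (\<Sum>m\<le>e. ?g m * (of_int a / of_int b) ^ m)"
    unfolding jet_def eval_fps_def using g by (intro suminf_finite) auto
  then have "of_int b ^ e * jet s (of_int a / of_int b) G = (\<Sum>m\<le>e. ?g m * (of_int a ^ m * of_int b ^ (e - m)))"
    by (simp only: sum_distrib_left)
       (intro sum.cong refl, use assms(3) in \<open>auto simp: power_divide power_diff\<close>)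
  also have "\<dots> \<in> \<int>"
    unfolding higher_fps_deriv_nth using assms(2)
    by (intro Ints_sum Ints_mult Ints_prod Ints_power) (auto simp del: of_nat_add)
  finally show ?thesis .
qed

section \<open>Transfer from \<open>x^k^n\<close> to \<open>x\<close>\<close>

primrec transfer_denom :: "nat \<Rightarrow> (nat \<Rightarrow> 'a::comm_ring_1 fps) \<Rightarrow> nat \<Rightarrow> 'a fps" where
  "transfer_denom k A 0 = 1"
| "transfer_denom k A (Suc n) = dil (k ^ n) (A 0) * transfer_denom k A n"

text \<open>These are the numerators of the equation iterated \<open>n\<close> times:
  \<open>F(x^k^n)\<close> is eliminated by the equation at \<open>x^k^n\<close>, after multiplying
  by \<open>dil (k ^ n) (A 0)\<close> instead of dividing. The value 0 from index \<open>d\<close>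
  on is what the case \<open>i = d - 1\<close> reads at \<open>Suc i\<close>.\<close>

primrec transfer_num :: "nat \<Rightarrow> nat \<Rightarrow> (nat \<Rightarrow> 'a::comm_ring_1 fps) \<Rightarrow> nat \<Rightarrow> nat \<Rightarrow> 'a fps" where
  "transfer_num k d A 0 = (\<lambda>i. if i = 0 then 1 else 0)"
| "transfer_num k d A (Suc n) = (\<lambda>i. if i < d then dil (k ^ n) (A 0) * transfer_num k d A n (Suc i)
      - dil (k ^ n) (A (Suc i)) * transfer_num k d A n 0 else 0)"

lemma transfer_num_ge: "d \<ge> 1 \<Longrightarrow> d \<le> i \<Longrightarrow> transfer_num k d A n i = 0"
  by (cases n) auto

lemma transfer_identity:
  fixes F :: "'a::idom fps"
  assumes k: "k > 0" and d: "d \<ge> 1" and eq: "(\<Sum>i\<le>d. A i * dil (k ^ i) F) = 0"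
  shows "transfer_denom k A n * F = (\<Sum>i<d. transfer_num k d A n i * dil (k ^ (n + i)) F)"
proof (induction n)
  case 0
  have "(\<Sum>i<d. (if i = 0 then 1 else 0) * dil (k ^ i) F) = (\<Sum>i\<in>{0}. (if i = 0 then 1 else 0) * dil (k ^ i) F)"
    using d by (intro sum.mono_neutral_right) auto
  then show ?case by simp
next
  case (Suc n)
  let ?f = "\<lambda>i. dil (k ^ (n + i)) F" and ?C = "transfer_num k d A n" and ?\<sigma> = "\<lambda>G. dil (k ^ n) G"
  have kpos: "k ^ i > 0" for i using k by simp
  have "0 = ?\<sigma> (\<Sum>i\<le>d. A i * dil (k ^ i) F)" by (simp add: eq)
  also have "\<dots> = (\<Sum>i\<le>d. ?\<sigma> (A i) * ?f i)"
    by (simp add: dil_sum dil_mult[OF kpos] dil_dil[OF kpos kpos] power_add mult.commute)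
  also have "\<dots> = (\<Sum>i<Suc d. ?\<sigma> (A i) * ?f i)" by (simp add: lessThan_Suc_atMost)
  also have "\<dots> = ?\<sigma> (A 0) * ?f 0 + (\<Sum>i<d. ?\<sigma> (A (Suc i)) * ?f (Suc i))"
    by (subst sum.lessThan_Suc_shift) simp
  finally have rel: "?\<sigma> (A 0) * ?f 0 = - (\<Sum>i<d. ?\<sigma> (A (Suc i)) * ?f (Suc i))"
    by (simp only: eq_neg_iff_add_eq_0)
  have "(\<Sum>i<d. ?C i * ?f i) = (\<Sum>i<Suc d. ?C i * ?f i)"
    by (simp add: transfer_num_ge[OF d])
  also have "\<dots> = ?C 0 * ?f 0 + (\<Sum>i<d. ?C (Suc i) * ?f (Suc i))"
    by (subst sum.lessThan_Suc_shift) simp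
  finally have shift: "(\<Sum>i<d. ?C i * ?f i) = ?C 0 * ?f 0 + (\<Sum>i<d. ?C (Suc i) * ?f (Suc i))" .
  have "transfer_denom k A (Suc n) * F = ?\<sigma> (A 0) * (\<Sum>i<d. ?C i * ?f i)"
    using Suc by (simp add: mult.assoc)
  also have "\<dots> = ?C 0 * (?\<sigma> (A 0) * ?f 0) + ?\<sigma> (A 0) * (\<Sum>i<d. ?C (Suc i) * ?f (Suc i))"
    unfolding shift by (simp only: distrib_left mult.left_commute)
  also have "\<dots> = (\<Sum>i<d. ?\<sigma> (A 0) * ?C (Suc i) * ?f (Suc i) - ?\<sigma> (A (Suc i)) * ?C 0 * ?f (Suc i))"
    unfolding rel by (simp add: sum_distrib_left sum_subtractf mult_ac)
  also have "\<dots> = (\<Sum>i<d. transfer_num k d A (Suc n) i * dil (k ^ (Suc n + i)) F)"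
    by (intro sum.cong) (auto simp: algebra_simps)
  finally show ?case .
qed

text \<open>The degrees add up to at most \<open>H * (1 + k + ... + k^(n-1))\<close>, and
  \<open>k \<ge> 2\<close> lets \<open>H * k ^ n\<close> absorb the sum.\<close>

lemma transfer_degree_step:
  fixes F G :: "'a::comm_ring_1 fps"
  assumes "k \<ge> 2" "deg_le H F" "deg_le (H * k ^ n) G"
  shows "deg_le (H * k ^ Suc n) (dil (k ^ n) F * G)"
proof -
  have "deg_le (k ^ n * H + H * k ^ n) (dil (k ^ n) F * G)"
    using assms by (intro deg_le_mult deg_le_dil) auto
  moreover have "k ^ n * H + H * k ^ n \<le> H * k ^ Suc n"
  proof -
    have "k ^ n * H + H * k ^ n = 2 * (H * k ^ n)" by simp
    also have "\<dots> \<le> k * (H * k ^ n)" by (rule mult_right_mono[OF assms(1)]) simp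
    also have "\<dots> = H * k ^ Suc n" by simp
    finally show ?thesis .
  qed
  ultimately show ?thesis by (rule deg_le_mono)
qed

lemma deg_le_transfer_denom:
  assumes "k \<ge> 2" "deg_le H (A 0)"
  shows "deg_le (H * k ^ n) (transfer_denom k A n)"
proof (induction n)
  case (Suc n)
  then show ?case using transfer_degree_step[OF assms] by simp
qed simp

lemma deg_le_transfer_num:
  assumes k: "k \<ge> 2" and A: "\<And>i. i \<le> d \<Longrightarrow> deg_le H (A i)"
  shows "deg_le (H * k ^ n) (transfer_num k d A n i)"
proof (induction n arbitrary: i)
  case (Suc n)
  show ?case
  proof (cases "i < d")
    case True
    then show ?thesis unfolding transfer_num.simps
      using transfer_degree_step[OF k A Suc, of 0 "Suc i"] transfer_degree_step[OF k A Suc, of "Suc i" 0]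
      by (auto intro: deg_le_diff)
  qed simp
qed simp

lemma dil_poly: "m > 0 \<Longrightarrow> dil m (fps_of_poly p) = fps_of_poly (pcompose p (monom 1 m :: 'a::idom poly))"
  by (subst fps_of_poly_pcompose) (simp_all add: fps_of_poly_monom')

lemma poly_power_diff_root:
  fixes x :: real
  assumes "m > 0" "x \<noteq> 0"
  obtains h where "monom 1 m - [:x ^ m:] = [:-x, 1:] * h" "poly h x \<noteq> 0"
proof -
  have "poly (monom 1 m - [:x ^ m:]) x = 0" by (simp add: poly_monom)
  then have "[:-x, 1:] dvd monom 1 m - [:x ^ m:]" by (simp only: poly_eq_0_iff_dvd)
  then obtain h where h: "monom 1 m - [:x ^ m:] = [:-x, 1:] * h" by (rule dvdE)
  have "poly (pderiv (monom 1 m - [:x ^ m:])) x = poly h x"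
    unfolding h pderiv_mult by (simp add: pderiv_pCons)
  moreover have "poly (pderiv (monom 1 m - [:x ^ m:])) x = real m * x ^ (m - 1)"
    by (simp add: pderiv_diff pderiv_monom poly_monom pderiv_pCons)
  ultimately show ?thesis using that h assms by auto
qed

text \<open>Since the points \<open>x^k^j\<close> are distinct, each root of \<open>p\<close> contributes at most a simple zero.\<close>

lemma order_prod_dilations:
  fixes p :: "real poly" and x :: real
  assumes "p \<noteq> 0" "0 < \<bar>x\<bar>" "\<bar>x\<bar> < 1" "k \<ge> 2"
  shows "\<exists>s g. s \<le> degree p \<and> (\<Prod>j<n. pcompose p (monom 1 (k ^ j))) = [:-x, 1:] ^ s * g \<and> poly g x \<noteq> 0"
  using assms(1)
proof (induction "degree p" arbitrary: p rule: less_induct)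
  case less
  have distinct: "x ^ (k ^ i) \<noteq> x ^ (k ^ j)" if "i \<noteq> j" for i j :: nat
  proof -
    have "\<bar>x\<bar> ^ (k ^ j) < \<bar>x\<bar> ^ (k ^ i)" if "i < j" for i j :: nat
      using assms that by (intro power_strict_decreasing power_strict_increasing) auto
    then have "\<bar>x\<bar> ^ (k ^ i) \<noteq> \<bar>x\<bar> ^ (k ^ j)" using that by (metis less_irrefl nat_neq_iff)
    then show ?thesis by (metis power_abs)
  qed
  show ?case
  proof (cases "\<exists>j<n. poly p (x ^ (k ^ j)) = 0")
    case False
    then have "poly (\<Prod>j<n. pcompose p (monom 1 (k ^ j))) x \<noteq> 0"
      by (auto simp: poly_prod poly_pcompose poly_monom)
    then show ?thesis by (intro exI[of _ 0] exI[of _ "\<Prod>j<n. pcompose p (monom 1 (k ^ j))"]) simp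
  next
    case True
    then obtain j0 where j0: "j0 < n" "poly p (x ^ (k ^ j0)) = 0" by blast
    define \<beta> where "\<beta> = x ^ (k ^ j0)"
    have "[:-\<beta>, 1:] dvd p" using j0 by (simp only: \<beta>_def poly_eq_0_iff_dvd)
    then obtain q where q: "p = [:-\<beta>, 1:] * q" by (rule dvdE)
    have q0: "q \<noteq> 0" using q less.prems by auto
    have dq: "degree p = Suc (degree q)" using q0 unfolding q by (subst degree_mult_eq) auto
    obtain s g where g: "s \<le> degree q" "(\<Prod>j<n. pcompose q (monom 1 (k ^ j))) = [:-x, 1:] ^ s * g"
      "poly g x \<noteq> 0" using less.hyps[of q] dq q0 by auto
    \<comment> \<open>A root \<open>\<beta>\<close> of \<open>p\<close> contributes the factors
      \<open>monom 1 (k ^ j) - [:\<beta>:]\<close>. The one with \<open>j = j0\<close> has a simple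
      zero at \<open>x\<close>; the others, collected in \<open>R\<close>, do not vanish
      there.\<close>
    obtain h where h: "monom 1 (k ^ j0) - [:\<beta>:] = [:-x, 1:] * h" "poly h x \<noteq> 0"
      using poly_power_diff_root[of "k ^ j0" x] assms unfolding \<beta>_def by auto
    define R where "R = (\<Prod>j\<in>{..<n} - {j0}. monom 1 (k ^ j) - [:\<beta>:])"
    have R: "poly R x \<noteq> 0"
      using distinct by (auto simp: R_def poly_prod poly_monom \<beta>_def)
    have pc: "pcompose p (monom 1 (k ^ j)) = (monom 1 (k ^ j) - [:\<beta>:]) * pcompose q (monom 1 (k ^ j))" for j
      unfolding q pcompose_mult by (simp add: pcompose_pCons)
    have "(\<Prod>j<n. monom 1 (k ^ j) - [:\<beta>:]) = (monom 1 (k ^ j0) - [:\<beta>:]) * R"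
      unfolding R_def using j0 by (subst prod.remove[of _ j0]) auto
    then have "(\<Prod>j<n. pcompose p (monom 1 (k ^ j))) = [:-x, 1:] ^ Suc s * (h * R * g)"
      unfolding pc prod.distrib g(2) h(1) by (simp only: power_Suc mult_ac)
    moreover have "poly (h * R * g) x \<noteq> 0" using R h g by simp
    ultimately show ?thesis using dq g(1) by (intro exI[of _ "Suc s"] exI[of _ "h * R * g"]) auto
  qed
qed

lemma transfer_denom_order:
  fixes p :: "real poly" and x :: real
  assumes "fps_of_poly p = A 0" "p \<noteq> 0" "0 < \<bar>x\<bar>" "\<bar>x\<bar> < 1" "k \<ge> 2"
  obtains s g where "s \<le> degree p" "transfer_denom k A n = lin x ^ s * fps_of_poly g" "poly g x \<noteq> 0"
proof -
  obtain s g where g: "s \<le> degree p" "(\<Prod>j<n. pcompose p (monom 1 (k ^ j))) = [:-x, 1:] ^ s * g" "poly g x \<noteq> 0"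
    using order_prod_dilations[OF assms(2-5)] by blast
  have "transfer_denom k A n = fps_of_poly (\<Prod>j<n. pcompose p (monom 1 (k ^ j)))" for n
  proof (induction n)
    case (Suc n)
    then show ?case using dil_poly[of "k ^ n" p] assms by (simp add: fps_of_poly_mult mult.commute)
  qed simp
  also have "\<dots> n = lin x ^ s * fps_of_poly g"
    unfolding g(2) by (simp add: fps_of_poly_mult fps_of_poly_power lin_def fps_of_poly_pCons)
  finally show ?thesis using that g by blast
qed

section \<open>Coefficient growth of the transfer polynomials\<close>

text \<open>The number \<open>c\<close> bounds the operator norm of multiplication by
  \<open>B\<close> for the supremum norm of the coefficients with weights
  \<open>\<theta> ^ (-m)\<close>. Such norms are submultiplicative, so an \<open>n\<close>-fold
  iteration costs an \<open>n\<close>-th power.\<close>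

definition mult_bounded :: "real \<Rightarrow> real fps \<Rightarrow> real \<Rightarrow> bool" where
  "mult_bounded \<theta> B c \<longleftrightarrow> (\<forall>G K. 0 \<le> K \<longrightarrow> (\<forall>m. \<bar>G $ m\<bar> \<le> K * \<theta> ^ m) \<longrightarrow>
      (\<forall>m. \<bar>(B * G) $ m\<bar> \<le> c * K * \<theta> ^ m))"

lemma mult_boundedD:
  "mult_bounded \<theta> B c \<Longrightarrow> 0 \<le> K \<Longrightarrow> (\<And>m. \<bar>G $ m\<bar> \<le> K * \<theta> ^ m) \<Longrightarrow> \<bar>(B * G) $ m\<bar> \<le> c * K * \<theta> ^ m"
  by (simp add: mult_bounded_def)

lemma mult_bounded_mono:
  assumes "mult_bounded \<theta> B c" "c \<le> c'" "0 \<le> \<theta>"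
  shows "mult_bounded \<theta> B c'"
  unfolding mult_bounded_def
proof (intro allI impI)
  fix G K m assume K: "0 \<le> K" "\<forall>m. \<bar>G $ m\<bar> \<le> K * \<theta> ^ m"
  have "\<bar>(B * G) $ m\<bar> \<le> c * K * \<theta> ^ m" using K by (intro mult_boundedD[OF assms(1)]) auto
  also have "\<dots> \<le> c' * K * \<theta> ^ m" using assms K by (intro mult_right_mono) auto
  finally show "\<bar>(B * G) $ m\<bar> \<le> c' * K * \<theta> ^ m" .
qed

lemma mult_bounded_mult:
  assumes "mult_bounded \<theta> B c" "mult_bounded \<theta> B' c'" "0 \<le> c'"
  shows "mult_bounded \<theta> (B * B') (c * c')"
  unfolding mult_bounded_def
proof (intro allI impI)
  fix G K m assume K: "0 \<le> K" "\<forall>m. \<bar>G $ m\<bar> \<le> K * \<theta> ^ m"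
  have "\<bar>(B' * G) $ m\<bar> \<le> (c' * K) * \<theta> ^ m" for m
    using mult_boundedD[OF assms(2) K(1), of G] K(2) by blast
  from mult_boundedD[OF assms(1) _ this, of m] K assms(3)
  show "\<bar>(B * B' * G) $ m\<bar> \<le> c * c' * K * \<theta> ^ m" by (simp add: mult.assoc)
qed

lemma mult_bounded_diff:
  assumes "mult_bounded \<theta> B c" "mult_bounded \<theta> B' c'"
  shows "mult_bounded \<theta> (B - B') (c + c')"
  unfolding mult_bounded_def
proof (intro allI impI)
  fix G K m assume K: "0 \<le> K" "\<forall>m. \<bar>G $ m\<bar> \<le> K * \<theta> ^ m"
  have "\<bar>(B * G) $ m\<bar> \<le> c * K * \<theta> ^ m" "\<bar>(B' * G) $ m\<bar> \<le> c' * K * \<theta> ^ m"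
    using mult_boundedD[OF assms(1) K(1), of G] mult_boundedD[OF assms(2) K(1), of G] K(2) by blast+
  then show "\<bar>((B - B') * G) $ m\<bar> \<le> (c + c') * K * \<theta> ^ m"
    by (simp add: left_diff_distrib distrib_right)
qed

lemma mult_bounded_0: "mult_bounded \<theta> 0 0"
  by (simp add: mult_bounded_def)

lemma mult_bounded_1: "mult_bounded \<theta> 1 1"
  by (simp add: mult_bounded_def)

lemma mult_bounded_monomial:
  assumes "1 \<le> \<theta>"
  shows "mult_bounded \<theta> (fps_const a * fps_X ^ j) \<bar>a\<bar>"
  unfolding mult_bounded_def
proof (intro allI impI)
  fix G K m assume K: "0 \<le> K" "\<forall>m. \<bar>G $ m\<bar> \<le> K * \<theta> ^ m"
  have "\<bar>(fps_X ^ j * G) $ m\<bar> \<le> K * \<theta> ^ m"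
  proof (cases "m < j")
    case False
    have "\<bar>G $ (m - j)\<bar> \<le> K * \<theta> ^ (m - j)" using K by blast
    also have "\<dots> \<le> K * \<theta> ^ m" using K assms by (intro mult_left_mono power_increasing) auto
    finally show ?thesis using False by (simp add: fps_X_power_mult_nth)
  qed (use K assms in \<open>simp add: fps_X_power_mult_nth\<close>)
  then have "\<bar>a\<bar> * \<bar>(fps_X ^ j * G) $ m\<bar> \<le> \<bar>a\<bar> * (K * \<theta> ^ m)" by (intro mult_left_mono) auto
  then show "\<bar>(fps_const a * fps_X ^ j * G) $ m\<bar> \<le> \<bar>a\<bar> * K * \<theta> ^ m"
    by (simp add: mult.assoc abs_mult)
qed

lemma mult_bounded_sum:
  assumes "finite J" "0 \<le> \<theta>" "\<And>j. j \<in> J \<Longrightarrow> mult_bounded \<theta> (B j) c"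
  shows "mult_bounded \<theta> (\<Sum>j\<in>J. B j) (of_nat (card J) * c)"
  using assms
proof (induction J rule: finite_induct)
  case (insert j J)
  then have 1: "mult_bounded \<theta> (B j) c" "mult_bounded \<theta> (\<Sum>j\<in>J. B j) (of_nat (card J) * c)" by auto
  show ?case
    unfolding mult_bounded_def
  proof (intro allI impI)
    fix G K m assume K: "0 \<le> K" "\<forall>m. \<bar>G $ m\<bar> \<le> K * \<theta> ^ m"
    have "\<bar>(B j * G) $ m\<bar> \<le> c * K * \<theta> ^ m" "\<bar>((\<Sum>j\<in>J. B j) * G) $ m\<bar> \<le> of_nat (card J) * c * K * \<theta> ^ m"
      using mult_boundedD[OF 1(1) K(1), of G] mult_boundedD[OF 1(2) K(1), of G] K(2) by blast+
    then show "\<bar>((\<Sum>j\<in>insert j J. B j) * G) $ m\<bar> \<le> of_nat (card (insert j J)) * c * K * \<theta> ^ m"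
      using insert.hyps by (simp add: distrib_right)
  qed
qed (simp add: mult_bounded_0)

lemma dil_deg_le_expand:
  fixes G :: "'a::idom fps"
  assumes "deg_le D G" "m > 0"
  shows "dil m G = (\<Sum>j\<le>D. fps_const (G $ j) * fps_X ^ (m * j))"
proof -
  have "G = (\<Sum>j\<le>D. fps_const (G $ j) * fps_X ^ j)"
    using assms by (intro fps_ext) (auto simp: fps_sum_nth fps_X_power_nth deg_le_def if_distrib cong: if_cong)
  then have "dil m G = dil m (\<Sum>j\<le>D. fps_const (G $ j) * fps_X ^ j)" by (rule arg_cong)
  also have "\<dots> = (\<Sum>j\<le>D. dil m (fps_const (G $ j) * fps_X ^ j))" by (rule dil_sum)
  also have "\<dots> = (\<Sum>j\<le>D. fps_const (G $ j) * fps_X ^ (m * j))"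
  proof (rule sum.cong[OF refl])
    fix j
    have "dil m (fps_X ^ j :: 'a fps) = fps_X ^ (m * j)"
      using assms(2) by (simp add: power_mult flip: fps_compose_power)
    then show "dil m (fps_const (G $ j) * fps_X ^ j) = fps_const (G $ j) * fps_X ^ (m * j)"
      using assms(2) by (simp add: dil_mult)
  qed
  finally show ?thesis .
qed

text \<open>For \<open>\<theta> \<ge> 1\<close>, multiplication by a power of \<open>x\<close> has
  norm at most 1. Hence only the number of coefficients counts and not the dilation
  \<open>m\<close>, and the transfer polynomials grow exponentially in \<open>n\<close> rather than
  in \<open>k ^ n\<close>.\<close>

lemma mult_bounded_dil:
  assumes "1 \<le> \<theta>" "deg_le H G" "\<And>j. \<bar>G $ j\<bar> \<le> h" "m > 0"
  shows "mult_bounded \<theta> (dil m G) (of_nat (Suc H) * h)"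
proof -
  have "mult_bounded \<theta> (\<Sum>j\<le>H. fps_const (G $ j) * fps_X ^ (m * j)) (of_nat (card {..H}) * h)"
  proof (rule mult_bounded_sum)
    show "mult_bounded \<theta> (fps_const (G $ j) * fps_X ^ (m * j)) h" for j
      using assms by (intro mult_bounded_mono[OF mult_bounded_monomial]) auto
  qed (use assms in auto)
  then show ?thesis using assms by (simp add: dil_deg_le_expand)
qed

lemma mult_bounded_transfer:
  assumes \<theta>: "1 \<le> \<theta>" and k: "k > 0" and A: "\<And>i. i \<le> d \<Longrightarrow> deg_le H (A i)"
    and h: "\<And>i j. i \<le> d \<Longrightarrow> \<bar>A i $ j\<bar> \<le> h" and h1: "1 \<le> h"
  shows "mult_bounded \<theta> (transfer_denom k A n) ((2 * (of_nat (Suc H) * h)) ^ n)"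
    and "mult_bounded \<theta> (transfer_num k d A n i) ((2 * (of_nat (Suc H) * h)) ^ n)"
proof -
  define c where "c = of_nat (Suc H) * h"
  have c: "c \<ge> 0" using h1 by (simp add: c_def)
  have b: "mult_bounded \<theta> (dil (k ^ n) (A i)) c" if "i \<le> d" for n i
    unfolding c_def using \<theta> A[OF that] h[OF that] k by (intro mult_bounded_dil) auto
  show "mult_bounded \<theta> (transfer_denom k A n) ((2 * (of_nat (Suc H) * h)) ^ n)"
    unfolding c_def[symmetric]
  proof (induction n)
    case (Suc n)
    show ?case
    proof (rule mult_bounded_mono)
      show "mult_bounded \<theta> (transfer_denom k A (Suc n)) (c * (2 * c) ^ n)"
        using mult_bounded_mult[OF b[of 0 n] Suc] c by simp
    qed (use c \<theta> in \<open>auto simp: mult_right_mono\<close>)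
  qed (simp add: mult_bounded_1)
  show "mult_bounded \<theta> (transfer_num k d A n i) ((2 * (of_nat (Suc H) * h)) ^ n)"
    unfolding c_def[symmetric]
  proof (induction n arbitrary: i)
    case 0
    have "mult_bounded \<theta> 0 1" using \<theta> by (simp add: mult_bounded_def)
    then show ?case by (simp add: mult_bounded_1)
  next
    case (Suc n)
    show ?case
    proof (cases "i < d")
      case True
      have "mult_bounded \<theta> (dil (k ^ n) (A 0) * transfer_num k d A n (Suc i)) (c * (2 * c) ^ n)"
        using c by (intro mult_bounded_mult[OF b Suc]) auto
      moreover have "mult_bounded \<theta> (dil (k ^ n) (A (Suc i)) * transfer_num k d A n 0) (c * (2 * c) ^ n)"
        using c True by (intro mult_bounded_mult[OF b Suc]) auto
      ultimately have "mult_bounded \<theta> (transfer_num k d A (Suc n) i) (c * (2 * c) ^ n + c * (2 * c) ^ n)"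
        unfolding transfer_num.simps by (simp only: True if_True mult_bounded_diff)
      then show ?thesis by (simp add: mult_ac)
    next
      case False
      moreover have "mult_bounded \<theta> 0 ((2 * c) ^ Suc n)" using c \<theta> by (simp add: mult_bounded_def)
      ultimately show ?thesis by simp
    qed
  qed
qed

section \<open>Linear forms in \<open>1\<close> and \<open>F(x)\<close>\<close>

text \<open>A tuple is one integer vector: index \<open>d\<close> carries the common denominator
  \<open>Q\<close>, the indices below \<open>d\<close> carry the numerators.\<close>

definition tuple_poly :: "nat \<Rightarrow> (nat \<times> nat \<Rightarrow> int) \<Rightarrow> nat \<Rightarrow> real fps" where
  "tuple_poly D v i = Abs_fps (\<lambda>j. if j \<le> D then of_int (v (i, j)) else 0)"

lemma deg_le_tuple_poly: "deg_le D (tuple_poly D v i)"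
  by (simp add: deg_le_def tuple_poly_def)

lemma integer_approximants:
  fixes f :: "nat \<Rightarrow> int fps"
  assumes "D < M"
  shows "\<exists>B. finite B \<and>
    (\<forall>v\<in>B. \<forall>i<d. ord_ge M (tuple_poly D v d * real_fps (f i) - tuple_poly D v i)) \<and>
    (\<forall>lq lp. (\<forall>v\<in>B. (\<Sum>j\<le>D. lq j * of_int (v (d, j))) + (\<Sum>i<d. \<Sum>j\<le>D. lp i j * of_int (v (i, j))) = 0) \<longrightarrow>
       (\<exists>g. (\<forall>i<d. \<forall>j\<le>D. lp i j = - g i j) \<and>
            (\<forall>j\<le>D. lq j = (\<Sum>i<d. \<Sum>m\<in>{j..<M}. g i m * real_fps (f i) $ (m - j)))))"
proof -
  \<comment> \<open>The row \<open>(i, m)\<close> is the coefficient of \<open>x^m\<close> in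
    \<open>Q * f i - P\<^sub>i\<close>, as a linear form in the coefficients of the tuple. The entry
    -1 produces the sign in \<open>lp i j = - g i j\<close>.\<close>
  define \<phi> where "\<phi> = (\<lambda>(i, m) (i', j). if i' = d then if j \<le> m then f i $ (m - j) else 0
      else if i' = i \<and> j = m then -1 else 0 :: int)"
  define I where "I = {..<d} \<times> {..<M}"
  define J where "J = {..d} \<times> {..D}"
  have sumJ: "(\<Sum>x\<in>J. h x) = (\<Sum>j\<le>D. h (d, j)) + (\<Sum>i<d. \<Sum>j\<le>D. h (i, j))" for h :: "nat \<times> nat \<Rightarrow> 'b::comm_monoid_add"
  proof -
    have "(\<Sum>x\<in>J. h x) = (\<Sum>i\<le>d. \<Sum>j\<le>D. h (i, j))" by (simp add: J_def sum.cartesian_product)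
    then show ?thesis by (simp add: lessThan_Suc_atMost[symmetric] add.commute)
  qed
  have sumI: "(\<Sum>x\<in>I. h x) = (\<Sum>i<d. \<Sum>m<M. h (i, m))" for h :: "nat \<times> nat \<Rightarrow> real"
    by (simp add: I_def sum.cartesian_product)
  obtain B where B: "finite B" "\<And>v i. v \<in> B \<Longrightarrow> i \<in> I \<Longrightarrow> (\<Sum>j\<in>J. \<phi> i j * v j) = 0"
    and span: "\<And>l :: nat \<times> nat \<Rightarrow> real. (\<forall>v\<in>B. (\<Sum>j\<in>J. l j * of_int (v j)) = 0) \<Longrightarrow>
       \<exists>g. \<forall>j\<in>J. l j = (\<Sum>i\<in>I. g i * of_int (\<phi> i j))"
    using integer_kernel_spanning_set[of I J \<phi>] by (auto simp: I_def J_def)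
  have "ord_ge M (tuple_poly D v d * real_fps (f i) - tuple_poly D v i)" if v: "v \<in> B" and i: "i < d" for v i
    unfolding ord_ge_def
  proof (intro allI impI)
    fix m assume m: "m < M"
    have "(\<Sum>j\<le>D. \<phi> (i, m) (d, j) * v (d, j)) = (\<Sum>j\<in>{..D} \<inter> {..m}. f i $ (m - j) * v (d, j))"
      by (rule sum.mono_neutral_cong_right) (auto simp: \<phi>_def)
    then have "real_of_int (\<Sum>j\<le>D. \<phi> (i, m) (d, j) * v (d, j))
        = (\<Sum>j\<in>{..D} \<inter> {..m}. tuple_poly D v d $ j * real_fps (f i) $ (m - j))"
      by (simp add: tuple_poly_def real_fps_def mult.commute)
    also have "\<dots> = (\<Sum>j\<le>m. tuple_poly D v d $ j * real_fps (f i) $ (m - j))"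
      by (rule sum.mono_neutral_left) (auto simp: tuple_poly_def)
    finally have 1: "real_of_int (\<Sum>j\<le>D. \<phi> (i, m) (d, j) * v (d, j)) = (tuple_poly D v d * real_fps (f i)) $ m"
      by (simp add: fps_mult_nth atLeast0AtMost)
    have "(\<Sum>i'<d. \<Sum>j\<le>D. \<phi> (i, m) (i', j) * v (i', j)) = (\<Sum>i'<d. if i' = i then \<Sum>j\<le>D. if j = m then - v (i, m) else 0 else 0)"
    proof (rule sum.cong[OF refl])
      fix i' assume "i' \<in> {..<d}"
      then have "\<phi> (i, m) (i', j) * v (i', j) = (if i' = i then if j = m then - v (i, m) else 0 else 0)" for j
        by (auto simp: \<phi>_def)
      then show "(\<Sum>j\<le>D. \<phi> (i, m) (i', j) * v (i', j))
          = (if i' = i then \<Sum>j\<le>D. if j = m then - v (i, m) else 0 else 0)" by simp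
    qed
    also have "\<dots> = (if m \<le> D then - v (i, m) else 0)" using i by simp
    finally have 2: "real_of_int (\<Sum>i'<d. \<Sum>j\<le>D. \<phi> (i, m) (i', j) * v (i', j)) = - tuple_poly D v i $ m"
      by (simp add: tuple_poly_def)
    have "(i, m) \<in> I" using i m by (simp add: I_def)
    from B(2)[OF v this] have "real_of_int (\<Sum>j\<le>D. \<phi> (i, m) (d, j) * v (d, j))
       + real_of_int (\<Sum>i'<d. \<Sum>j\<le>D. \<phi> (i, m) (i', j) * v (i', j)) = 0"
      unfolding sumJ by (simp only: of_int_add[symmetric] of_int_0)
    then show "(tuple_poly D v d * real_fps (f i) - tuple_poly D v i) $ m = 0"
      unfolding 1 2 by simp
  qed
  moreover have "\<exists>g. (\<forall>i<d. \<forall>j\<le>D. lp i j = - g i j) \<and>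
            (\<forall>j\<le>D. lq j = (\<Sum>i<d. \<Sum>m\<in>{j..<M}. g i m * real_fps (f i) $ (m - j)))"
    if l: "\<forall>v\<in>B. (\<Sum>j\<le>D. lq j * of_int (v (d, j))) + (\<Sum>i<d. \<Sum>j\<le>D. lp i j * of_int (v (i, j))) = 0" for lq lp
  proof -
    define l where "l = (\<lambda>(i, j). if i = d then lq j else lp i j)"
    have "\<forall>v\<in>B. (\<Sum>j\<in>J. l j * of_int (v j)) = 0"
    proof
      fix v assume "v \<in> B"
      moreover have "(\<Sum>i<d. \<Sum>j\<le>D. l (i, j) * of_int (v (i, j))) = (\<Sum>i<d. \<Sum>j\<le>D. lp i j * of_int (v (i, j)))"
        by (intro sum.cong) (auto simp: l_def)
      ultimately show "(\<Sum>j\<in>J. l j * of_int (v j)) = 0"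
        using l unfolding sumJ by (simp add: l_def)
    qed
    from span[OF this] obtain g where g: "\<And>j. j \<in> J \<Longrightarrow> l j = (\<Sum>i\<in>I. g i * of_int (\<phi> i j))" by blast
    have "lp i j = - g (i, j)" if "i < d" "j \<le> D" for i j
    proof -
      have "(i, j) \<in> J" using that by (simp add: J_def)
      from g[OF this] have "lp i j = (\<Sum>i'<d. \<Sum>m<M. g (i', m) * of_int (\<phi> (i', m) (i, j)))"
        using that unfolding sumI by (simp add: l_def)
      also have "\<dots> = (\<Sum>i'<d. if i' = i then \<Sum>m<M. if m = j then - g (i, j) else 0 else 0)"
      proof (rule sum.cong[OF refl])
        fix i'
        have "g (i', m) * of_int (\<phi> (i', m) (i, j)) = (if i' = i then if m = j then - g (i, j) else 0 else 0)" for m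
          using that by (auto simp: \<phi>_def)
        then show "(\<Sum>m<M. g (i', m) * of_int (\<phi> (i', m) (i, j)))
            = (if i' = i then \<Sum>m<M. if m = j then - g (i, j) else 0 else 0)" by simp
      qed
      also have "\<dots> = - g (i, j)" using that assms by simp
      finally show ?thesis .
    qed
    moreover have "lq j = (\<Sum>i<d. \<Sum>m\<in>{j..<M}. g (i, m) * real_fps (f i) $ (m - j))" if "j \<le> D" for j
    proof -
      have "(d, j) \<in> J" using that by (simp add: J_def)
      from g[OF this] have "lq j = (\<Sum>i'<d. \<Sum>m<M. g (i', m) * of_int (\<phi> (i', m) (d, j)))"
        unfolding sumI by (simp add: l_def)
      also have "\<dots> = (\<Sum>i<d. \<Sum>m\<in>{j..<M}. g (i, m) * real_fps (f i) $ (m - j))"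
        by (intro sum.cong[OF refl] sum.mono_neutral_cong_right) (auto simp: \<phi>_def real_fps_def)
      finally show ?thesis .
    qed
    ultimately show ?thesis by (intro exI[of _ "\<lambda>i m. g (i, m)"]) blast
  qed
  ultimately show ?thesis using B(1) by blast
qed

text \<open>This is why the functionals kill the multiples of \<open>\<omega>\<close>: after the
  substitution, a power of \<open>lin (x ^ m)\<close> is divisible by the same power of
  \<open>lin x\<close>, and a jet of order below the exponent does not see it.\<close>

lemma dil_lin_power:
  fixes x :: real
  assumes "m > 0" "x \<noteq> 0"
  obtains h where "dil m (lin (x ^ m) ^ t) = lin x ^ t * fps_of_poly h"
proof -
  obtain h where h: "monom 1 m - [:x ^ m:] = [:-x, 1:] * h"
    using poly_power_diff_root[OF assms] by blast
  have "dil m (lin (x ^ m)) = fps_X ^ m - fps_const (x ^ m)"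
    using assms(1) by (simp add: lin_def dil_diff)
  also have "\<dots> = fps_of_poly (monom 1 m - [:x ^ m:])"
    by (simp add: fps_of_poly_monom' fps_of_poly_pCons)
  finally have "dil m (lin (x ^ m)) = lin x * fps_of_poly h"
    unfolding h by (simp add: fps_of_poly_mult lin_def fps_of_poly_pCons)
  then have "dil m (lin (x ^ m) ^ t) = (lin x * fps_of_poly h) ^ t"
    using assms(1) by (simp flip: fps_compose_power)
  also have "\<dots> = lin x ^ t * fps_of_poly (h ^ t)"
    by (simp add: power_mult_distrib fps_of_poly_power)
  finally show ?thesis by (rule that)
qed

lemma jet_mult_dil_expand:
  assumes "deg_le D G" "m > 0" "ereal \<bar>x\<bar> < fps_conv_radius B"
  shows "jet s x (B * dil m G) = (\<Sum>j\<le>D. G $ j * jet s x (B * fps_X ^ (m * j)))"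
proof -
  have c: "ereal \<bar>x\<bar> < fps_conv_radius (B * fps_X ^ (m * j))" for j
    using assms(3) by (intro fps_conv_radius_mult_gt) simp_all
  have c': "ereal \<bar>x\<bar> < fps_conv_radius (fps_const (G $ j) * (B * fps_X ^ (m * j)))" for j
    by (rule fps_conv_radius_mult_gt[OF _ c]) simp
  have "B * dil m G = (\<Sum>j\<le>D. fps_const (G $ j) * (B * fps_X ^ (m * j)))"
    unfolding dil_deg_le_expand[OF assms(1,2)] sum_distrib_left by (simp add: mult_ac)
  then show ?thesis using c c' by (simp add: jet_sum jet_cmult)
qed

text \<open>The functional is the jet at \<open>x\<close> of \<open>\<nu>\<close> times the
  transferred denominator plus \<open>\<kappa>\<close> times the transferred numerators.
  \<open>lp_g\<close> and \<open>lq_g\<close> express it as a combination of the approximation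
  conditions, so by duality it kills \<open>(1; f\<^sub>i)\<close>, where its value is
  \<open>fact s * eval_fps g0 x * (\<nu> + \<kappa> * eval_fps F x)\<close>. The order
  \<open>M\<close> is tied to \<open>\<delta>'\<close> and not to \<open>\<delta>\<close>, so that
  it does not move with \<open>s\<close>.\<close>

lemma approximant_functional_nonvanishing:
  fixes F :: "real fps" and A :: "nat \<Rightarrow> real fps" and g0 :: "real fps"
  assumes k: "k \<ge> 2" and d: "d \<ge> 1" and degA: "\<And>i. i \<le> d \<Longrightarrow> deg_le \<delta>' (A i)" and A0: "A 0 \<noteq> 0"
    and eq: "(\<Sum>i\<le>d. A i * dil (k ^ i) F) = 0"
    and x: "0 < \<bar>x\<bar>" "\<bar>x\<bar> < 1" "ereal \<bar>x\<bar> < fps_conv_radius F"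
    and M: "M = (2 * d + 2) * (k ^ (d + 1) * \<delta>') + 1" and \<delta>': "\<delta> \<le> \<delta>'"
    and D: "\<delta> + D + 2 = M + Suc s" and DM: "D < M" and sD: "s \<le> D" and \<delta>: "\<delta> > 0"
    and order: "transfer_denom k A n = lin x ^ s * g0" "fps_conv_radius g0 = \<infinity>" "eval_fps g0 x \<noteq> 0"
    and lp_g: "\<And>i j. i < d \<Longrightarrow> j \<le> D \<Longrightarrow> \<kappa> * jet s x (transfer_num k d A n i * fps_X ^ (k ^ n * j)) = - g i j"
    and lq_g: "\<And>j. j \<le> D \<Longrightarrow> \<nu> * jet s x (transfer_denom k A n * fps_X ^ (k ^ n * j))
          = (\<Sum>i<d. \<Sum>m\<in>{j..<M}. g i m * dil (k ^ i) F $ (m - j))"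
  shows "\<nu> + \<kappa> * eval_fps F x = 0"
proof -
  define N where "N = k ^ n"
  define \<beta> where "\<beta> = x ^ N"
  have N: "N > 0" using k by (simp add: N_def)
  have x0: "x \<noteq> 0" using x by auto
  have \<beta>x: "\<bar>\<beta>\<bar> \<le> \<bar>x\<bar>"
    using power_decreasing[of 1 N "\<bar>x\<bar>"] x N by (simp add: \<beta>_def power_abs)
  let ?B = "transfer_denom k A n" and ?C = "transfer_num k d A n" and ?f = "\<lambda>i. dil (k ^ i) F"
  have kpos: "k ^ i > 0" for i using k by simp
  have degA0: "deg_le \<delta>' (A 0)" using degA[of 0] by simp
  have cB: "fps_conv_radius ?B = \<infinity>"
    using fps_conv_radius_deg_le[OF deg_le_transfer_denom[where A = A, OF k degA0]] .
  have cC: "fps_conv_radius (?C i) = \<infinity>" for i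
    using fps_conv_radius_deg_le[OF deg_le_transfer_num[where A = A, OF k degA]] .
  have cf: "ereal \<bar>x\<bar> < fps_conv_radius (?f i)" for i
    using x kpos by (intro fps_conv_radius_dil) auto
  have "\<forall>i. \<exists>r u. ?f i = r + lin \<beta> ^ Suc s * u \<and> deg_le s r \<and> ereal \<bar>x\<bar> < fps_conv_radius u"
    using divide_by_lin_power[OF \<beta>x x(2) cf] by metis
  then obtain r u where f: "\<And>i. ?f i = r i + lin \<beta> ^ Suc s * u i" and r: "\<And>i. deg_le s (r i)"
    and cu: "\<And>i. ereal \<bar>x\<bar> < fps_conv_radius (u i)" by metis
  obtain h where h: "dil N (lin \<beta> ^ Suc s) = lin x ^ Suc s * fps_of_poly h"
    unfolding \<beta>_def by (rule dil_lin_power[OF N x0])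
  define lq where "lq = (\<lambda>j. \<nu> * jet s x (?B * fps_X ^ (N * j)))"
  define lp where "lp = (\<lambda>i j. \<kappa> * jet s x (?C i * fps_X ^ (N * j)))"
  have killed: "(\<Sum>l\<le>Suc s. (lin \<beta> ^ Suc s) $ l * jet s x (E * fps_X ^ (N * (j + l)))) = 0"
    if E: "fps_conv_radius E = \<infinity>" for E j
  proof -
    have "jet s x (E * fps_X ^ (N * j) * dil N (lin \<beta> ^ Suc s)) =
       (\<Sum>l\<le>Suc s. (lin \<beta> ^ Suc s) $ l * jet s x (E * fps_X ^ (N * j) * fps_X ^ (N * l)))"
      using E by (intro jet_mult_dil_expand[OF deg_le_lin_power N] fps_conv_radius_mult_gt) simp_all
    also have "\<dots> = (\<Sum>l\<le>Suc s. (lin \<beta> ^ Suc s) $ l * jet s x (E * fps_X ^ (N * (j + l))))"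
      by (simp only: mult.assoc power_add[symmetric] distrib_left)
    moreover have "jet s x (E * fps_X ^ (N * j) * dil N (lin \<beta> ^ Suc s))
        = jet s x (lin x ^ Suc s * (fps_of_poly h * E * fps_X ^ (N * j)))"
      unfolding h by (simp only: mult_ac)
    moreover have "\<dots> = 0"
      using E by (intro jet_lin_power_Suc_mult fps_conv_radius_mult_gt) simp_all
    ultimately show ?thesis by simp
  qed
  have "lq 0 + (\<Sum>i<d. \<Sum>j<Suc s. r i $ j * lp i j) = 0"
  proof (rule simultaneous_approximation_duality[where f = ?f and u = u and \<omega> = "lin \<beta> ^ Suc s"
        and M = M and D = D and \<delta> = \<delta> and g = g])
    show "\<delta> + D + 2 = M + Suc s" "D < M" "\<delta> > 0" by fact+
    show "Suc s \<le> Suc D" using sD by simp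
    have "1 \<le> k ^ (d + 1)" using kpos[of "d+1"] by linarith
    then have "1 * (1 * \<delta>) \<le> (2 * d + 2) * (k ^ (d + 1) * \<delta>')"
      using \<delta>' by (intro mult_mono) auto
    then show "\<delta> < M" unfolding M by linarith
    show "(\<Sum>i<d. c i * ?f i) = c'" if "\<And>i. i < d \<Longrightarrow> deg_le \<delta> (c i)" "deg_le \<delta> c'"
      "ord_ge M ((\<Sum>i<d. c i * ?f i) - c')" for c c'
      by (rule mahler_zero_estimate[OF k degA A0 eq])
         (use that \<delta>' in \<open>auto simp only: M intro: deg_le_mono\<close>)
    show "deg_le (\<delta> - 1) (\<Sum>i<d. c i * u i)" if c: "\<And>i. i < d \<Longrightarrow> deg_le \<delta> (c i)"
      and dd: "deg_le (\<delta> + Suc s - 1) (lin \<beta> ^ Suc s * (\<Sum>i<d. c i * u i))" for c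
    proof (rule deg_le_lin_power_mult_cancel)
      have "\<delta> - 1 + Suc s = \<delta> + Suc s - 1" using \<delta> by simp
      then show "deg_le (\<delta> - 1 + Suc s) (lin \<beta> ^ Suc s * (\<Sum>i<d. c i * u i))" using dd by simp
      have "ereal \<bar>x\<bar> < fps_conv_radius (\<Sum>i<d. c i * u i)"
      proof (rule fps_conv_radius_sum_gt)
        fix i assume "i \<in> {..<d}"
        then have "fps_conv_radius (c i) = \<infinity>" using fps_conv_radius_deg_le[OF c] by simp
        then show "ereal \<bar>x\<bar> < fps_conv_radius (c i * u i)"
          using cu by (intro fps_conv_radius_mult_gt) simp_all
      qed simp
      then show "ereal \<bar>\<beta>\<bar> < fps_conv_radius (\<Sum>i<d. c i * u i)"
        using \<beta>x by (meson ereal_less_eq(3) le_less_trans)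
    qed
    show "deg_le (Suc s) (lin \<beta> ^ Suc s)" by (rule deg_le_lin_power)
    show "?f i = r i + lin \<beta> ^ Suc s * u i" for i by (rule f)
    show "deg_le (Suc s - 1) (r i)" for i using r by simp
    show "lp i j = - g i j" if "i < d" "j \<le> D" for i j
      using lp_g[OF that] by (simp add: lp_def N_def)
    show "lq j = (\<Sum>i<d. \<Sum>m\<in>{j..<M}. g i m * ?f i $ (m - j))" if "j \<le> D" for j
      using lq_g[OF that] by (simp add: lq_def N_def)
    show "(\<Sum>l\<le>Suc s. (lin \<beta> ^ Suc s) $ l * lp i (j + l)) = 0" for i j
    proof -
      have "(\<Sum>l\<le>Suc s. (lin \<beta> ^ Suc s) $ l * lp i (j + l))
        = \<kappa> * (\<Sum>l\<le>Suc s. (lin \<beta> ^ Suc s) $ l * jet s x (?C i * fps_X ^ (N * (j + l))))"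
        unfolding lp_def sum_distrib_left by (simp only: mult.left_commute)
      then show ?thesis by (simp only: killed[OF cC] mult_zero_right)
    qed
    show "(\<Sum>l\<le>Suc s. (lin \<beta> ^ Suc s) $ l * lq (j + l)) = 0" for j
    proof -
      have "(\<Sum>l\<le>Suc s. (lin \<beta> ^ Suc s) $ l * lq (j + l))
        = \<nu> * (\<Sum>l\<le>Suc s. (lin \<beta> ^ Suc s) $ l * jet s x (?B * fps_X ^ (N * (j + l))))"
        unfolding lq_def sum_distrib_left by (simp only: mult.left_commute)
      then show ?thesis by (simp only: killed[OF cB] mult_zero_right)
    qed
  qed simp
  \<comment> \<open>Replacing the residue \<open>r i\<close> by the full series changes the argument
    of the jet by a multiple of \<open>lin x ^ Suc s\<close>, which a jet of order \<open>s\<close>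
    ignores.\<close>
  moreover have "(\<Sum>j<Suc s. r i $ j * lp i j) = \<kappa> * jet s x (?C i * dil N (?f i))" for i
  proof -
    have 1: "(\<Sum>j<Suc s. r i $ j * lp i j) = \<kappa> * jet s x (?C i * dil N (r i))"
      unfolding lp_def using cC
      by (subst jet_mult_dil_expand[OF r N]) (simp_all only: lessThan_Suc_atMost sum_distrib_left mult.left_commute, simp)
    have cdu: "ereal \<bar>x\<bar> < fps_conv_radius (dil N (u i))"
      using x cu N by (intro fps_conv_radius_dil) auto
    have "?C i * dil N (?f i) = ?C i * dil N (r i) + lin x ^ Suc s * (fps_of_poly h * ?C i * dil N (u i))"
      unfolding f[of i] dil_add dil_mult[OF N] h by (simp only: distrib_left mult_ac)
    moreover have c1: "ereal \<bar>x\<bar> < fps_conv_radius (fps_of_poly h * ?C i * dil N (u i))"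
      using cC cdu by (intro fps_conv_radius_mult_gt) simp_all
    moreover have "ereal \<bar>x\<bar> < fps_conv_radius (lin x ^ Suc s * (fps_of_poly h * ?C i * dil N (u i)))"
      by (rule fps_conv_radius_mult_gt[OF _ c1]) (simp only: fps_conv_radius_lin_power, simp)
    moreover have "ereal \<bar>x\<bar> < fps_conv_radius (?C i * dil N (r i))"
      using cC fps_conv_radius_deg_le[OF deg_le_dil[OF r N]] by (intro fps_conv_radius_mult_gt) simp_all
    ultimately have "jet s x (?C i * dil N (?f i)) = jet s x (?C i * dil N (r i))"
      using jet_lin_power_Suc_mult[OF c1, of s] by (simp only: jet_add)
    then show ?thesis using 1 by simp
  qed
  ultimately have "\<nu> * jet s x ?B + \<kappa> * (\<Sum>i<d. jet s x (?C i * dil N (?f i))) = 0"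
    by (simp add: lq_def sum_distrib_left)
  moreover have "(\<Sum>i<d. jet s x (?C i * dil N (?f i))) = jet s x (?B * F)"
  proof -
    have "?B * F = (\<Sum>i<d. ?C i * dil N (?f i))"
      using k d by (subst transfer_identity[OF _ d eq]) (simp_all add: dil_dil kpos N N_def power_add mult.commute)
    moreover have "ereal \<bar>x\<bar> < fps_conv_radius (?C i * dil N (?f i))" for i
    proof (rule fps_conv_radius_mult_gt)
      show "ereal \<bar>x\<bar> < fps_conv_radius (dil N (?f i))" using fps_conv_radius_dil[OF _ x(2) cf N, of i] by simp
    qed (simp add: cC)
    ultimately show ?thesis by (simp add: jet_sum)
  qed
  moreover have "jet s x ?B = fact s * eval_fps g0 x"
    unfolding order(1) using order(2) by (intro jet_lin_power_mult) simp
  moreover have "jet s x (?B * F) = fact s * (eval_fps g0 x * eval_fps F x)"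
  proof -
    have "ereal \<bar>x\<bar> < fps_conv_radius (g0 * F)" using order(2) x by (intro fps_conv_radius_mult_gt) simp_all
    then have "jet s x (lin x ^ s * (g0 * F)) = fact s * eval_fps (g0 * F) x" by (rule jet_lin_power_mult)
    then show ?thesis unfolding order(1) using order(2) x by (simp add: mult.assoc eval_fps_mult)
  qed
  ultimately have "fact s * eval_fps g0 x * (\<nu> + \<kappa> * eval_fps F x) = 0" by (simp add: algebra_simps)
  then show ?thesis using order(3) by simp
qed

section \<open>The irrationality exponent\<close>

lemma eventually_power_le_double_power:
  fixes z c Z :: real
  assumes "z > 1" "k \<ge> 2"
  shows "\<forall>\<^sub>F n in sequentially. Z * c ^ n \<le> z ^ (k ^ n)"
proof -
  obtain m where m: "\<bar>c\<bar> < z ^ m" using real_arch_pow[OF assms(1)] by blast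
  have "(\<lambda>n. of_nat n * (1/2) ^ n :: real) \<longlonglongrightarrow> 0" by (rule powser_times_n_limit_0) simp
  then have "\<forall>\<^sub>F n in sequentially. of_nat n * (1/2) ^ n < 1 / (real m + 1)"
    by (rule order_tendstoD) simp
  moreover have "\<forall>\<^sub>F n in sequentially. \<bar>Z\<bar> \<le> z ^ n"
  proof -
    obtain n0 where n0: "\<bar>Z\<bar> < z ^ n0" using real_arch_pow[OF assms(1)] by blast
    have "\<bar>Z\<bar> \<le> z ^ n" if "n \<ge> n0" for n
      using n0 power_increasing[OF that, of z] assms(1) by linarith
    then show ?thesis by (auto simp: eventually_sequentially)
  qed
  ultimately show ?thesis
  proof eventually_elim
    case (elim n)
    have "real n * (real m + 1) < 2 ^ n" using elim(1) by (simp add: field_simps)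
    then have "real (n * (m + 1)) < real (2 ^ n)" by (simp add: distrib_left distrib_right)
    then have "n * (m + 1) < 2 ^ n" by (simp only: of_nat_less_iff)
    also have "(2::nat) ^ n \<le> k ^ n" using assms by (intro power_mono) auto
    finally have n: "m * n + n \<le> k ^ n" by (simp add: algebra_simps)
    have "Z * c ^ n \<le> \<bar>Z * c ^ n\<bar>" by (rule abs_ge_self)
    also have "\<dots> = \<bar>Z\<bar> * \<bar>c\<bar> ^ n" by (simp add: abs_mult power_abs)
    also have "\<dots> \<le> z ^ n * (z ^ m) ^ n"
      using elim(2) m assms(1) by (intro mult_mono power_mono) auto
    also have "\<dots> = z ^ (m * n + n)" by (simp add: power_add power_mult)
    also have "\<dots> \<le> z ^ (k ^ n)" using n assms(1) by (intro power_increasing) auto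
    finally show ?case .
  qed
qed

text \<open>Given \<open>q\<close>, take the least \<open>n\<close> with
  \<open>2 * q \<le> y ^ (k ^ n)\<close>. The first term is then at most 1/2, and minimality gives
  \<open>y ^ (k ^ n) \<le> (2 * q) ^ k\<close>, hence the exponent \<open>k * e\<close>; the extra 1
  is the factor \<open>q\<close> of the second term. As only \<open>p / q\<close> different from
  \<open>\<xi>\<close> are tested, rational \<open>\<xi>\<close> is covered as well.\<close>

lemma irrationality_exponent_leI:
  fixes y :: real and k e n1 :: nat
  assumes y: "y > 1" and k: "k \<ge> 2"
    and forms: "\<And>n p q. n \<ge> n1 \<Longrightarrow> q > 0 \<Longrightarrow> \<xi> \<noteq> of_int p / of_nat q \<Longrightarrow>
       1 \<le> real q / y ^ (k ^ n) + real q * y ^ (e * k ^ n) * \<bar>\<xi> - of_int p / of_nat q\<bar>"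
  shows "irrationality_exponent \<xi> \<le> ereal (real (k * e + 1))"
proof -
  define U where "U = k * e + 1"
  have lower: "1 / (2 * real q) ^ U \<le> \<bar>\<xi> - of_int p / of_nat q\<bar>"
    if q: "q > 0" "y ^ (k ^ n1) < 2 * real q" and ne: "\<xi> \<noteq> of_int p / of_nat q" for p :: int and q :: nat
  proof -
    obtain n0 where n0: "2 * real q < y ^ n0" using real_arch_pow[OF y] by blast
    have "n0 < 2 ^ n0" by (rule less_exp)
    also have "(2::nat) ^ n0 \<le> k ^ n0" using k by (intro power_mono) auto
    finally have "y ^ n0 \<le> y ^ (k ^ n0)" using y by (intro power_increasing) auto
    then have ex: "2 * real q \<le> y ^ (k ^ n0)" using n0 by linarith
    define n where "n = (LEAST n. 2 * real q \<le> y ^ (k ^ n))"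
    have n: "2 * real q \<le> y ^ (k ^ n)" 
      unfolding n_def by (rule LeastI[of "\<lambda>n. 2 * real q \<le> y ^ (k ^ n)", OF ex])
    have "\<not> n \<le> n1"
    proof
      assume "n \<le> n1"
      then have "y ^ (k ^ n) \<le> y ^ (k ^ n1)" using y k by (intro power_increasing) auto
      then show False using n q by linarith
    qed
    then obtain m where m: "n = Suc m" "n1 \<le> m" by (cases n) auto
    then have "y ^ (k ^ m) < 2 * real q"
      using not_less_Least[of m "\<lambda>n. 2 * real q \<le> y ^ (k ^ n)"] by (simp flip: n_def)
    then have "(y ^ (k ^ m)) ^ k \<le> (2 * real q) ^ k" using y by (intro power_mono) auto
    then have "y ^ (k ^ n) \<le> (2 * real q) ^ k" by (simp add: m power_mult[symmetric] mult.commute)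
    then have "(y ^ (k ^ n)) ^ e \<le> ((2 * real q) ^ k) ^ e" using y by (intro power_mono) auto
    then have big: "y ^ (e * k ^ n) \<le> (2 * real q) ^ (k * e)" by (simp add: power_mult mult.commute[of e])
    have "real q / y ^ (k ^ n) \<le> 1 / 2" using n y by (simp add: field_simps)
    moreover have "1 \<le> real q / y ^ (k ^ n) + real q * y ^ (e * k ^ n) * \<bar>\<xi> - of_int p / of_nat q\<bar>"
      using m by (intro forms[OF _ q(1) ne]) simp
    ultimately have "1 / 2 \<le> real q * y ^ (e * k ^ n) * \<bar>\<xi> - of_int p / of_nat q\<bar>" by linarith
    also have "\<dots> \<le> real q * (2 * real q) ^ (k * e) * \<bar>\<xi> - of_int p / of_nat q\<bar>"
      using big by (intro mult_right_mono mult_left_mono) auto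
    finally have "1 \<le> (2 * real q) ^ U * \<bar>\<xi> - of_int p / of_nat q\<bar>" by (simp add: U_def)
    then show ?thesis using q by (simp add: field_simps)
  qed
  have "\<mu> \<le> real U" if inf: "infinite {(p :: int, q :: nat). q > 0 \<and>
          0 < \<bar>\<xi> - of_int p / of_nat q\<bar> \<and> \<bar>\<xi> - of_int p / of_nat q\<bar> < of_nat q powr (- \<mu>)}" for \<mu>
  proof (rule ccontr)
    assume "\<not> \<mu> \<le> real U"
    then have \<mu>: "\<mu> > real U" by simp
    \<comment> \<open>Beyond this \<open>Q\<close> the lower bound is available, and
      \<open>q powr (\<mu> - U)\<close> exceeds \<open>2 powr U\<close>, so that the factor 2 in
      \<open>(2 * q) ^ U\<close> does no harm. Each of the remaining denominators admits finitely
      many \<open>p\<close>.\<close>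
    define Q where "Q = nat \<lceil>max (y ^ (k ^ n1)) (2 powr (real U / (\<mu> - real U)))\<rceil>"
    define P where "P = \<lceil>real Q * (\<bar>\<xi>\<bar> + 1)\<rceil>"
    have "{(p :: int, q :: nat). q > 0 \<and> 0 < \<bar>\<xi> - of_int p / of_nat q\<bar> \<and>
        \<bar>\<xi> - of_int p / of_nat q\<bar> < of_nat q powr (- \<mu>)} \<subseteq> {-P..P} \<times> {..Q}"
    proof safe
      fix p :: int and q :: nat
      assume q: "q > 0" and ne: "0 < \<bar>\<xi> - of_int p / of_nat q\<bar>"
        and lt: "\<bar>\<xi> - of_int p / of_nat q\<bar> < of_nat q powr (- \<mu>)"
      show qQ: "q \<le> Q"
      proof (rule ccontr)
        assume "\<not> q \<le> Q"
        then have gt: "y ^ (k ^ n1) < real q" "2 powr (real U / (\<mu> - real U)) < real q"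
          unfolding Q_def by linarith+
        have "1 / (2 * real q) ^ U \<le> \<bar>\<xi> - of_int p / of_nat q\<bar>"
          using q gt ne by (intro lower) auto
        also note lt
        finally have "1 / (2 * real q) ^ U < real q powr (- \<mu>)" .
        then have "(2 * real q) powr (- real U) < real q powr (- \<mu>)"
          using q by (simp add: powr_minus powr_realpow field_simps)
        then have "2 powr (- real U) < real q powr (- \<mu>) * real q powr (real U)"
          using q by (simp add: powr_mult powr_minus field_simps)
        also have "\<dots> = (real q powr (\<mu> - real U)) powr (- 1)"
          by (simp only: powr_powr powr_add[symmetric]) simp
        finally have a: "2 powr (- real U) < (real q powr (\<mu> - real U)) powr (- 1)" .
        have "(2 powr (real U / (\<mu> - real U))) powr (\<mu> - real U) < real q powr (\<mu> - real U)"
          using gt(2) \<mu> by (intro powr_less_mono2) auto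
        then have "2 powr real U < real q powr (\<mu> - real U)" using \<mu> by (simp add: powr_powr)
        then have "(real q powr (\<mu> - real U)) powr (- 1) < (2 powr real U) powr (- 1)"
          by (intro powr_less_mono2_neg) auto
        then show False using a by (simp add: powr_powr powr_minus_divide)
      qed
      have "of_nat q powr (- \<mu>) \<le> 1" using q \<mu> by (simp add: powr_minus ge_one_powr_ge_zero field_simps)
      then have "\<bar>\<xi> - of_int p / of_nat q\<bar> < 1" using lt by linarith
      then have "\<bar>of_int p / of_nat q\<bar> \<le> \<bar>\<xi>\<bar> + 1" by linarith
      then have "\<bar>real_of_int p\<bar> \<le> real q * (\<bar>\<xi>\<bar> + 1)" using q by (simp add: field_simps)
      also have "\<dots> \<le> real Q * (\<bar>\<xi>\<bar> + 1)" using qQ by (intro mult_right_mono) auto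
      finally have "\<bar>real_of_int p\<bar> \<le> real Q * (\<bar>\<xi>\<bar> + 1)" .
      then have "\<bar>p\<bar> \<le> P" unfolding P_def by linarith
      then show "p \<in> {-P..P}" by auto
    qed
    then show False using inf finite_subset by blast
  qed
  then show ?thesis unfolding irrationality_exponent_def U_def[symmetric]
    by (intro SUP_least) auto
qed

section \<open>Integral linear forms at \<open>a / b\<close>\<close>

definition int_fps :: "real fps \<Rightarrow> bool" where
  "int_fps G \<longleftrightarrow> (\<forall>m. G $ m \<in> \<int>)"

lemma int_fps_mult: "int_fps F \<Longrightarrow> int_fps G \<Longrightarrow> int_fps (F * G)"
  by (auto simp: int_fps_def fps_mult_nth intro!: Ints_sum Ints_mult)

lemma int_fps_diff: "int_fps F \<Longrightarrow> int_fps G \<Longrightarrow> int_fps (F - G)"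
  by (auto simp: int_fps_def)

lemma int_fps_sum: "(\<And>i. i \<in> I \<Longrightarrow> int_fps (G i)) \<Longrightarrow> int_fps (\<Sum>i\<in>I. G i)"
  by (auto simp: int_fps_def fps_sum_nth intro!: Ints_sum)

lemma int_fps_dil: "m > 0 \<Longrightarrow> int_fps G \<Longrightarrow> int_fps (dil m G)"
  by (auto simp: int_fps_def dil_nth)

lemma int_fps_tuple_poly: "int_fps (tuple_poly D v i)"
  by (auto simp: int_fps_def tuple_poly_def)

lemma int_fps_transfer:
  assumes "k > 0" "\<And>i. i \<le> d \<Longrightarrow> int_fps (A i)"
  shows "int_fps (transfer_denom k A n)" "int_fps (transfer_num k d A n i)"
proof -
  have 0: "int_fps 0" "int_fps 1" by (auto simp: int_fps_def)
  show "int_fps (transfer_denom k A n)"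
    by (induction n) (use assms 0 in \<open>auto intro!: int_fps_mult int_fps_dil\<close>)
  show "int_fps (transfer_num k d A n i)"
    by (induction n arbitrary: i) (use assms 0 in \<open>auto intro!: int_fps_mult int_fps_dil int_fps_diff\<close>)
qed

lemma real_fps_nth [simp]: "real_fps G $ m = of_int (G $ m)"
  by (simp add: real_fps_def)

lemma real_fps_mult: "real_fps (F * G) = real_fps F * real_fps G"
  by (rule fps_ext) (simp add: fps_mult_nth)

lemma real_fps_sum: "real_fps (\<Sum>i\<in>I. G i) = (\<Sum>i\<in>I. real_fps (G i))"
  by (rule fps_ext) (simp add: fps_sum_nth)

lemma real_fps_dil: "m > 0 \<Longrightarrow> real_fps (dil m G) = dil m (real_fps G)"
  by (rule fps_ext) (simp add: dil_nth)

text \<open>Substituting \<open>x^k^n\<close> in the approximants and transferring them to \<open>F\<close> yields, after taking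
  jets at \<open>x = a / b\<close>, linear forms in \<open>1\<close> and \<open>F (a / b)\<close>. The order \<open>s\<close> of the jet is the order of vanishing at \<open>x\<close> of the
  denominator \<open>transfer_denom k A n\<close>, so that only \<open>F (a / b)\<close> itself survives in the jet of
  \<open>transfer_denom k A n * F\<close>.\<close>

lemma mahler_linear_forms:
  fixes F :: "int fps" and A :: "nat \<Rightarrow> int poly" and a b :: int and z h :: real
  assumes k: "k \<ge> 2" and d: "d \<ge> 1" and H: "H \<ge> 1"
    and degA: "\<And>i. i \<le> d \<Longrightarrow> degree (A i) \<le> H" and A0: "A 0 \<noteq> 0"
    and coeffA: "\<And>i j. i \<le> d \<Longrightarrow> \<bar>real_of_int (coeff (A i) j)\<bar> \<le> h" and h: "h \<ge> 1"
    and eq: "mahler_equation k d A F"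
    and ab: "a \<noteq> 0" "\<bar>a\<bar> < b" "ereal \<bar>of_int a / of_int b\<bar> < fps_conv_radius (real_fps F)"
    and z: "z > 1" "z ^ 4 = of_int b"
    and M: "M = (2 * d + 2) * (k ^ (d + 1) * (4 * H)) + 1"
    and D: "3 * H + D + 1 = M"
    and small: "\<bar>of_int a / of_int b\<bar> ^ M * of_int b ^ (D + H + 1) \<le> (1 :: real)"
  shows "\<exists>n1. \<forall>n\<ge>n1. \<forall>p (q::nat). q > 0 \<longrightarrow>
     eval_fps (real_fps F) (of_int a / of_int b) \<noteq> of_int p / of_nat q \<longrightarrow>
     1 \<le> real q / (z ^ 2) ^ (k ^ n) + real q * (z ^ 2) ^ (2 * (D + H + 1) * k ^ n)
           * \<bar>eval_fps (real_fps F) (of_int a / of_int b) - of_int p / of_nat q\<bar>"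
proof -
  define x :: real where "x = of_int a / of_int b"
  define G where "G = real_fps F"
  define \<xi> where "\<xi> = eval_fps G x"
  define AA where "AA = (\<lambda>i. real_fps (fps_of_poly (A i)))"
  define f where "f = (\<lambda>i. dil (k ^ i) G)"
  have kpos: "k ^ i > 0" for i using k by simp
  have b: "b > 0" using ab by linarith
  have x: "0 < \<bar>x\<bar>" "\<bar>x\<bar> < 1" "ereal \<bar>x\<bar> < fps_conv_radius G"
    using ab b by (simp_all add: x_def G_def abs_mult)
  have AAnth: "AA i $ j = of_int (coeff (A i) j)" for i j by (simp add: AA_def)
  have degAA: "deg_le H (AA i)" if "i \<le> d" for i
    using degA[OF that] by (auto simp: deg_le_def AAnth coeff_eq_0)
  have AA0: "AA 0 \<noteq> 0"
    using A0 by (metis AAnth fps_zero_nth of_int_eq_0_iff poly_eqI coeff_0)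
  have eqG: "(\<Sum>i\<le>d. AA i * dil (k ^ i) G) = 0"
  proof -
    have "real_fps (\<Sum>i\<le>d. fps_of_poly (A i) * dil (k ^ i) F) = real_fps 0"
      using eq by (simp add: mahler_equation_def)
    then show ?thesis by (simp add: real_fps_sum real_fps_mult real_fps_dil[OF kpos] AA_def G_def)
         (simp add: fps_eq_iff)
  qed
  have intAA: "int_fps (AA i)" for i by (simp add: int_fps_def AAnth)
  have hAA: "\<bar>AA i $ j\<bar> \<le> h" if "i \<le> d" for i j using coeffA[OF that] by (simp add: AAnth)
  define p0 where "p0 = map_poly real_of_int (A 0)"
  have p0: "fps_of_poly p0 = AA 0" by (rule fps_ext) (simp add: p0_def AAnth coeff_map_poly)
  have p00: "p0 \<noteq> 0" using AA0 p0 by auto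
  have degp0: "degree p0 \<le> H" 
    unfolding p0_def using degA[of 0] by (intro degree_le) (auto simp: coeff_map_poly coeff_eq_0)
  have DM: "D < M" and HD: "H \<le> D"
  proof -
    show "D < M" using D by simp
    have "2 * (2 * (4 * H)) \<le> (2 * d + 2) * (k ^ (d + 1) * (4 * H))"
    proof (intro mult_mono)
      have "2 ^ 1 \<le> k ^ (d + 1)" using k by (intro order_trans[OF power_mono[of 2 k 1] power_increasing]) auto
      then show "2 \<le> k ^ (d + 1)" by simp
    qed auto
    then show "H \<le> D" using D unfolding M by linarith
  qed
  obtain B where finB: "finite B"
    and apprB: "\<And>v i. v \<in> B \<Longrightarrow> i < d \<Longrightarrow> ord_ge M (tuple_poly D v d * f i - tuple_poly D v i)"
    and spanB: "\<And>lq lp. (\<forall>v\<in>B. (\<Sum>j\<le>D. lq j * of_int (v (d, j))) + (\<Sum>i<d. \<Sum>j\<le>D. lp i j * of_int (v (i, j))) = 0) \<Longrightarrow>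
       \<exists>g. (\<forall>i<d. \<forall>j\<le>D. lp i j = - g i j) \<and> (\<forall>j\<le>D. lq j = (\<Sum>i<d. \<Sum>m\<in>{j..<M}. g i m * f i $ (m - j)))"
  proof -
    have "real_fps (dil (k ^ i) F) = f i" for i by (simp add: f_def G_def real_fps_dil[OF kpos])
    then show ?thesis using that integer_approximants[OF DM, of d "\<lambda>i. dil (k ^ i) F"] by auto
  qed
  have degAA0: "deg_le H (AA 0)" using degAA[of 0] by simp
  define tden where "tden = transfer_denom k AA"
  define tnum where "tnum = transfer_num k d AA"
  have degt: "deg_le (H * k ^ n) (tden n)" "deg_le (H * k ^ n) (tnum n i)" for n i
    unfolding tden_def tnum_def using deg_le_transfer_denom[where A = AA, OF k degAA0] deg_le_transfer_num[where A = AA, OF k degAA] by auto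
  have ct: "fps_conv_radius (tden n) = \<infinity>" "fps_conv_radius (tnum n i) = \<infinity>" for n i
    using fps_conv_radius_deg_le[OF degt(1)] fps_conv_radius_deg_le[OF degt(2)] by auto
  have ctp: "fps_conv_radius (dil (k ^ n) (tuple_poly D v i)) = \<infinity>" for n v i
    using fps_conv_radius_deg_le[OF deg_le_dil[OF deg_le_tuple_poly kpos]] .
  define Q where "Q = (\<lambda>n v. tden n * dil (k ^ n) (tuple_poly D v d))"
  define P where "P = (\<lambda>n v. \<Sum>i<d. tnum n i * dil (k ^ n) (tuple_poly D v i))"
  have degQ: "deg_le ((D + H) * k ^ n) (Q n v)" for n v
  proof -
    have "deg_le (H * k ^ n + k ^ n * D) (Q n v)"
      unfolding Q_def by (intro deg_le_mult degt deg_le_dil deg_le_tuple_poly kpos)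
    then show ?thesis by (simp add: algebra_simps)
  qed
  have degP: "deg_le ((D + H) * k ^ n) (P n v)" for n v
    unfolding P_def
  proof (rule deg_le_sum)
    show "deg_le ((D + H) * k ^ n) (tnum n i * dil (k ^ n) (tuple_poly D v i))" for i
    proof -
      have "deg_le (H * k ^ n + k ^ n * D) (tnum n i * dil (k ^ n) (tuple_poly D v i))"
        by (intro deg_le_mult degt deg_le_dil deg_le_tuple_poly kpos)
      then show ?thesis by (simp add: algebra_simps)
    qed
  qed
  have intt: "int_fps (tden n)" "int_fps (tnum n i)" for n i
    unfolding tden_def tnum_def using int_fps_transfer[of k d AA] intAA k by auto
  have intQP: "int_fps (Q n v)" "int_fps (P n v)" for n v
    unfolding Q_def P_def
    by (intro int_fps_mult int_fps_sum int_fps_dil intt int_fps_tuple_poly kpos)+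
  \<comment> \<open>One finite set \<open>B\<close> serves every \<open>n\<close>: if all these jets
    vanished, the span property of \<open>B\<close> would make the functional a combination of the
    approximation conditions and force \<open>\<nu> + \<kappa> * \<xi> = 0\<close>.\<close>
  have nonvanishing: "\<exists>v\<in>B. \<nu> * jet s x (Q n v) + \<kappa> * jet s x (P n v) \<noteq> 0"
    if s: "tden n = lin x ^ s * fps_of_poly g0" "poly g0 x \<noteq> 0" "s \<le> H" and ne: "\<nu> + \<kappa> * \<xi> \<noteq> 0" for n s g0 \<nu> \<kappa>
  proof (rule ccontr)
    assume "\<not> ?thesis"
    then have zero: "\<nu> * jet s x (Q n v) + \<kappa> * jet s x (P n v) = 0" if "v \<in> B" for v using that by blast
    define lq where "lq = (\<lambda>j. \<nu> * jet s x (tden n * fps_X ^ (k ^ n * j)))"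
    define lp where "lp = (\<lambda>i j. \<kappa> * jet s x (tnum n i * fps_X ^ (k ^ n * j)))"
    have "\<forall>v\<in>B. (\<Sum>j\<le>D. lq j * of_int (v (d, j))) + (\<Sum>i<d. \<Sum>j\<le>D. lp i j * of_int (v (i, j))) = 0"
    proof
      fix v assume v: "v \<in> B"
      have tp: "tuple_poly D v i $ j = of_int (v (i, j))" if "j \<le> D" for i j
        using that by (simp add: tuple_poly_def)
      have "\<nu> * jet s x (Q n v) = (\<Sum>j\<le>D. lq j * of_int (v (d, j)))"
        unfolding Q_def lq_def using ct
        by (subst jet_mult_dil_expand[OF deg_le_tuple_poly kpos]) (simp_all add: sum_distrib_left tp mult_ac)
      moreover have "\<kappa> * jet s x (P n v) = (\<Sum>i<d. \<Sum>j\<le>D. lp i j * of_int (v (i, j)))"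
      proof -
        have "jet s x (P n v) = (\<Sum>i<d. jet s x (tnum n i * dil (k ^ n) (tuple_poly D v i)))"
          unfolding P_def by (intro jet_sum fps_conv_radius_mult_gt) (simp_all add: ct ctp)
        moreover have "\<kappa> * jet s x (tnum n i * dil (k ^ n) (tuple_poly D v i)) = (\<Sum>j\<le>D. lp i j * of_int (v (i, j)))" for i
          unfolding lp_def using ct
          by (subst jet_mult_dil_expand[OF deg_le_tuple_poly kpos]) (simp_all add: sum_distrib_left tp mult_ac)
        ultimately show ?thesis by (simp add: sum_distrib_left)
      qed
      ultimately show "(\<Sum>j\<le>D. lq j * of_int (v (d, j))) + (\<Sum>i<d. \<Sum>j\<le>D. lp i j * of_int (v (i, j))) = 0"
        using zero[OF v] by simp
    qed
    from spanB[OF this] obtain g where g: "\<And>i j. i < d \<Longrightarrow> j \<le> D \<Longrightarrow> lp i j = - g i j"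
      "\<And>j. j \<le> D \<Longrightarrow> lq j = (\<Sum>i<d. \<Sum>m\<in>{j..<M}. g i m * f i $ (m - j))" by blast
    have "\<nu> + \<kappa> * eval_fps G x = 0"
    proof (rule approximant_functional_nonvanishing[where A = AA and g = g and ?g0.0 = "fps_of_poly g0"
          and \<delta> = "3 * H + s" and \<delta>' = "4 * H" and s = s and n = n and D = D])
      show "deg_le (4 * H) (AA i)" if "i \<le> d" for i using degAA[OF that] by (rule deg_le_mono) simp
      show "3 * H + s + D + 2 = M + Suc s" using D by simp
      show "s \<le> D" using s HD by simp
      show "transfer_denom k AA n = lin x ^ s * fps_of_poly g0" using s by (simp add: tden_def)
      show "\<kappa> * jet s x (transfer_num k d AA n i * fps_X ^ (k ^ n * j)) = - g i j" if "i < d" "j \<le> D" for i j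
        using g(1)[OF that] by (simp add: lp_def tnum_def)
      show "\<nu> * jet s x (transfer_denom k AA n * fps_X ^ (k ^ n * j))
          = (\<Sum>i<d. \<Sum>m\<in>{j..<M}. g i m * dil (k ^ i) G $ (m - j))" if "j \<le> D" for j
        using g(2)[OF that] by (simp add: lq_def tden_def f_def)
    qed (use k d AA0 eqG x M DM H s in auto)
    then show False using ne by (simp add: \<xi>_def)
  qed
  have jet_remainder: "jet s x (Q n v) * \<xi> - jet s x (P n v)
      = jet s x (\<Sum>i<d. tnum n i * dil (k ^ n) (tuple_poly D v d * f i - tuple_poly D v i))"
    if s: "tden n = lin x ^ s * fps_of_poly g0" for n s g0 v
  proof -
    have cQ: "ereal \<bar>x\<bar> < fps_conv_radius (fps_of_poly g0 * dil (k ^ n) (tuple_poly D v d))"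
      using ctp by (intro fps_conv_radius_mult_gt) simp_all
    have cQG: "ereal \<bar>x\<bar> < fps_conv_radius (fps_of_poly g0 * dil (k ^ n) (tuple_poly D v d) * G)"
      by (intro fps_conv_radius_mult_gt[OF cQ] x)
    have 1: "jet s x (Q n v) = fact s * eval_fps (fps_of_poly g0 * dil (k ^ n) (tuple_poly D v d)) x"
      unfolding Q_def s mult.assoc by (rule jet_lin_power_mult[OF cQ])
    have "jet s x (Q n v * G) = fact s * eval_fps (fps_of_poly g0 * dil (k ^ n) (tuple_poly D v d) * G) x"
      unfolding Q_def s using jet_lin_power_mult[OF cQG] by (simp only: mult.assoc)
    also have "\<dots> = jet s x (Q n v) * \<xi>"
      using 1 cQ x by (subst eval_fps_mult) (simp_all add: \<xi>_def mult.assoc)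
    finally have 2: "jet s x (Q n v * G) = jet s x (Q n v) * \<xi>" .
    have "Q n v * G = dil (k ^ n) (tuple_poly D v d) * (tden n * G)" by (simp add: Q_def mult_ac)
    also have "tden n * G = (\<Sum>i<d. tnum n i * dil (k ^ n) (f i))"
      unfolding tden_def tnum_def f_def using k d
      by (subst transfer_identity[OF _ d eqG]) (simp_all add: dil_dil kpos power_add mult.commute)
    finally have QG: "Q n v * G = dil (k ^ n) (tuple_poly D v d) * (\<Sum>i<d. tnum n i * dil (k ^ n) (f i))" .
    have "Q n v * G - P n v = (\<Sum>i<d. tnum n i * dil (k ^ n) (tuple_poly D v d * f i - tuple_poly D v i))"
    proof -
      have "tnum n i * dil (k ^ n) (tuple_poly D v d * f i - tuple_poly D v i)
          = dil (k ^ n) (tuple_poly D v d) * (tnum n i * dil (k ^ n) (f i)) - tnum n i * dil (k ^ n) (tuple_poly D v i)" for i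
        by (simp only: dil_diff dil_mult[OF kpos] right_diff_distrib mult.left_commute)
      then show ?thesis
        by (simp only: P_def QG sum_distrib_left sum_subtractf)
    qed
    moreover have "jet s x (Q n v * G - P n v) = jet s x (Q n v * G) - jet s x (P n v)"
    proof (rule jet_diff)
      show "ereal \<bar>x\<bar> < fps_conv_radius (Q n v * G)"
        unfolding Q_def using ct ctp x by (intro fps_conv_radius_mult_gt) simp_all
      show "ereal \<bar>x\<bar> < fps_conv_radius (P n v)"
        using fps_conv_radius_deg_le[OF degP] by simp
    qed
    ultimately show ?thesis using 2 by simp
  qed
  obtain K0 r where r: "1 \<le> r" "0 \<le> K0" "\<And>m. \<bar>G $ m\<bar> \<le> K0 * r ^ m"
    by (rule fps_conv_radius_coeff_bound[OF abs_ge_zero x(2,3)]) blast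
  define V where "V = (\<Sum>v\<in>B. \<Sum>y\<in>{..d} \<times> {..D}. \<bar>real_of_int (v y)\<bar>)"
  have V0: "V \<ge> 0" unfolding V_def by (intro sum_nonneg abs_ge_zero)
  have V: "\<bar>tuple_poly D v i $ j\<bar> \<le> V" if "v \<in> B" "i \<le> d" for v i j
  proof (cases "j \<le> D")
    case True
    have "\<bar>real_of_int (v (i, j))\<bar> \<le> (\<Sum>y\<in>{..d} \<times> {..D}. \<bar>real_of_int (v y)\<bar>)"
      using True that by (intro member_le_sum[of "(i, j)"]) auto
    also have "\<dots> \<le> V" unfolding V_def using that finB
      by (intro member_le_sum[of v B "\<lambda>v. \<Sum>y\<in>{..d} \<times> {..D}. \<bar>real_of_int (v y)\<bar>"] sum_nonneg abs_ge_zero) simp_all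
    finally show ?thesis using True by (simp add: tuple_poly_def)
  qed (use V0 in \<open>simp add: tuple_poly_def\<close>)
  define K1 where "K1 = of_nat (Suc D) * V * K0 + V"
  have K1: "V \<le> K1" "0 \<le> K1" using V0 r by (simp_all add: K1_def)
  have rem_bound: "\<bar>(tuple_poly D v d * f i - tuple_poly D v i) $ m\<bar> \<le> K1 * r ^ m" if "v \<in> B" "i < d" for v i m
  proof -
    have "mult_bounded r (dil 1 (tuple_poly D v d)) (of_nat (Suc D) * V)"
      using r V[OF that(1), of d] by (intro mult_bounded_dil deg_le_tuple_poly) auto
    then have mb: "mult_bounded r (tuple_poly D v d) (of_nat (Suc D) * V)" by simp
    have fb: "\<bar>f i $ m\<bar> \<le> K0 * r ^ m" for m
    proof (cases "k ^ i dvd m")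
      case True
      then have "\<bar>f i $ m\<bar> \<le> K0 * r ^ (m div k ^ i)" using r by (simp add: f_def dil_nth[OF kpos])
      also have "\<dots> \<le> K0 * r ^ m" using r by (intro mult_left_mono power_increasing) auto
      finally show ?thesis .
    qed (use r in \<open>simp add: f_def dil_nth[OF kpos]\<close>)
    have 1: "\<bar>(tuple_poly D v d * f i) $ m\<bar> \<le> of_nat (Suc D) * V * K0 * r ^ m"
      by (rule mult_boundedD[OF mb r(2) fb])
    have "\<bar>tuple_poly D v i $ m\<bar> \<le> V * 1" using V[OF that(1), of i m] that(2) by simp
    also have "\<dots> \<le> V * r ^ m" using V0 r by (intro mult_left_mono one_le_power) auto
    finally show ?thesis using 1 by (simp add: K1_def distrib_right)
  qed
  \<comment> \<open>The assumption \<open>small\<close> leaves one spare factor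
    \<open>b = z ^ 4\<close> for each unit of \<open>k ^ n\<close>. One
    \<open>z = \<theta>' ^ M\<close> pays for the growth of the coefficients, one \<open>z\<close>
    for \<open>Z * c ^ n\<close>, and \<open>z ^ 2\<close> remains as the decay of the
    forms.\<close>
  define \<theta>' where "\<theta>' = root M z"
  have M0: "M > 0" using DM by simp
  have \<theta>'M: "\<theta>' ^ M = z" using M0 z by (simp add: \<theta>'_def)
  have \<theta>'1: "1 < \<theta>'" using M0 z by (simp add: \<theta>'_def)
  define \<theta> where "\<theta> = (1 + \<theta>') / 2"
  have \<theta>: "1 < \<theta>" "\<theta> < \<theta>'" using \<theta>'1 by (simp_all add: \<theta>_def)
  have zb: "real_of_int b ^ e = z ^ (4 * e)" for e by (simp add: z(2)[symmetric] power_mult)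
  have rate: "(\<theta>' * \<bar>x\<bar>) ^ M * z ^ (4 * (D + H) + 3) \<le> 1"
  proof -
    have "(\<theta>' * \<bar>x\<bar>) ^ M * z ^ (4 * (D + H) + 3) = \<bar>x\<bar> ^ M * (z ^ Suc (4 * (D + H) + 3))"
      by (simp only: power_mult_distrib \<theta>'M power_Suc mult_ac)
    also have "z ^ Suc (4 * (D + H) + 3) = of_int b ^ (D + H + 1)"
      unfolding zb by (rule arg_cong[of _ _ "\<lambda>e. z ^ e"]) simp
    finally show ?thesis using small by (simp add: x_def)
  qed
  have \<theta>'x: "\<theta>' * \<bar>x\<bar> < 1"
  proof (rule ccontr)
    assume "\<not> ?thesis"
    then have "1 \<le> (\<theta>' * \<bar>x\<bar>) ^ M" by (intro one_le_power) simp
    moreover have "1 < z ^ (4 * (D + H) + 3)" using z by (intro one_less_power) auto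
    ultimately have "1 * 1 < (\<theta>' * \<bar>x\<bar>) ^ M * z ^ (4 * (D + H) + 3)" by (intro mult_le_less_imp_less) auto
    then show False using rate by simp
  qed
  have \<theta>0: "0 < \<theta>" using \<theta> by simp
  have "\<forall>s. \<exists>C\<ge>0. \<forall>G K N. 0 \<le> K \<longrightarrow> (\<forall>m. \<bar>G $ m\<bar> \<le> K * \<theta> ^ m) \<longrightarrow> ord_ge N G \<longrightarrow>
           \<bar>jet s x G\<bar> \<le> C * K * (\<theta>' * \<bar>x\<bar>) ^ N"
    using jet_bound[OF \<theta>0 \<theta>(2) x(1) \<theta>'x] by blast
  then obtain C where C: "\<And>s. 0 \<le> C s" "\<And>s G K N. 0 \<le> K \<Longrightarrow> (\<And>m. \<bar>G $ m\<bar> \<le> K * \<theta> ^ m) \<Longrightarrow> ord_ge N G \<Longrightarrow>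
           \<bar>jet s x G\<bar> \<le> C s * K * (\<theta>' * \<bar>x\<bar>) ^ N"
    by metis
  \<comment> \<open>The order \<open>s\<close> of the jet varies with \<open>n\<close> but stays at
    most \<open>H\<close>, so one sum bounds all the constants.\<close>
  define C1 where "C1 = (\<Sum>s\<le>H. C s)"
  have C1: "C s \<le> C1" if "s \<le> H" for s
    unfolding C1_def using that C(1) by (intro member_le_sum) auto
  define c where "c = 2 * (of_nat (Suc H) * h)"
  have c0: "c \<ge> 0" using h by (simp add: c_def)
  have mbt: "mult_bounded \<theta> (tden n) (c ^ n)" "mult_bounded \<theta> (tnum n i) (c ^ n)" for n i
  proof -
    have "1 \<le> \<theta>" "k > 0" using \<theta> k by simp_all
    note * = mult_bounded_transfer[OF this degAA hAA h]
    show "mult_bounded \<theta> (tden n) (c ^ n)" unfolding tden_def c_def by (rule *(1))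
    show "mult_bounded \<theta> (tnum n i) (c ^ n)" unfolding tnum_def c_def by (rule *(2))
  qed
  define Z where "Z = C1 * (of_nat d * K1)"
  have K1d: "K1 \<le> of_nat d * K1" using d K1 mult_right_mono[of 1 "real d" K1] by simp
  have jetQ: "\<bar>jet s x (Q n v)\<bar> \<le> Z * c ^ n" if "v \<in> B" "s \<le> H" for s n v
  proof -
    have tb: "\<bar>dil (k ^ n) (tuple_poly D v d) $ m\<bar> \<le> K1 * \<theta> ^ m" for m
    proof -
      have "\<bar>dil (k ^ n) (tuple_poly D v d) $ m\<bar> \<le> V"
        using V[OF that(1), of d] V0 by (simp add: dil_nth[OF kpos])
      also have "\<dots> \<le> K1 * 1" using K1 by simp
      also have "\<dots> \<le> K1 * \<theta> ^ m" using K1 \<theta> by (intro mult_left_mono one_le_power) auto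
      finally show ?thesis .
    qed
    have qb: "\<bar>Q n v $ m\<bar> \<le> c ^ n * K1 * \<theta> ^ m" for m
      unfolding Q_def by (rule mult_boundedD[OF mbt(1) K1(2) tb])
    have "\<bar>jet s x (Q n v)\<bar> \<le> C s * (c ^ n * K1) * (\<theta>' * \<bar>x\<bar>) ^ 0"
      using c0 K1 by (intro C(2) qb) (auto simp: ord_ge_def)
    also have "\<dots> \<le> C1 * (c ^ n * (of_nat d * K1)) * 1"
      using c0 K1 K1d C(1)[of s] C1[OF that(2)] by (intro mult_mono mult_nonneg_nonneg) auto
    finally show ?thesis by (simp add: Z_def mult_ac)
  qed
  have jetE: "\<bar>jet s x (\<Sum>i<d. tnum n i * dil (k ^ n) (tuple_poly D v d * f i - tuple_poly D v i))\<bar>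
      \<le> Z * c ^ n * ((\<theta>' * \<bar>x\<bar>) ^ M) ^ (k ^ n)" if "v \<in> B" "s \<le> H" and rn: "r \<le> \<theta> ^ (k ^ n)" for s n v
  proof -
    let ?R = "\<lambda>i. tuple_poly D v d * f i - tuple_poly D v i"
    \<comment> \<open>Dilation by \<open>k ^ n\<close> replaces the growth rate \<open>r\<close> of
      the coefficients by its \<open>k ^ n\<close>-th root. For large \<open>n\<close> this is below
      any fixed \<open>\<theta> > 1\<close>, so the radius of convergence leaves no trace in the
      exponents.\<close>
    have tb: "\<bar>dil (k ^ n) (?R i) $ m\<bar> \<le> K1 * \<theta> ^ m" if i: "i < d" for i m
    proof (cases "k ^ n dvd m")
      case True
      then obtain l where l: "m = k ^ n * l" by (rule dvdE)
      have "\<bar>dil (k ^ n) (?R i) $ m\<bar> = \<bar>?R i $ l\<bar>"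
        using l kpos[of n] by (simp add: dil_nth[OF kpos])
      also have "\<dots> \<le> K1 * r ^ l" by (rule rem_bound[OF \<open>v \<in> B\<close> i])
      also have "\<dots> \<le> K1 * (\<theta> ^ (k ^ n)) ^ l" using rn r K1 by (intro mult_left_mono power_mono) auto
      finally show ?thesis by (simp add: l power_mult)
    next
      case False
      then show ?thesis using K1 \<theta>0 by (simp add: dil_nth[OF kpos])
    qed
    have rb: "\<bar>(tnum n i * dil (k ^ n) (?R i)) $ m\<bar> \<le> c ^ n * K1 * \<theta> ^ m" if "i < d" for i m
      by (rule mult_boundedD[OF mbt(2) K1(2) tb[OF that]])
    have eb: "\<bar>(\<Sum>i<d. tnum n i * dil (k ^ n) (?R i)) $ m\<bar> \<le> (of_nat d * (c ^ n * K1)) * \<theta> ^ m" for m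
    proof -
      have "\<bar>(\<Sum>i<d. tnum n i * dil (k ^ n) (?R i)) $ m\<bar> \<le> (\<Sum>i<d. \<bar>(tnum n i * dil (k ^ n) (?R i)) $ m\<bar>)"
        unfolding fps_sum_nth by (rule sum_abs)
      also have "\<dots> \<le> (\<Sum>i<d. c ^ n * K1 * \<theta> ^ m)" using rb by (intro sum_mono) auto
      finally show ?thesis by (simp add: mult.assoc)
    qed
    have "ord_ge (k ^ n * M) (\<Sum>i<d. tnum n i * dil (k ^ n) (?R i))"
      using apprB[OF that(1)] by (intro ord_ge_sum ord_ge_mult ord_ge_dil kpos) auto
    then have "\<bar>jet s x (\<Sum>i<d. tnum n i * dil (k ^ n) (?R i))\<bar>
        \<le> C s * (of_nat d * (c ^ n * K1)) * (\<theta>' * \<bar>x\<bar>) ^ (k ^ n * M)"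
      using c0 K1 by (intro C(2) eb) auto
    also have "\<dots> \<le> C1 * (of_nat d * (c ^ n * K1)) * (\<theta>' * \<bar>x\<bar>) ^ (k ^ n * M)"
      using c0 K1 C1[OF that(2)] \<theta>'1 by (intro mult_right_mono) auto
    finally show ?thesis by (simp add: Z_def mult_ac power_mult)
  qed
  have "\<forall>\<^sub>F n in sequentially. r * 1 ^ n \<le> \<theta> ^ (k ^ n)"
    by (rule eventually_power_le_double_power[OF \<theta>(1) k])
  moreover have "\<forall>\<^sub>F n in sequentially. Z * c ^ n \<le> z ^ (k ^ n)"
    by (rule eventually_power_le_double_power[OF z(1) k])
  ultimately have "\<forall>\<^sub>F n in sequentially. r \<le> \<theta> ^ (k ^ n) \<and> Z * c ^ n \<le> z ^ (k ^ n)"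
    by eventually_elim simp
  then obtain n1 where n1: "\<And>n. n \<ge> n1 \<Longrightarrow> r \<le> \<theta> ^ (k ^ n) \<and> Z * c ^ n \<le> z ^ (k ^ n)"
    by (auto simp: eventually_sequentially)
  show ?thesis
    unfolding x_def[symmetric] G_def[symmetric] \<xi>_def[symmetric]
  proof (intro exI[of _ n1] allI impI)
    fix n :: nat and p :: int and q :: nat
    assume n: "n1 \<le> n" and q: "q > 0" and ne: "\<xi> \<noteq> of_int p / of_nat q"
    define N where "N = k ^ n"
    obtain s g0 where s: "s \<le> degree p0" "tden n = lin x ^ s * fps_of_poly g0" "poly g0 x \<noteq> 0"
      unfolding tden_def by (rule transfer_denom_order[where A = AA and x = x and n = n, OF p0 p00 x(1,2) k])
    have sH: "s \<le> H" using s degp0 by simp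
    \<comment> \<open>With \<open>\<nu> = p\<close> and \<open>\<kappa> = - q\<close> the functional
      is \<open>q\<close> times the value of the linear form at the rational point
      \<open>p / q\<close>; after multiplication by \<open>b ^ E\<close> it is a nonzero
      integer.\<close>
    have "real_of_int p + (- real q) * \<xi> \<noteq> 0" using ne q by (auto simp: field_simps)
    from nonvanishing[OF s(2,3) sH this] obtain v where v: "v \<in> B"
      and X0: "of_int p * jet s x (Q n v) + (- real q) * jet s x (P n v) \<noteq> 0" by blast
    define X where "X = of_int p * jet s x (Q n v) + (- real q) * jet s x (P n v)"
    define E where "E = (D + H) * N"
    have "of_int b ^ E * X = of_int p * (of_int b ^ E * jet s x (Q n v)) - of_nat q * (of_int b ^ E * jet s x (P n v))"
      by (simp add: X_def algebra_simps)
    moreover have "of_int b ^ E * jet s x (Q n v) \<in> \<int>" "of_int b ^ E * jet s x (P n v) \<in> \<int>"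
      unfolding x_def E_def N_def using intQP b degQ degP by (auto intro!: jet_integrality simp: int_fps_def)
    ultimately have "of_int b ^ E * X \<in> \<int>" by (auto intro!: Ints_diff Ints_mult)
    moreover have "of_int b ^ E * X \<noteq> 0" using X0 b by (simp add: X_def)
    ultimately have "1 \<le> \<bar>of_int b ^ E * X\<bar>" by (rule Ints_nonzero_abs_ge1)
    also have "\<dots> = z ^ (4 * E) * \<bar>X\<bar>" using z(1) by (simp add: zb abs_mult)
    also have "X = of_nat q * (jet s x (Q n v) * \<xi> - jet s x (P n v)) - of_nat q * jet s x (Q n v) * (\<xi> - of_int p / of_nat q)"
      using q by (simp add: X_def field_simps)
    also have "\<bar>\<dots>\<bar> \<le> of_nat q * \<bar>jet s x (Q n v) * \<xi> - jet s x (P n v)\<bar> + of_nat q * \<bar>jet s x (Q n v)\<bar> * \<bar>\<xi> - of_int p / of_nat q\<bar>"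
      by (rule order_trans[OF abs_triangle_ineq4]) (simp add: abs_mult)
    also have "\<dots> \<le> of_nat q * (z ^ N * ((\<theta>' * \<bar>x\<bar>) ^ M) ^ N) + of_nat q * z ^ N * \<bar>\<xi> - of_int p / of_nat q\<bar>"
    proof (intro add_mono mult_left_mono mult_right_mono)
      have Zc: "Z * c ^ n \<le> z ^ N" using n1[OF n] by (simp add: N_def)
      have "\<bar>jet s x (Q n v) * \<xi> - jet s x (P n v)\<bar> \<le> Z * c ^ n * ((\<theta>' * \<bar>x\<bar>) ^ M) ^ N"
        unfolding jet_remainder[OF s(2)] N_def using n1[OF n] by (intro jetE v sH) simp
      also have "\<dots> \<le> z ^ N * ((\<theta>' * \<bar>x\<bar>) ^ M) ^ N" using Zc \<theta>'1 by (intro mult_right_mono) auto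
      finally show "\<bar>jet s x (Q n v) * \<xi> - jet s x (P n v)\<bar> \<le> z ^ N * ((\<theta>' * \<bar>x\<bar>) ^ M) ^ N" .
      show "\<bar>jet s x (Q n v)\<bar> \<le> z ^ N" using jetQ[OF v sH, of n] Zc by linarith
    qed auto
    finally have "1 \<le> z ^ (4 * E) * (of_nat q * (z ^ N * ((\<theta>' * \<bar>x\<bar>) ^ M) ^ N) + of_nat q * z ^ N * \<bar>\<xi> - of_int p / of_nat q\<bar>)"
      using z(1) by (simp add: mult_left_mono)
    also have "\<dots> = of_nat q * (z ^ (4 * E) * z ^ N * ((\<theta>' * \<bar>x\<bar>) ^ M) ^ N) + of_nat q * (z ^ (4 * E) * z ^ N) * \<bar>\<xi> - of_int p / of_nat q\<bar>"
      by (simp add: algebra_simps)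
    also have "\<dots> \<le> of_nat q * (1 / (z ^ 2) ^ N) + of_nat q * (z ^ 2) ^ (2 * (D + H + 1) * N) * \<bar>\<xi> - of_int p / of_nat q\<bar>"
    proof (intro add_mono mult_left_mono mult_right_mono)
      have "z ^ (4 * E) * z ^ N * ((\<theta>' * \<bar>x\<bar>) ^ M) ^ N * (z ^ 2) ^ N = ((\<theta>' * \<bar>x\<bar>) ^ M * z ^ (4 * (D + H) + 3)) ^ N"
        by (simp add: E_def power_mult_distrib power_mult[symmetric] power_add[symmetric] algebra_simps)
      also have "\<dots> \<le> 1" using rate \<theta>'1 z by (intro power_le_one) auto
      finally show "z ^ (4 * E) * z ^ N * ((\<theta>' * \<bar>x\<bar>) ^ M) ^ N \<le> 1 / (z ^ 2) ^ N"
        using z by (simp add: field_simps)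
      have "z ^ (4 * E) * z ^ N = z ^ (4 * E + N)" by (simp add: power_add)
      also have "\<dots> \<le> z ^ (2 * (2 * (D + H + 1) * N))" using z by (intro power_increasing) (auto simp: E_def algebra_simps)
      also have "\<dots> = (z ^ 2) ^ (2 * (D + H + 1) * N)" by (rule power_mult)
      finally show "z ^ (4 * E) * z ^ N \<le> (z ^ 2) ^ (2 * (D + H + 1) * N)" .
    qed auto
    finally show "1 \<le> real q / (z ^ 2) ^ (k ^ n) + real q * (z ^ 2) ^ (2 * (D + H + 1) * k ^ n) * \<bar>\<xi> - of_int p / of_nat q\<bar>"
      by (simp add: N_def)
  qed
qed

section \<open>Choice of the parameters and comparison with the stated bound\<close>

theorem theorem5p3:
  fixes k d H :: nat and h a b :: int
    and A :: "nat \<Rightarrow> int poly" and F :: "int fps"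
  assumes "k \<ge> 2" and "d \<ge> 1"
    and "A 0 * A d \<noteq> 0"
    and "mahler_equation k d A F"
    and "H = Max (insert 1 ((\<lambda>i. degree (A i)) ` {..d}))"
    and "h = Max ((\<lambda>n. \<bar>fps_nth F n\<bar>) ` {..H} \<union> (\<Union>i\<le>d. abs ` set (coeffs (A i))))"
    and "a \<noteq> 0" and "b \<ge> 2"
    and "ereal (norm (real_of_int a / real_of_int b)) < fps_conv_radius (real_fps F)"
    and "ln (real_of_int \<bar>a\<bar>) / ln (real_of_int b)
           \<in> {0..<1 / (8 * real H ^ 2 * real d * real k ^ (2 * d + 1))}"
  shows "irrationality_exponent (eval_fps (real_fps F) (real_of_int a / real_of_int b))
           \<le> ereal ((4 * real d * real H * real_of_int h ^ 3)
                       ^ (1536 * H ^ 6 * k ^ (10 * d) * d ^ 2)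
                     * real k ^ (320 * H ^ 4 * k ^ (6 * d) * d ^ 2))"
proof -
  note k = assms(1) and d = assms(2) and b = assms(8)
  have A0: "A 0 \<noteq> 0" using assms(3) by auto
  have H: "H \<ge> 1" unfolding assms(5) by (intro Max_ge) auto
  have degA: "degree (A i) \<le> H" if "i \<le> d" for i
    unfolding assms(5) using that by (intro Max_ge) auto
  define S where "S = (\<lambda>n. \<bar>fps_nth F n\<bar>) ` {..H} \<union> (\<Union>i\<le>d. abs ` set (coeffs (A i)))"
  have finS: "finite S" by (auto simp: S_def)
  have hS: "s \<le> h" if "s \<in> S" for s using Max_ge[OF finS that] assms(6) by (simp add: S_def)
  have coeffs: "\<bar>coeff (A i) j\<bar> \<le> h" if "i \<le> d" "coeff (A i) j \<noteq> 0" for i j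
  proof (rule hS)
    have "coeff (A i) j \<in> set (coeffs (A i))" using that by (intro coeff_in_coeffs le_degree) auto
    then show "\<bar>coeff (A i) j\<bar> \<in> S" using that(1) unfolding S_def by blast
  qed
  have "lead_coeff (A 0) \<noteq> 0" using A0 by simp
  then have h: "h \<ge> 1" using coeffs[of 0 "degree (A 0)"] by linarith
  have coeffA: "\<bar>real_of_int (coeff (A i) j)\<bar> \<le> real_of_int h" if "i \<le> d" for i j
    using coeffs[OF that, of j] h by (cases "coeff (A i) j = 0") linarith+
  define M where "M = (2 * d + 2) * (k ^ (d + 1) * (4 * H)) + 1"
  have k1: "1 \<le> k ^ e" for e using k by simp
  define D where "D = M - 1 - 3 * H"
  have "1 * (1 * (4 * H)) \<le> (2 * d + 2) * (k ^ (d + 1) * (4 * H))"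
    by (intro mult_mono k1) auto
  then have D: "3 * H + D + 1 = M" unfolding D_def M_def by linarith
  define L where "L = 8 * H ^ 2 * d * k ^ (2 * d + 1)"
  define r where "r = ln (real_of_int \<bar>a\<bar>) / ln (real_of_int b)"
  have L1: "1 \<le> L" using H d k1[of "2*d+1"] by (simp add: L_def)
  have r: "0 \<le> r" "r * real L < 1"
  proof -
    have "real L = 8 * real H ^ 2 * real d * real k ^ (2 * d + 1)" by (simp add: L_def)
    then have "0 \<le> r" "r < 1 / real L" using assms(10) by (simp_all add: r_def)
    then show "0 \<le> r" "r * real L < 1" using L1 by (simp_all add: pos_less_divide_eq)
  qed
  have lnb: "ln (real_of_int b) > 0" using b by simp
  have lna: "ln (real_of_int \<bar>a\<bar>) = r * ln (real_of_int b)" using lnb by (simp add: r_def)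
  have a1: "real_of_int \<bar>a\<bar> > 0" using assms(7) by simp
  have "r * 1 \<le> r * real L" using r L1 by (intro mult_left_mono) auto
  then have "r < 1" using r by simp
  then have "ln (real_of_int \<bar>a\<bar>) < ln (real_of_int b)" using lna lnb by simp
  then have ab: "\<bar>a\<bar> < b" using a1 b by (subst (asm) ln_less_cancel_iff) auto
  \<comment> \<open>Together with \<open>r * L < 1\<close> this gives
    \<open>M * r \<le> 2 * H\<close>, that is, \<open>|a|^M \<le> b^(2 * H)\<close>. The inequality
    \<open>2 \<le> k ^ d\<close> turns \<open>k ^ (d + 1)\<close> into the
    \<open>k ^ (2 * d + 1)\<close> of \<open>L\<close>, and the factor \<open>H ^ 2\<close> of
    \<open>L\<close> is slack.\<close>
  have M_le: "M \<le> 2 * H * L"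
  proof -
    have "M \<le> 4 * d * (k ^ (d + 1) * (4 * H)) + 1" unfolding M_def using d by (intro add_mono mult_right_mono) auto
    also have "\<dots> \<le> 4 * d * (k ^ (d + 1) * (4 * H)) + 4 * d * (k ^ (d + 1) * (4 * H))"
      using d H k1[of "d+1"] by (intro add_left_mono) simp
    also have "\<dots> = 16 * H * d * (2 * k ^ (d + 1))" by simp
    also have "\<dots> \<le> 16 * H * d * (k ^ d * k ^ (d + 1))"
    proof (intro mult_left_mono mult_right_mono)
      show "2 \<le> k ^ d" using power_increasing[of 1 d k] k d by simp
    qed auto
    also have "\<dots> \<le> (16 * H * d * (k ^ d * k ^ (d + 1))) * H ^ 2" using H by simp
    also have "\<dots> = 2 * H * L" by (simp add: L_def power_add mult_2 power2_eq_square)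
    finally show ?thesis .
  qed
  have "real M * r \<le> real (2 * H * L) * r" using M_le r by (intro mult_right_mono) (simp_all only: of_nat_le_iff)
  also have "\<dots> = 2 * real H * (r * real L)" by simp
  also have "\<dots> \<le> 2 * real H * 1" using r by (intro mult_left_mono) auto
  finally have Mr: "real M * r \<le> real (2 * H)" by simp
  have aM: "real_of_int \<bar>a\<bar> ^ M \<le> real_of_int b ^ (2 * H)"
  proof -
    have "ln (real_of_int \<bar>a\<bar> ^ M) = (real M * r) * ln (real_of_int b)"
      using a1 by (simp only: ln_realpow lna mult.assoc)
    also have "\<dots> \<le> real (2 * H) * ln (real_of_int b)" using Mr lnb by (intro mult_right_mono) auto
    also have "\<dots> = ln (real_of_int b ^ (2 * H))" using b by (simp add: ln_realpow)
    finally show ?thesis using a1 b by (subst (asm) ln_le_cancel_iff) auto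
  qed
  have small: "\<bar>real_of_int a / real_of_int b\<bar> ^ M * real_of_int b ^ (D + H + 1) \<le> 1"
  proof -
    have "\<bar>real_of_int a / real_of_int b\<bar> ^ M * real_of_int b ^ (D + H + 1)
        = real_of_int \<bar>a\<bar> ^ M * real_of_int b ^ (D + H + 1) / real_of_int b ^ M"
      using b by (simp add: power_divide)
    also have "\<dots> \<le> real_of_int b ^ (2 * H) * real_of_int b ^ (D + H + 1) / real_of_int b ^ M"
      using aM b by (intro divide_right_mono mult_right_mono) auto
    also have "real_of_int b ^ (2 * H) * real_of_int b ^ (D + H + 1) = real_of_int b ^ M"
      unfolding power_add[symmetric] by (rule arg_cong[of _ _ "\<lambda>e. real_of_int b ^ e"]) (use D in simp)
    finally show ?thesis using b by simp
  qed
  define z where "z = root 4 (real_of_int b)"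
  have z: "z > 1" "z ^ 4 = real_of_int b" using b by (simp_all add: z_def)
  obtain n1 where n1: "\<And>n p q. n \<ge> n1 \<Longrightarrow> (q::nat) > 0 \<Longrightarrow>
     eval_fps (real_fps F) (of_int a / of_int b) \<noteq> of_int p / of_nat q \<Longrightarrow>
     1 \<le> real q / (z ^ 2) ^ (k ^ n) + real q * (z ^ 2) ^ (2 * (D + H + 1) * k ^ n)
           * \<bar>eval_fps (real_fps F) (of_int a / of_int b) - of_int p / of_nat q\<bar>"
    using mahler_linear_forms[OF k d H degA A0 coeffA _ assms(4,7) ab _ z M_def D small] h assms(9)
    by auto
  have "irrationality_exponent (eval_fps (real_fps F) (of_int a / of_int b)) \<le> ereal (real (k * (2 * (D + H + 1)) + 1))"
    by (rule irrationality_exponent_leI[OF _ k n1]) (use z in simp)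
  also have "\<dots> \<le> ereal ((4 * real d * real H * real_of_int h ^ 3)
                       ^ (1536 * H ^ 6 * k ^ (10 * d) * d ^ 2)
                     * real k ^ (320 * H ^ 4 * k ^ (6 * d) * d ^ 2))"
  proof -
    have "D + H + 1 \<le> M" using D H by linarith
    also have "M \<le> 4 * d * (k ^ (d + 1) * (4 * H)) + 4 * d * (k ^ (d + 1) * (4 * H))"
      unfolding M_def
    proof (rule add_mono)
      show "(2 * d + 2) * (k ^ (d + 1) * (4 * H)) \<le> 4 * d * (k ^ (d + 1) * (4 * H))"
        using d by (intro mult_right_mono) auto
      have "1 * (1 * 1) \<le> 4 * d * (k ^ (d + 1) * (4 * H))"
        using d H by (intro mult_mono k1) auto
      then show "1 \<le> 4 * d * (k ^ (d + 1) * (4 * H))" by linarith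
    qed
    finally have "k * (2 * (D + H + 1)) \<le> k * (2 * (4 * d * (k ^ (d + 1) * (4 * H)) + 4 * d * (k ^ (d + 1) * (4 * H))))"
      by (intro mult_left_mono) auto
    also have "\<dots> = 64 * (d * H * k ^ (d + 2))" by simp
    finally have "k * (2 * (D + H + 1)) \<le> 64 * (d * H * k ^ (d + 2))" .
    moreover have "1 * 1 * 1 \<le> d * H * k ^ (d + 2)" using d H by (intro mult_mono k1) auto
    ultimately have "k * (2 * (D + H + 1)) + 1 \<le> 65 * (d * H * k ^ (d + 2))" by linarith
    then have "real (k * (2 * (D + H + 1)) + 1) \<le> real (65 * (d * H * k ^ (d + 2)))"
      by (simp only: of_nat_le_iff)
    also have "\<dots> = 65 * real d * real H * real k ^ (d + 2)" by simp
    \<comment> \<open>The exponent obtained is linear in \<open>d * H * k ^ (d + 2)\<close>, far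
      below the stated bound. The two factors are compared separately: since
      \<open>h \<ge> 1\<close>, the first base is at least \<open>4 * d * H\<close>, and its fourth
      power already exceeds \<open>65 * d * H\<close>.\<close>
    also have "\<dots> \<le> (4 * real d * real H * real_of_int h ^ 3) ^ (1536 * H ^ 6 * k ^ (10 * d) * d ^ 2)
                     * real k ^ (320 * H ^ 4 * k ^ (6 * d) * d ^ 2)"
    proof (rule mult_mono)
      define X where "X = 4 * real d * real H * real_of_int h ^ 3"
      have dH: "1 \<le> real d * real H" using d H by (simp flip: of_nat_mult)
      have "1 \<le> real_of_int h ^ 3" using h by (intro one_le_power) simp
      then have X: "4 * (real d * real H) \<le> X"
        using mult_left_mono[of 1 "real_of_int h ^ 3" "4 * (real d * real H)"] dH by (simp add: X_def mult_ac)
      have "65 * real d * real H \<le> 4 ^ 3 * (4 * (real d * real H))" using dH by simp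
      also have "\<dots> \<le> X ^ 3 * X" using X dH by (intro mult_mono power_mono) auto
      also have "\<dots> = X ^ 4" by (simp add: eval_nat_numeral)
      also have "\<dots> \<le> X ^ (1536 * H ^ 6 * k ^ (10 * d) * d ^ 2)"
      proof (rule power_increasing)
        have "1 * 1 * 1 * 1 \<le> H ^ 6 * k ^ (10 * d) * d ^ 2 * 1" using H d k1[of "10 * d"] by (intro mult_mono) auto
        then show "4 \<le> 1536 * H ^ 6 * k ^ (10 * d) * d ^ 2" by (simp add: mult.assoc)
      qed (use X dH in linarith)
      finally show "65 * real d * real H \<le> (4 * real d * real H * real_of_int h ^ 3) ^ (1536 * H ^ 6 * k ^ (10 * d) * d ^ 2)"
        by (simp add: X_def)
      show "real k ^ (d + 2) \<le> real k ^ (320 * H ^ 4 * k ^ (6 * d) * d ^ 2)"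
      proof (rule power_increasing)
        have "1 * 1 * d \<le> H ^ 4 * k ^ (6 * d) * d ^ 2"
          using H d k1[of "6 * d"] by (intro mult_mono) (auto simp: power2_eq_square)
        then show "d + 2 \<le> 320 * H ^ 4 * k ^ (6 * d) * d ^ 2" using d by (simp add: mult.assoc)
      qed (use k in simp)
    qed (use h in auto)
    finally show ?thesis by simp
  qed
  finally show ?thesis .
qed

end
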